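(* Let $M$ be a ${\rm II}_1$-factor with separable predual and let ${\rm tr}$ be its unique normal trace with ${\rm tr}(I)=1$. Let $\mathfrak{N}_I$ be the unitary representation of the group ${\rm Inn}\,M$ of inner automorphisms of $M$ on $L^2(M,{\rm tr})$ determined by $\mathfrak{N}_I(\theta)x=\theta(x)$ for $x\in M\subset L^2(M,{\rm tr})$, and let $L_0=\{v\in L^2(M,{\rm tr}):{\rm tr}(v)=0\}$. Then the restriction $\mathfrak{N}_I^0$ of $\mathfrak{N}_I$ to the invariant subspace $L_0$ is irreducible.
   Context: $L^2(M,{\rm tr})$ is the completion of $M$ with respect to the inner product $\langle a,b\rangle={\rm tr}(b^*a)$; for $v\in L^2(M,{\rm tr})$, ${\rm tr}(v)$ means $\langle v,I\rangle$. $U(M)$ is the unitary group of $M$, ${\rm Ad}\,u(x)=uxu^*$, and ${\rm Inn}\,M=\{{\rm Ad}\,u:u\in U(M)\}$. Irreducible means that there is no nontrivial closed invariant subspace (equivalently, the commutant consists of scalars). *)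

theory Defs
  imports "HOL-Analysis.Analysis" "HOL-Algebra.Group"
begin

section \<open>Complex Hilbert spaces\<close>

class complex_vector = real_vector +
  fixes scaleC :: "complex \<Rightarrow> 'a \<Rightarrow> 'a"  (infixr "*\<^sub>C" 75)
  assumes scaleC_add_right: "c *\<^sub>C (x + y) = c *\<^sub>C x + c *\<^sub>C y"
    and scaleC_add_left: "(c + d) *\<^sub>C x = c *\<^sub>C x + d *\<^sub>C x"
    and scaleC_scaleC: "c *\<^sub>C (d *\<^sub>C x) = (c * d) *\<^sub>C x"
    and scaleR_scaleC: "r *\<^sub>R x = complex_of_real r *\<^sub>C x"

lemma scaleC_one: "1 *\<^sub>C x = (x :: 'a::complex_vector)"
  using scaleR_scaleC[of 1 x] by simp

text \<open>The inner product is linear in the first argument. The axiom \<open>cinner_self\<close> ties it to the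
  norm and yields positive definiteness.\<close>

class complex_hilbert = complex_vector + banach +
  fixes cinner :: "'a \<Rightarrow> 'a \<Rightarrow> complex"
  assumes cinner_commute: "cinner x y = cnj (cinner y x)"
    and cinner_add_left: "cinner (x + y) z = cinner x z + cinner y z"
    and cinner_scaleC_left: "cinner (c *\<^sub>C x) y = c * cinner x y"
    and cinner_self: "cinner x x = complex_of_real ((norm x)\<^sup>2)"

instantiation complex :: complex_hilbert
begin
definition scaleC_complex :: "complex \<Rightarrow> complex \<Rightarrow> complex" where
  "scaleC_complex c x = c * x"
definition cinner_complex :: "complex \<Rightarrow> complex \<Rightarrow> complex" where
  "cinner_complex x y = x * cnj y"
instance
proof
  fix x y z c d :: complex and r :: real
  show "c *\<^sub>C (x + y) = c *\<^sub>C x + c *\<^sub>C y"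
    by (simp add: scaleC_complex_def distrib_left)
  show "(c + d) *\<^sub>C x = c *\<^sub>C x + d *\<^sub>C x"
    by (simp add: scaleC_complex_def distrib_right)
  show "c *\<^sub>C (d *\<^sub>C x) = (c * d) *\<^sub>C x"
    by (simp add: scaleC_complex_def mult.assoc)
  show "r *\<^sub>R x = complex_of_real r *\<^sub>C x"
    by (simp add: scaleC_complex_def scaleR_conv_of_real)
  show "cinner x y = cnj (cinner y x)"
    by (simp add: cinner_complex_def mult.commute)
  show "cinner (x + y) z = cinner x z + cinner y z"
    by (simp add: cinner_complex_def distrib_right)
  show "cinner (c *\<^sub>C x) y = c * cinner x y"
    by (simp add: cinner_complex_def scaleC_complex_def mult.assoc)
  show "cinner x x = complex_of_real ((norm x)\<^sup>2)"
    unfolding cinner_complex_def by (rule complex_norm_square[symmetric])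
qed
end

definition closed_csubspace :: "'a::complex_hilbert set \<Rightarrow> bool" where
  "closed_csubspace S \<longleftrightarrow> closed S \<and> 0 \<in> S \<and> (\<forall>x\<in>S. \<forall>y\<in>S. x + y \<in> S) \<and>
     (\<forall>c. \<forall>x\<in>S. c *\<^sub>C x \<in> S)"


section \<open>Bounded complex-linear operators\<close>

typedef (overloaded) 'a bop =
  "{f :: 'a::complex_hilbert \<Rightarrow> 'a. bounded_linear f \<and> (\<forall>c x. f (c *\<^sub>C x) = c *\<^sub>C f x)}"
  morphisms bop_apply Bop
  by (rule exI[of _ "\<lambda>x. x"]) auto

setup_lifting type_definition_bop

lemma bounded_linear_scaleC: "bounded_linear (\<lambda>x::'a::complex_hilbert. c *\<^sub>C x)"
proof (rule bounded_linear_intro[where K = "cmod c"])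
  fix x y :: 'a and r :: real
  show "c *\<^sub>C (x + y) = c *\<^sub>C x + c *\<^sub>C y"
    by (rule scaleC_add_right)
  show "c *\<^sub>C (r *\<^sub>R x) = r *\<^sub>R (c *\<^sub>C x)"
    by (simp add: scaleR_scaleC scaleC_scaleC mult.commute)
  have "cinner (c *\<^sub>C x) (c *\<^sub>C x) = c * cnj c * cinner x x"
    by (metis cinner_commute cinner_scaleC_left complex_cnj_mult mult.assoc mult.commute)
  then have "complex_of_real ((norm (c *\<^sub>C x))\<^sup>2) = complex_of_real ((norm x * cmod c)\<^sup>2)"
    by (simp add: cinner_self complex_norm_square[symmetric] power_mult_distrib mult.commute)
  then have "(norm (c *\<^sub>C x))\<^sup>2 = (norm x * cmod c)\<^sup>2"
    by (simp only: of_real_eq_iff)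
  then show "norm (c *\<^sub>C x) \<le> norm x * cmod c"
    by (simp add: power2_eq_iff_nonneg)
qed

instantiation bop :: (complex_hilbert) ring
begin
lift_definition zero_bop :: "'a bop" is "\<lambda>x. 0"
  by (simp add: linear_0[OF bounded_linear.linear[OF bounded_linear_scaleC]])
lift_definition plus_bop :: "'a bop \<Rightarrow> 'a bop \<Rightarrow> 'a bop" is "\<lambda>f g x. f x + g x"
  by (auto simp: bounded_linear_add scaleC_add_right)
lift_definition uminus_bop :: "'a bop \<Rightarrow> 'a bop" is "\<lambda>f x. - f x"
  by (auto simp: bounded_linear_minus linear_neg[OF bounded_linear.linear[OF bounded_linear_scaleC]])
lift_definition minus_bop :: "'a bop \<Rightarrow> 'a bop \<Rightarrow> 'a bop" is "\<lambda>f g x. f x - g x"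
  by (auto simp: bounded_linear_sub linear_diff[OF bounded_linear.linear[OF bounded_linear_scaleC]])
lift_definition times_bop :: "'a bop \<Rightarrow> 'a bop \<Rightarrow> 'a bop" is "\<lambda>f g x. f (g x)"
  by (auto simp: bounded_linear_compose)
instance
proof
  fix f g h :: "'a bop"
  show "f * g * h = f * (g * h)" by transfer simp
  show "f + g + h = f + (g + h)" by transfer (simp add: add.assoc)
  show "f + g = g + f" by transfer (simp add: add.commute)
  show "0 + f = f" by transfer simp
  show "- f + f = 0" by transfer simp
  show "f - g = f + - g" by transfer simp
  show "(f + g) * h = f * h + g * h" by transfer simp
  show "f * (g + h) = f * g + f * h"
    by transfer (auto simp: linear_add[OF bounded_linear.linear])
qed
end

instantiation bop :: (complex_hilbert) monoid_mult
begin
lift_definition one_bop :: "'a bop" is "\<lambda>x. x"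
  by auto
instance
  by standard (transfer; simp)+
end

instantiation bop :: (complex_hilbert) complex_vector
begin
lift_definition scaleC_bop :: "complex \<Rightarrow> 'a bop \<Rightarrow> 'a bop" is "\<lambda>c f x. c *\<^sub>C f x"
  by (auto simp: scaleC_scaleC mult.commute bounded_linear_compose[OF bounded_linear_scaleC])
definition scaleR_bop :: "real \<Rightarrow> 'a bop \<Rightarrow> 'a bop" where
  "scaleR_bop r f = complex_of_real r *\<^sub>C f"
instance
proof
  fix f g :: "'a bop" and c d :: complex and a b :: real
  show add: "c *\<^sub>C (f + g) = c *\<^sub>C f + c *\<^sub>C g" for c
    by transfer (simp add: scaleC_add_right)
  show add': "(c + d) *\<^sub>C f = c *\<^sub>C f + d *\<^sub>C f" for c d
    by transfer (simp add: scaleC_add_left)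
  show assoc: "c *\<^sub>C (d *\<^sub>C f) = (c * d) *\<^sub>C f" for c d
    by transfer (simp add: scaleC_scaleC)
  show "a *\<^sub>R f = complex_of_real a *\<^sub>C f"
    by (fact scaleR_bop_def)
  show "a *\<^sub>R (f + g) = a *\<^sub>R f + a *\<^sub>R g"
    by (simp add: scaleR_bop_def add)
  show "(a + b) *\<^sub>R f = a *\<^sub>R f + b *\<^sub>R f"
    by (simp add: scaleR_bop_def add')
  show "a *\<^sub>R b *\<^sub>R f = (a * b) *\<^sub>R f"
    by (simp add: scaleR_bop_def assoc)
  show "1 *\<^sub>R f = f"
    unfolding scaleR_bop_def by transfer (simp add: scaleC_one)
qed
end

text \<open>Such an operator exists and is unique by the Riesz representation theorem.\<close>

definition adj :: "'a::complex_hilbert bop \<Rightarrow> 'a bop" where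
  "adj x = (THE y. \<forall>\<xi> \<eta>. cinner (bop_apply x \<xi>) \<eta> = cinner \<xi> (bop_apply y \<eta>))"

definition unitary_op :: "'a::complex_hilbert bop \<Rightarrow> bool" where
  "unitary_op u \<longleftrightarrow> adj u * u = 1 \<and> u * adj u = 1"

definition projection_op :: "'a::complex_hilbert bop \<Rightarrow> bool" where
  "projection_op p \<longleftrightarrow> p * p = p \<and> adj p = p"


section \<open>Von Neumann algebras and factors of type \<open>II\<^sub>1\<close>\<close>

definition commutant :: "'a::complex_hilbert bop set \<Rightarrow> 'a bop set" where
  "commutant S = {y. \<forall>x\<in>S. x * y = y * x}"

definition von_neumann_algebra :: "'a::complex_hilbert bop set \<Rightarrow> bool" where
  "von_neumann_algebra M \<longleftrightarrow> (\<forall>x\<in>M. adj x \<in> M) \<and> commutant (commutant M) = M"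

definition factor :: "'a::complex_hilbert bop set \<Rightarrow> bool" where
  "factor M \<longleftrightarrow> von_neumann_algebra M \<and> M \<inter> commutant M = range (\<lambda>c. c *\<^sub>C 1)"

definition mvn_equivalent :: "'a::complex_hilbert bop set \<Rightarrow> 'a bop \<Rightarrow> 'a bop \<Rightarrow> bool" where
  "mvn_equivalent M p q \<longleftrightarrow> (\<exists>v\<in>M. adj v * v = p \<and> v * adj v = q)"

definition finite_projection :: "'a::complex_hilbert bop set \<Rightarrow> 'a bop \<Rightarrow> bool" where
  "finite_projection M p \<longleftrightarrow> p \<in> M \<and> projection_op p \<and>
     (\<forall>q\<in>M. projection_op q \<and> p * q = q \<and> mvn_equivalent M q p \<longrightarrow> q = p)"

definition abelian_projection :: "'a::complex_hilbert bop set \<Rightarrow> 'a bop \<Rightarrow> bool" where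
  "abelian_projection M p \<longleftrightarrow> p \<in> M \<and> projection_op p \<and>
     (\<forall>x\<in>M. \<forall>y\<in>M. (p * x * p) * (p * y * p) = (p * y * p) * (p * x * p))"

definition II1_factor :: "'a::complex_hilbert bop set \<Rightarrow> bool" where
  "II1_factor M \<longleftrightarrow> factor M \<and> finite_projection M 1 \<and> (\<forall>p. abelian_projection M p \<longrightarrow> p = 0)"


section \<open>The predual and normal traces\<close>

definition square_summable :: "(nat \<Rightarrow> 'a::complex_hilbert) \<Rightarrow> bool" where
  "square_summable \<xi> \<longleftrightarrow> summable (\<lambda>n. (norm (\<xi> n))\<^sup>2)"

definition ultraweak :: "'a::complex_hilbert bop topology" where
  "ultraweak = topology_generated_by
     {{x. (\<Sum>n. cinner (bop_apply x (\<xi> n)) (\<eta> n)) \<in> U} | \<xi> \<eta> U.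
        square_summable \<xi> \<and> square_summable \<eta> \<and> open U}"

definition clinear_on :: "'a::complex_vector set \<Rightarrow> ('a \<Rightarrow> 'b::complex_vector) \<Rightarrow> bool" where
  "clinear_on M f \<longleftrightarrow> (\<forall>x\<in>M. \<forall>y\<in>M. f (x + y) = f x + f y) \<and> (\<forall>c. \<forall>x\<in>M. f (c *\<^sub>C x) = c *\<^sub>C f x)"

text \<open>Functionals are total functions of which only the values on \<open>M\<close> matter.\<close>

definition predual :: "'a::complex_hilbert bop set \<Rightarrow> ('a bop \<Rightarrow> complex) set" where
  "predual M = {\<phi>. clinear_on M \<phi> \<and> continuous_map (subtopology ultraweak M) euclidean \<phi>}"

text \<open>Separability for the norm of functionals on \<open>M\<close>, the supremum over the unit ball of \<open>M\<close>.\<close>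

definition separable_predual :: "'a::complex_hilbert bop set \<Rightarrow> bool" where
  "separable_predual M \<longleftrightarrow>
     (\<exists>D \<subseteq> predual M. countable D \<and>
        (\<forall>\<phi>\<in>predual M. \<forall>\<epsilon>>0. \<exists>\<psi>\<in>D. \<forall>x\<in>M. onorm (bop_apply x) \<le> 1 \<longrightarrow> cmod (\<phi> x - \<psi> x) \<le> \<epsilon>))"

definition normal_trace :: "'a::complex_hilbert bop set \<Rightarrow> ('a bop \<Rightarrow> complex) \<Rightarrow> bool" where
  "normal_trace M tr \<longleftrightarrow> tr \<in> predual M \<and> (\<forall>x\<in>M. tr (adj x * x) \<in> \<real>\<^sub>\<ge>\<^sub>0) \<and>
     (\<forall>x\<in>M. \<forall>y\<in>M. tr (x * y) = tr (y * x))"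

text \<open>The space \<open>'k\<close> is the completion of \<open>M\<close> for \<open>\<langle>a, b\<rangle> = tr(b\<^sup>*a)\<close>, with \<open>\<iota>\<close> the canonical
  map of \<open>M\<close> onto a dense subspace. This determines \<open>'k\<close> and \<open>\<iota>\<close> up to a unique unitary.\<close>

definition L2_completion ::
  "'a::complex_hilbert bop set \<Rightarrow> ('a bop \<Rightarrow> complex) \<Rightarrow> ('a bop \<Rightarrow> 'k::complex_hilbert) \<Rightarrow> bool" where
  "L2_completion M tr \<iota> \<longleftrightarrow> clinear_on M \<iota> \<and>
     (\<forall>a\<in>M. \<forall>b\<in>M. cinner (\<iota> a) (\<iota> b) = tr (adj b * a)) \<and> closure (\<iota> ` M) = UNIV"


section \<open>Unitary representations\<close>

definition unitary_group :: "'k::complex_hilbert bop monoid" where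
  "unitary_group = \<lparr>carrier = {u. unitary_op u}, mult = (*), one = 1\<rparr>"

definition unitary_rep :: "('g, 'm) monoid_scheme \<Rightarrow> ('g \<Rightarrow> 'k::complex_hilbert bop) \<Rightarrow> bool" where
  "unitary_rep G \<pi> \<longleftrightarrow> \<pi> \<in> hom G unitary_group"

definition invariant_subspace ::
  "('g, 'm) monoid_scheme \<Rightarrow> ('g \<Rightarrow> 'k::complex_hilbert bop) \<Rightarrow> 'k set \<Rightarrow> bool" where
  "invariant_subspace G \<pi> S \<longleftrightarrow> closed_csubspace S \<and> (\<forall>g\<in>carrier G. bop_apply (\<pi> g) ` S \<subseteq> S)"

text \<open>\<open>L\<close> is invariant and the restriction of \<open>\<pi>\<close> to \<open>L\<close> is irreducible.\<close>

definition irreducible_on ::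
  "('g, 'm) monoid_scheme \<Rightarrow> ('g \<Rightarrow> 'k::complex_hilbert bop) \<Rightarrow> 'k set \<Rightarrow> bool" where
  "irreducible_on G \<pi> L \<longleftrightarrow> invariant_subspace G \<pi> L \<and>
     (\<forall>S. invariant_subspace G \<pi> S \<and> S \<subseteq> L \<longrightarrow> S = {0} \<or> S = L)"

text \<open>Automorphisms of \<open>M\<close> are extensional functions on \<open>M\<close>.\<close>

definition Ad :: "'a::complex_hilbert bop set \<Rightarrow> 'a bop \<Rightarrow> 'a bop \<Rightarrow> 'a bop" where
  "Ad M u = (\<lambda>x\<in>M. u * x * adj u)"

definition Inn :: "'a::complex_hilbert bop set \<Rightarrow> ('a bop \<Rightarrow> 'a bop) monoid" where
  "Inn M = \<lparr>carrier = {Ad M u | u. u \<in> M \<and> unitary_op u}, mult = compose M, one = (\<lambda>x\<in>M. x)\<rparr>"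

text \<open>Density of \<open>\<iota> ` M\<close> makes the operator unique.\<close>

definition inner_rep ::
  "'a::complex_hilbert bop set \<Rightarrow> ('a bop \<Rightarrow> 'k::complex_hilbert) \<Rightarrow> ('a bop \<Rightarrow> 'a bop) \<Rightarrow> 'k bop" where
  "inner_rep M \<iota> \<theta> = (THE T. \<forall>x\<in>M. bop_apply T (\<iota> x) = \<iota> (\<theta> x))"

end

theory Submission imports Defs begin

text \<open>
  Let \<open>S \<subseteq> L\<^sub>0\<close> be a closed invariant subspace. Differentiating \<open>s \<mapsto> u s u\<^sup>*\<close> along unitaries close
  to 1 shows that \<open>x s - s x \<in> S\<close> for \<open>x \<in> M\<close> and \<open>s \<in> S\<close>. Choose nonzero self-adjoint \<open>a, b \<in> M\<close> with
  \<open>a b = 0\<close>. Iterated commutators give \<open>a x a\<^sup>3 s b\<^sup>2 y b \<in> S\<close> for all \<open>x, y \<in> M\<close>. A nonzero closed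
  sub-bimodule of \<open>L\<^sup>2(M)\<close> is everything, as the component of 1 in it is a central vector, hence a
  scalar. So if some \<open>a\<^sup>3 s b\<^sup>2\<close> is nonzero, then \<open>a L\<^sup>2(M) b \<subseteq> S\<close>, and \<open>a t b = 0\<close> for all \<open>t\<close> in the
  orthogonal complement of \<open>S\<close>. In either case one of \<open>S\<close> and its complement is a
  commutator-invariant space annihilated by \<open>t \<mapsto> p t q\<close> with \<open>p, q \<noteq> 0\<close>; such a space consists of
  scalars because \<open>M\<close> has no minimal projections.
\<close>

text \<open>Elements of \<open>S\<close> are vectors of the completion, not operators, so a product
  such as \<open>a s b\<close> is read through the bounded operators \<open>lm\<close> and
  \<open>rm\<close>, which extend left and right multiplication from \<open>M\<close>. The trace is
  not assumed faithful: injectivity of \<open>\<iota>\<close> is derived from normality and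
  factoriality before a vector identity can be turned back into an identity in \<open>M\<close>. Nor
  is a central vector known to come from \<open>M\<close>; it is therefore paired with averages of
  an element of \<open>M\<close>, which stay bounded and so have their limit in \<open>M\<close>.
  Instead of spectral theory, square roots of \<open>1 - k\<close> for self-adjoint contractions
  \<open>k\<close> provide unitaries, absolute values and norm estimates. Hence \<open>a\<close> and
  \<open>b\<close> are merely self-adjoint, not projections, and powers survive: iterated
  commutators first isolate \<open>a\<^sup>2 s b\<close>, and commutators with \<open>a x a\<close>
  and \<open>b y b\<close> then raise the exponents to 3 and 2. The free factors \<open>x\<close>
  and \<open>y\<close> are what lets the bimodule argument start.\<close>

section \<open>Hilbert space geometry\<close>

lemma cinner_add_right: "cinner z (x + y) = cinner z x + cinner z (y :: 'a::complex_hilbert)"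
  by (metis cinner_add_left cinner_commute complex_cnj_add)

lemma cinner_scaleC_right: "cinner x (c *\<^sub>C y) = cnj c * cinner x (y :: 'a::complex_hilbert)"
  by (metis cinner_scaleC_left cinner_commute complex_cnj_mult)

lemma scaleC_zero_right [simp]: "c *\<^sub>C 0 = (0 :: 'a::complex_vector)"
  using scaleC_add_right[of c 0 0] by simp

lemma scaleC_zero_left [simp]: "0 *\<^sub>C x = (0 :: 'a::complex_vector)"
  using scaleC_add_left[of 0 0 x] by simp

lemma scaleC_minus_right: "c *\<^sub>C (- x) = - (c *\<^sub>C (x :: 'a::complex_vector))"
  using scaleC_add_right[of c x "- x"] by (simp add: eq_neg_iff_add_eq_0 add.commute)

lemma scaleC_minus_left: "(- c) *\<^sub>C x = - (c *\<^sub>C (x :: 'a::complex_vector))"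
  using scaleC_add_left[of c "- c" x] by (simp add: eq_neg_iff_add_eq_0 add.commute)

lemma scaleC_diff_right: "c *\<^sub>C (x - y) = c *\<^sub>C x - c *\<^sub>C (y :: 'a::complex_vector)"
  using scaleC_add_right[of c x "- y"] by (simp add: scaleC_minus_right)

lemma scaleC_diff_left: "(c - d) *\<^sub>C x = c *\<^sub>C x - d *\<^sub>C (x :: 'a::complex_vector)"
  using scaleC_add_left[of c "- d" x] by (simp add: scaleC_minus_left)

lemma scaleC_minus_one: "(- 1) *\<^sub>C x = - (x :: 'a::complex_vector)"
  by (simp add: scaleC_minus_left scaleC_one)

lemma cinner_zero_left [simp]: "cinner 0 (x :: 'a::complex_hilbert) = 0"
  using cinner_add_left[of 0 0 x] by simp

lemma cinner_zero_right [simp]: "cinner (x :: 'a::complex_hilbert) 0 = 0"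
  using cinner_add_right[of x 0 0] by simp

lemma cinner_minus_left: "cinner (- x) y = - cinner x (y :: 'a::complex_hilbert)"
  using cinner_add_left[of x "- x" y] by (simp add: eq_neg_iff_add_eq_0 add.commute)

lemma cinner_minus_right: "cinner x (- y) = - cinner x (y :: 'a::complex_hilbert)"
  using cinner_add_right[of x y "- y"] by (simp add: eq_neg_iff_add_eq_0 add.commute)

lemma cinner_diff_left: "cinner (x - y) z = cinner x z - cinner y (z :: 'a::complex_hilbert)"
  using cinner_add_left[of x "- y" z] by (simp add: cinner_minus_left)

lemma cinner_diff_right: "cinner z (x - y) = cinner z x - cinner z (y :: 'a::complex_hilbert)"
  using cinner_add_right[of z x "- y"] by (simp add: cinner_minus_right)

lemma cinner_scaleR_left: "cinner (r *\<^sub>R x) y = of_real r * cinner x (y :: 'a::complex_hilbert)"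
  by (simp add: scaleR_scaleC cinner_scaleC_left)

lemma cinner_scaleR_right: "cinner x (r *\<^sub>R y) = of_real r * cinner x (y :: 'a::complex_hilbert)"
  by (simp add: scaleR_scaleC cinner_scaleC_right)

lemmas cinner_simps = cinner_add_left cinner_add_right cinner_diff_left cinner_diff_right
  cinner_minus_left cinner_minus_right cinner_scaleC_left cinner_scaleC_right
  cinner_scaleR_left cinner_scaleR_right

lemma cinner_self_eq_0_iff: "cinner x x = 0 \<longleftrightarrow> x = (0 :: 'a::complex_hilbert)"
  by (simp add: cinner_self)

lemma power2_norm_eq_cinner: "(norm x)\<^sup>2 = Re (cinner x (x :: 'a::complex_hilbert))"
  by (simp add: cinner_self)

lemma cinner_eq_zero_commute: "cinner x y = 0 \<longleftrightarrow> cinner y (x :: 'a::complex_hilbert) = 0"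
  by (metis cinner_commute complex_cnj_zero)

lemma norm_scaleC: "norm (c *\<^sub>C x) = cmod c * norm (x :: 'a::complex_hilbert)"
proof -
  have "cinner (c *\<^sub>C x) (c *\<^sub>C x) = (c * cnj c) * cinner x x"
    by (simp add: cinner_simps)
  also have "\<dots> = of_real ((cmod c * norm x)\<^sup>2)"
    by (simp add: cinner_self power_mult_distrib complex_norm_square[symmetric])
  finally have "cinner (c *\<^sub>C x) (c *\<^sub>C x) = of_real ((cmod c * norm x)\<^sup>2)" .
  then have "(norm (c *\<^sub>C x))\<^sup>2 = (cmod c * norm x)\<^sup>2"
    unfolding cinner_self of_real_eq_iff .
  then show ?thesis by (simp add: power2_eq_iff_nonneg)
qed

lemma norm_diff_square:
  "(norm (x - y))\<^sup>2 = (norm x)\<^sup>2 + (norm y)\<^sup>2 - 2 * Re (cinner x (y :: 'a::complex_hilbert))"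
  using cinner_commute[of y x] by (simp add: power2_norm_eq_cinner cinner_simps)

lemma norm_add_square:
  "(norm (x + y))\<^sup>2 = (norm x)\<^sup>2 + (norm y)\<^sup>2 + 2 * Re (cinner x (y :: 'a::complex_hilbert))"
  using cinner_commute[of y x] by (simp add: power2_norm_eq_cinner cinner_simps)

lemma Cauchy_Schwarz: "cmod (cinner x y) \<le> norm x * norm (y :: 'a::complex_hilbert)"
proof (cases "y = 0")
  case False
  define c where "c = cinner x y / of_real ((norm y)\<^sup>2)"
  have ny: "norm y > 0" using False by simp
  have cny: "c * of_real ((norm y)\<^sup>2) = cinner x y"
    unfolding c_def using ny by simp
  have "cinner (x - c *\<^sub>C y) (x - c *\<^sub>C y)
      = cinner x x - cnj c * cinner x y - c * cinner y x + c * cnj c * cinner y y"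
    by (simp add: cinner_simps algebra_simps)
  also have "\<dots> = cinner x x - cnj c * cinner x y"
  proof -
    have "c * cnj c * cinner y y = c * cnj (cinner x y)"
      using cny by (simp add: cinner_self mult_ac flip: cny)
    then show ?thesis using cinner_commute[of y x] by simp
  qed
  also have "\<dots> = of_real ((norm x)\<^sup>2 - (cmod (cinner x y))\<^sup>2 / (norm y)\<^sup>2)"
    unfolding c_def by (simp add: cinner_self complex_norm_square[symmetric] mult.commute[of "cnj _"])
  finally have "(norm (x - c *\<^sub>C y))\<^sup>2 = (norm x)\<^sup>2 - (cmod (cinner x y))\<^sup>2 / (norm y)\<^sup>2"
    unfolding cinner_self of_real_eq_iff .
  then have "(cmod (cinner x y))\<^sup>2 / (norm y)\<^sup>2 \<le> (norm x)\<^sup>2"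
    by (metis zero_le_power2 diff_ge_0_iff_ge)
  then have "(cmod (cinner x y))\<^sup>2 \<le> (norm x * norm y)\<^sup>2"
    using ny by (simp add: divide_le_eq power_mult_distrib)
  then show ?thesis
    by (rule power2_le_imp_le) simp
qed simp

lemma bounded_linear_cinner_left: "bounded_linear (\<lambda>x. cinner x (y :: 'a::complex_hilbert))"
  by (rule bounded_linear_intro[where K = "norm y"])
    (auto simp: cinner_simps Cauchy_Schwarz scaleR_conv_of_real)

lemma bounded_linear_cinner_right: "bounded_linear (\<lambda>x. cinner (y :: 'a::complex_hilbert) x)"
  by (rule bounded_linear_intro[where K = "norm y"])
    (auto simp: cinner_simps scaleR_conv_of_real mult.commute[of "norm _" "norm y"] Cauchy_Schwarz)

section \<open>Minimal norm in convex sets and orthogonal projection\<close>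

lemma parallelogram:
  "(norm (x + y))\<^sup>2 + (norm (x - y))\<^sup>2 = 2 * (norm x)\<^sup>2 + 2 * (norm (y :: 'a::complex_hilbert))\<^sup>2"
  by (simp add: norm_diff_square norm_add_square)

text \<open>The midpoint of \<open>x\<close> and \<open>y\<close> stays in \<open>Q\<close>, so the
  parallelogram law makes any two nearly minimal vectors close to each other.\<close>

lemma convex_norm_diff_bound:
  fixes Q :: "'a::complex_hilbert set"
  assumes "convex Q" "x \<in> Q" "y \<in> Q" "\<And>z. z \<in> Q \<Longrightarrow> d \<le> norm z" "0 \<le> d"
  shows "(norm (x - y))\<^sup>2 \<le> 2 * (norm x)\<^sup>2 + 2 * (norm y)\<^sup>2 - 4 * d\<^sup>2"
proof -
  have "(1/2) *\<^sub>R x + (1/2) *\<^sub>R y \<in> Q"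
    using assms(1,2,3) by (rule convexD) auto
  then have "d \<le> norm ((1/2) *\<^sub>R (x + y))"
    using assms(4) by (simp add: scaleR_add_right)
  then have "2 * d \<le> norm (x + y)" by simp
  then have "(2 * d)\<^sup>2 \<le> (norm (x + y))\<^sup>2" using assms(5) by (intro power_mono) auto
  then show ?thesis using parallelogram[of x y] by (simp add: power_mult_distrib)
qed

lemma convex_minimal_norm:
  fixes Q :: "'a::complex_hilbert set"
  assumes Q: "closed Q" "convex Q" "Q \<noteq> {}"
  obtains w where "w \<in> Q" "\<And>z. z \<in> Q \<Longrightarrow> norm w \<le> norm z"
    "\<And>z. z \<in> Q \<Longrightarrow> norm z \<le> norm w \<Longrightarrow> z = w"
proof -
  define d where "d = Inf (norm ` Q)"
  have bdd: "bdd_below (norm ` Q)" by (rule bdd_belowI2[of _ 0]) simp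
  have dle: "d \<le> norm z" if "z \<in> Q" for z
    unfolding d_def using that bdd by (intro cInf_lower) auto
  have d0: "0 \<le> d" unfolding d_def using Q(3) by (intro cInf_greatest) auto
  have "\<exists>z\<in>Q. norm z < d + inverse (real (Suc n))" for n
  proof -
    have "\<exists>r\<in>norm ` Q. r < d + inverse (real (Suc n))"
      unfolding d_def using Q(3) bdd by (subst cInf_less_iff[symmetric]) auto
    then show ?thesis by blast
  qed
  then obtain z where z: "\<And>n. z n \<in> Q" "\<And>n. norm (z n) < d + inverse (real (Suc n))" by metis
  have nz: "(\<lambda>n. norm (z n)) \<longlonglongrightarrow> d"
  proof (rule tendsto_sandwich[of "\<lambda>_. d" _ _ "\<lambda>n. d + inverse (real (Suc n))"])
    show "(\<lambda>n. d + inverse (real (Suc n))) \<longlonglongrightarrow> d"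
      using LIMSEQ_inverse_real_of_nat_add[of d] by simp
    show "\<forall>\<^sub>F n in sequentially. norm (z n) \<le> d + inverse (real (Suc n))"
      using z(2) by (intro always_eventually allI less_imp_le)
    show "\<forall>\<^sub>F n in sequentially. d \<le> norm (z n)" using z(1) dle by simp
  qed simp
  have "Cauchy z"
  proof (rule metric_CauchyI)
    fix e :: real assume e: "0 < e"
    \<comment> \<open>The margin \<open>e\<^sup>2 / 4\<close> enters the bound for two vectors with
      factor 2 each, so the squared distance stays below \<open>e\<^sup>2\<close>.\<close>
    have "(\<lambda>n. (norm (z n))\<^sup>2) \<longlonglongrightarrow> d\<^sup>2" by (intro tendsto_intros nz)
    then have "\<forall>\<^sub>F n in sequentially. (norm (z n))\<^sup>2 < d\<^sup>2 + e\<^sup>2 / 4"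
      by (rule order_tendstoD) (use e in simp)
    then obtain N where N: "\<And>n. n \<ge> N \<Longrightarrow> (norm (z n))\<^sup>2 < d\<^sup>2 + e\<^sup>2 / 4"
      by (auto simp: eventually_sequentially)
    show "\<exists>N. \<forall>m\<ge>N. \<forall>n\<ge>N. dist (z m) (z n) < e"
    proof (intro exI allI impI)
      fix m n assume "m \<ge> N" "n \<ge> N"
      then have "(norm (z m - z n))\<^sup>2 < e\<^sup>2"
        using convex_norm_diff_bound[OF Q(2) z(1)[of m] z(1)[of n] dle d0] N[of m] N[of n] by simp
      then show "dist (z m) (z n) < e" using e by (simp add: dist_norm power2_less_imp_less)
    qed
  qed
  then obtain w where w: "z \<longlonglongrightarrow> w" by (auto simp: Cauchy_convergent_iff convergent_def)
  have wQ: "w \<in> Q" using Q(1) z(1) w by (meson closed_sequentially)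
  have nw: "norm w = d" using tendsto_norm[OF w] nz by (rule LIMSEQ_unique)
  show thesis
  proof (rule that[OF wQ])
    show "norm w \<le> norm v" if "v \<in> Q" for v using dle that nw by simp
    show "v = w" if "v \<in> Q" "norm v \<le> norm w" for v
    proof -
      have "norm v = d" using that dle nw by force
      then have "(norm (v - w))\<^sup>2 \<le> 0"
        using convex_norm_diff_bound[OF Q(2) that(1) wQ dle d0] nw by simp
      then show ?thesis by simp
    qed
  qed
qed

lemma closed_csubspaceD:
  assumes "closed_csubspace S"
  shows "closed S" "0 \<in> S" "\<And>x y. x \<in> S \<Longrightarrow> y \<in> S \<Longrightarrow> x + y \<in> S"
    "\<And>c x. x \<in> S \<Longrightarrow> c *\<^sub>C x \<in> S" "\<And>x. x \<in> S \<Longrightarrow> - x \<in> S"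
    "\<And>x y. x \<in> S \<Longrightarrow> y \<in> S \<Longrightarrow> x - y \<in> S" "\<And>r x. x \<in> S \<Longrightarrow> r *\<^sub>R x \<in> S"
proof -
  show *: "closed S" "0 \<in> S" "\<And>x y. x \<in> S \<Longrightarrow> y \<in> S \<Longrightarrow> x + y \<in> S"
    "\<And>c x. x \<in> S \<Longrightarrow> c *\<^sub>C x \<in> S"
    using assms by (auto simp: closed_csubspace_def)
  show n: "- x \<in> S" if "x \<in> S" for x
    using *(4)[OF that, of "- 1"] by (simp add: scaleC_minus_one)
  show "x - y \<in> S" if "x \<in> S" "y \<in> S" for x y
    using *(3)[OF that(1) n[OF that(2)]] by simp
  show "r *\<^sub>R x \<in> S" if "x \<in> S" for r x
    using *(4)[OF that] by (simp add: scaleR_scaleC)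
qed

definition ortho :: "'a::complex_hilbert set \<Rightarrow> 'a set" where
  "ortho S = {v. \<forall>w\<in>S. cinner v w = 0}"

lemma closed_Ball_cinner: "closed {v. \<forall>w\<in>S. cinner v (w :: 'a::complex_hilbert) = 0}"
proof -
  have "{v. \<forall>w\<in>S. cinner v w = 0} = (\<Inter>w\<in>S. {v. cinner v w = 0})" by auto
  then show ?thesis
    by (simp add: closed_INT closed_Collect_eq linear_continuous_on bounded_linear_cinner_left)
qed

lemma closed_csubspace_ortho: "closed_csubspace (ortho S)"
  using closed_Ball_cinner[of S] unfolding closed_csubspace_def ortho_def
  by (auto simp: cinner_simps)

text \<open>The vector of least norm in the translate \<open>v + S\<close> is orthogonal to
  \<open>S\<close>; otherwise subtracting its component along some \<open>t\<close> would shorten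
  it.\<close>

lemma orthogonal_decomposition:
  fixes v :: "'a::complex_hilbert"
  assumes S: "closed_csubspace S"
  obtains a b where "a \<in> S" "b \<in> ortho S" "v = a + b"
proof -
  note S' = closed_csubspaceD[OF S]
  define Q where "Q = (\<lambda>s. v + s) ` S"
  have "closed Q" unfolding Q_def using S'(1) by (rule closed_translation)
  moreover have "convex Q" unfolding Q_def
    by (intro convex_translation convexI S'(3) S'(7))
  moreover have "Q \<noteq> {}" using S'(2) by (auto simp: Q_def)
  ultimately obtain w where w: "w \<in> Q" "\<And>z. z \<in> Q \<Longrightarrow> norm w \<le> norm z"
    by (rule convex_minimal_norm) blast
  obtain s where s: "s \<in> S" "w = v + s" using w(1) by (auto simp: Q_def)
  have "cinner w t = 0" if t: "t \<in> S" for t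
  proof (cases "t = 0")
    case False
    \<comment> \<open>\<open>c *\<^sub>C t\<close> is the component of \<open>w\<close> along
      \<open>t\<close>. For this \<open>c\<close> the minimality inequality reads
      \<open>2 r \<le> r\<close> with \<open>r\<close> the squared norm of that component.\<close>
    define c where "c = cinner w t / of_real ((norm t)\<^sup>2)"
    have "w - c *\<^sub>C t \<in> Q"
      unfolding Q_def s(2) using S'(4)[OF t, of c] S'(6)[OF s(1)] by (auto simp: add_diff_eq[symmetric])
    then have "norm w \<le> norm (w - c *\<^sub>C t)" by (rule w(2))
    then have "(norm w)\<^sup>2 \<le> (norm (w - c *\<^sub>C t))\<^sup>2" by (intro power_mono) auto
    then have "2 * Re (cnj c * cinner w t) \<le> (cmod c)\<^sup>2 * (norm t)\<^sup>2"
      by (simp add: norm_diff_square norm_scaleC cinner_simps power_mult_distrib)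
    moreover have "cnj c * cinner w t = of_real ((cmod c)\<^sup>2 * (norm t)\<^sup>2)"
    proof -
      have "cinner w t = c * of_real ((norm t)\<^sup>2)" using False by (simp add: c_def)
      then have "cnj c * cinner w t = (c * cnj c) * of_real ((norm t)\<^sup>2)"
        by (simp only: mult_ac)
      then show ?thesis by (simp only: complex_norm_square[symmetric] of_real_mult of_real_power)
    qed
    ultimately have "2 * ((cmod c)\<^sup>2 * (norm t)\<^sup>2) \<le> (cmod c)\<^sup>2 * (norm t)\<^sup>2"
      by (simp only: Re_complex_of_real)
    then have "(cmod c)\<^sup>2 * (norm t)\<^sup>2 \<le> 0" by linarith
    then have "c = 0" using False
      by (metis mult_le_0_iff norm_eq_zero power2_less_eq_zero_iff)
    then show ?thesis using False by (simp add: c_def)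
  qed simp
  then have "w \<in> ortho S" by (simp add: ortho_def)
  moreover have "- s \<in> S" by (rule S'(5)[OF s(1)])
  moreover have "v = - s + w" unfolding s(2) by simp
  ultimately show thesis using that by blast
qed

lemma ortho_inter: "v \<in> S \<Longrightarrow> v \<in> ortho S \<Longrightarrow> v = 0"
  by (auto simp: ortho_def cinner_self_eq_0_iff)

lemma ortho_ortho_subset:
  assumes "closed_csubspace S"
  shows "ortho (ortho S) \<subseteq> S"
proof
  fix v assume v: "v \<in> ortho (ortho S)"
  obtain a b where ab: "a \<in> S" "b \<in> ortho S" "v = a + b"
    by (rule orthogonal_decomposition[OF assms])
  have "cinner v b = 0" using v ab(2) by (auto simp: ortho_def)
  moreover have "cinner a b = 0" using ab(1,2) by (auto simp: ortho_def intro: cinner_eq_zero_commute[THEN iffD1])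
  ultimately have "b = 0" using ab(3) by (simp add: cinner_add_left cinner_self_eq_0_iff)
  then show "v \<in> S" using ab by simp
qed

text \<open>A vector \<open>b\<close> orthogonal to the kernel determines the functional, since
  \<open>u - (f u / f b) b\<close> always lies in the kernel; the representing vector is a multiple
  of \<open>b\<close>.\<close>

lemma Riesz_representation:
  fixes f :: "'a::complex_hilbert \<Rightarrow> complex"
  assumes f: "bounded_linear f" "\<And>c v. f (c *\<^sub>C v) = c * f v"
  obtains w where "\<And>v. f v = cinner v w"
proof (cases "\<forall>v. f v = 0")
  case True
  then show ?thesis using that[of 0] by simp
next
  case False
  then obtain v where v: "f v \<noteq> 0" by blast
  interpret f: bounded_linear f by (rule f)
  define S where "S = {v. f v = 0}"
  have "closed_csubspace S"
    unfolding closed_csubspace_def S_def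
    by (auto simp: f(2) f.add f.zero closed_Collect_eq linear_continuous_on f(1))
  then obtain a b where ab: "a \<in> S" "b \<in> ortho S" "v = a + b"
    by (rule orthogonal_decomposition)
  have fb: "f b \<noteq> 0" using v ab by (auto simp: S_def f.add)
  then have b: "b \<noteq> 0" using f.zero by auto
  define w where "w = (cnj (f b) / of_real ((norm b)\<^sup>2)) *\<^sub>C b"
  show ?thesis
  proof (rule that)
    fix u
    have "u - (f u / f b) *\<^sub>C b \<in> S" using fb by (simp add: S_def f.diff f(2))
    then have "cinner (u - (f u / f b) *\<^sub>C b) b = 0"
      using ab(2) by (auto simp: ortho_def intro: cinner_eq_zero_commute[THEN iffD1])
    then have "cinner u b = (f u / f b) * of_real ((norm b)\<^sup>2)"
      by (simp add: cinner_simps cinner_self)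
    then show "f u = cinner u w" using b fb by (simp add: w_def cinner_simps)
  qed
qed

lemma cinner_extensionality:
  assumes "\<And>v. cinner v x = cinner v (y :: 'a::complex_hilbert)"
  shows "x = y"
proof -
  have "cinner (x - y) (x - y) = 0" using assms[of "x - y"] by (simp add: cinner_diff_right)
  then show ?thesis by (simp add: cinner_self_eq_0_iff)
qed

section \<open>The Banach algebra of bounded operators\<close>

lemma bop_bounded_linear: "bounded_linear (bop_apply x)"
  using bop_apply[of x] by simp

lemma bop_scaleC_vec: "bop_apply x (c *\<^sub>C v) = c *\<^sub>C bop_apply x v"
  using bop_apply[of x] by simp

lemmas bop_linear_simps =
  linear_add[OF bounded_linear.linear[OF bop_bounded_linear]]
  linear_diff[OF bounded_linear.linear[OF bop_bounded_linear]]
  linear_neg[OF bounded_linear.linear[OF bop_bounded_linear]]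
  bop_scaleC_vec

lemma bop_zero_vec [simp]: "bop_apply x 0 = 0"
  by (rule linear_0[OF bounded_linear.linear[OF bop_bounded_linear]])

lemma bop_apply_simps:
  "bop_apply 0 v = 0" "bop_apply 1 v = v" "bop_apply (x + y) v = bop_apply x v + bop_apply y v"
  "bop_apply (x - y) v = bop_apply x v - bop_apply y v" "bop_apply (- x) v = - bop_apply x v"
  "bop_apply (x * y) v = bop_apply x (bop_apply y v)" "bop_apply (c *\<^sub>C x) v = c *\<^sub>C bop_apply x v"
  "bop_apply (r *\<^sub>R x) v = r *\<^sub>R bop_apply x v"
  by (simp_all add: zero_bop.rep_eq one_bop.rep_eq plus_bop.rep_eq minus_bop.rep_eq
      uminus_bop.rep_eq times_bop.rep_eq scaleC_bop.rep_eq scaleR_scaleC)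

lemma bop_eqI: "(\<And>v. bop_apply x v = bop_apply y v) \<Longrightarrow> x = y"
  by (metis bop_apply_inject ext)

lemma bop_apply_Bop:
  "bounded_linear f \<Longrightarrow> (\<And>c v. f (c *\<^sub>C v) = c *\<^sub>C f v) \<Longrightarrow> bop_apply (Bop f) = f"
  by (simp add: Bop_inverse)

lemma bop_mult_scaleC:
  "x * (c *\<^sub>C y) = c *\<^sub>C (x * y)" "(c *\<^sub>C x) * y = c *\<^sub>C (x * (y :: 'a::complex_hilbert bop))"
  by (auto intro!: bop_eqI simp: bop_apply_simps bop_linear_simps)

instantiation bop :: (complex_hilbert) real_normed_algebra
begin

definition norm_bop :: "'a bop \<Rightarrow> real" where "norm_bop x = onorm (bop_apply x)"
definition dist_bop :: "'a bop \<Rightarrow> 'a bop \<Rightarrow> real" where "dist_bop x y = norm (x - y)"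
definition sgn_bop :: "'a bop \<Rightarrow> 'a bop" where "sgn_bop x = inverse (norm x) *\<^sub>R x"
definition uniformity_bop :: "('a bop \<times> 'a bop) filter" where
  "uniformity_bop = (INF e\<in>{0 <..}. principal {(x, y). dist x y < e})"
definition open_bop :: "'a bop set \<Rightarrow> bool" where
  "open_bop U \<longleftrightarrow> (\<forall>x\<in>U. eventually (\<lambda>(x', y). x' = x \<longrightarrow> y \<in> U) uniformity)"

instance
proof
  fix x y :: "'a bop" and r :: real and U :: "'a bop set"
  have ap: "bop_apply (x + y) = (\<lambda>v. bop_apply x v + bop_apply y v)"
    "bop_apply (x * y) = bop_apply x \<circ> bop_apply y"
    "bop_apply (r *\<^sub>R x) = (\<lambda>v. r *\<^sub>R bop_apply x v)" for x y :: "'a bop" and r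
    by (auto simp: bop_apply_simps fun_eq_iff)
  show "dist x y = norm (x - y)" by (rule dist_bop_def)
  show "sgn x = inverse (norm x) *\<^sub>R x" by (rule sgn_bop_def)
  show "uniformity = (INF e\<in>{0 <..}. principal {(x, y :: 'a bop). dist x y < e})"
    by (rule uniformity_bop_def)
  show "open U \<longleftrightarrow> (\<forall>x\<in>U. eventually (\<lambda>(x', y). x' = x \<longrightarrow> y \<in> U) uniformity)"
    by (rule open_bop_def)
  show "norm x = 0 \<longleftrightarrow> x = 0"
    by (auto simp: norm_bop_def onorm_eq_0[OF bop_bounded_linear] bop_apply_simps intro!: bop_eqI)
  show "norm (x + y) \<le> norm x + norm y"
    unfolding norm_bop_def ap by (rule onorm_triangle) (rule bop_bounded_linear)+
  show "norm (r *\<^sub>R x) = \<bar>r\<bar> * norm x"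
    unfolding norm_bop_def ap by (rule onorm_scaleR) (rule bop_bounded_linear)
  show "norm (x * y) \<le> norm x * norm y"
    unfolding norm_bop_def ap by (rule onorm_compose) (rule bop_bounded_linear)+
  show "(r *\<^sub>R x) * y = r *\<^sub>R (x * y)" "x * (r *\<^sub>R y) = r *\<^sub>R (x * y)"
    by (simp_all add: scaleR_scaleC bop_mult_scaleC)
qed

end

lemma norm_bop_apply: "norm (bop_apply x v) \<le> norm x * norm v"
  unfolding norm_bop_def by (rule onorm[OF bop_bounded_linear])

lemma norm_bop_le: "0 \<le> C \<Longrightarrow> (\<And>v. norm (bop_apply x v) \<le> C * norm v) \<Longrightarrow> norm x \<le> C"
  unfolding norm_bop_def by (rule onorm_bound)

lemma norm_bop_one_le: "norm (1 :: 'a::complex_hilbert bop) \<le> 1"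
  by (rule norm_bop_le) (auto simp: bop_apply_simps)

lemma norm_bop_scaleC: "norm (c *\<^sub>C x) \<le> cmod c * norm (x :: 'a::complex_hilbert bop)"
  by (rule norm_bop_le) (auto simp: bop_apply_simps norm_scaleC mult.assoc intro!: mult_left_mono norm_bop_apply)

text \<open>Completeness is inherited from \<open>blinfun\<close>, whose norm is the same operator
  norm; complex homogeneity survives pointwise limits.\<close>

instance bop :: (complex_hilbert) banach
proof
  fix X :: "nat \<Rightarrow> 'a bop" assume X: "Cauchy X"
  define B where "B n = Blinfun (bop_apply (X n))" for n
  have B: "blinfun_apply (B n) = bop_apply (X n)" for n
    by (simp add: B_def bounded_linear_Blinfun_apply bop_bounded_linear)
  have nB: "norm (B m - B n) = norm (X m - X n)" for m n
  proof -
    have "blinfun_apply (B m - B n) = bop_apply (X m - X n)"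
      by (auto simp: blinfun.diff_left B bop_apply_simps fun_eq_iff)
    then show ?thesis by (simp add: norm_blinfun.rep_eq norm_bop_def)
  qed
  have "Cauchy B" using X unfolding Cauchy_def dist_norm nB .
  then obtain L where L: "B \<longlonglongrightarrow> L" by (auto simp: Cauchy_convergent_iff convergent_def)
  have Lv: "(\<lambda>n. bop_apply (X n) v) \<longlonglongrightarrow> blinfun_apply L v" for v
    using blinfun.tendsto[OF L tendsto_const[of v]] by (simp add: B)
  have Lc: "blinfun_apply L (c *\<^sub>C v) = c *\<^sub>C blinfun_apply L v" for c v
  proof (rule LIMSEQ_unique)
    show "(\<lambda>n. bop_apply (X n) (c *\<^sub>C v)) \<longlonglongrightarrow> blinfun_apply L (c *\<^sub>C v)" by (rule Lv)
    show "(\<lambda>n. bop_apply (X n) (c *\<^sub>C v)) \<longlonglongrightarrow> c *\<^sub>C blinfun_apply L v"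
      unfolding bop_scaleC_vec by (rule bounded_linear.tendsto[OF bounded_linear_scaleC Lv])
  qed
  define T where "T = Bop (blinfun_apply L)"
  have T: "bop_apply T = blinfun_apply L"
    unfolding T_def by (rule bop_apply_Bop) (auto simp: Lc blinfun.bounded_linear_right)
  have "norm (X n - T) = norm (B n - L)" for n
  proof -
    have "blinfun_apply (B n - L) = bop_apply (X n - T)"
      by (auto simp: blinfun.diff_left B T bop_apply_simps fun_eq_iff)
    then show ?thesis by (simp add: norm_blinfun.rep_eq norm_bop_def)
  qed
  then have "X \<longlonglongrightarrow> T" using L by (simp add: LIM_zero_iff tendsto_iff dist_norm)
  then show "convergent X" by (auto simp: convergent_def)
qed

section \<open>Adjoints\<close>

lemma adj_exists:
  fixes x :: "'a::complex_hilbert bop"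
  shows "\<exists>y. \<forall>v w. cinner (bop_apply x v) w = cinner v (bop_apply y w)"
proof -
  have "\<exists>y. \<forall>v. cinner (bop_apply x v) w = cinner v y" for w
  proof -
    have "bounded_linear (\<lambda>v. cinner (bop_apply x v) w)"
      by (rule bounded_linear_compose[OF bounded_linear_cinner_left bop_bounded_linear])
    then obtain y where "\<And>v. cinner (bop_apply x v) w = cinner v y"
      by (rule Riesz_representation) (auto simp: bop_linear_simps cinner_simps)
    then show ?thesis by blast
  qed
  then obtain y where y: "\<And>v w. cinner (bop_apply x v) w = cinner v (y w)" by metis
  have bl: "bounded_linear y"
  proof (rule bounded_linear_intro[where K = "norm x"])
    show "y (v + w) = y v + y w" for v w
      by (rule cinner_extensionality) (simp add: cinner_simps flip: y)
    show "y (r *\<^sub>R v) = r *\<^sub>R y v" for r v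
      by (rule cinner_extensionality) (simp add: cinner_simps flip: y)
    fix v
    \<comment> \<open>Putting \<open>w = y v\<close> into the adjoint identity bounds
      \<open>y\<close> by the norm of \<open>x\<close>.\<close>
    have "(norm (y v))\<^sup>2 = Re (cinner (bop_apply x (y v)) v)" by (simp add: power2_norm_eq_cinner y)
    also have "\<dots> \<le> norm (bop_apply x (y v)) * norm v"
      using Cauchy_Schwarz complex_Re_le_cmod order_trans by blast
    also have "\<dots> \<le> norm x * norm (y v) * norm v" by (intro mult_right_mono norm_bop_apply) simp
    finally have "norm (y v) * norm (y v) \<le> norm (y v) * (norm v * norm x)"
      by (simp add: power2_eq_square mult_ac)
    then show "norm (y v) \<le> norm v * norm x"
      by (cases "norm (y v) = 0") (auto simp: mult_le_cancel_left)
  qed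
  have "y (c *\<^sub>C v) = c *\<^sub>C y v" for c v
    by (rule cinner_extensionality) (simp add: cinner_simps flip: y)
  then have "bop_apply (Bop y) = y" using bl by (intro bop_apply_Bop)
  then show ?thesis using y by metis
qed

text \<open>Unique existence gives the definite description in \<open>adj\<close> its meaning; from
  here on only this identity is used, never the definition.\<close>

lemma cinner_adj_right: "cinner v (bop_apply (adj x) w) = cinner (bop_apply x v) w"
proof -
  have "\<exists>!y. \<forall>v w. cinner (bop_apply x v) w = cinner v (bop_apply y w)"
    using adj_exists[of x] by (metis bop_eqI cinner_extensionality)
  then have "\<forall>v w. cinner (bop_apply x v) w = cinner v (bop_apply (adj x) w)"
    unfolding adj_def by (rule theI')
  then show ?thesis by metis
qed

lemma cinner_adj_left: "cinner (bop_apply (adj x) v) w = cinner v (bop_apply x w)"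
  by (metis cinner_adj_right cinner_commute)

lemma adj_unique: "(\<And>v w. cinner (bop_apply x v) w = cinner v (bop_apply y w)) \<Longrightarrow> adj x = y"
  by (rule bop_eqI, rule cinner_extensionality) (simp add: cinner_adj_right)

lemma adj_simps [simp]:
  "adj (adj x) = x" "adj (x * y) = adj y * adj x" "adj (x + y) = adj x + adj y" "adj 1 = 1"
  "adj 0 = 0" "adj (x - y) = adj x - adj y" "adj (- x) = - adj x" "adj (c *\<^sub>C x) = cnj c *\<^sub>C adj x"
  "adj (r *\<^sub>R x) = r *\<^sub>R adj x"
  by (rule adj_unique; simp add: bop_apply_simps bop_linear_simps cinner_simps cinner_adj_right cinner_adj_left)+

lemma norm_adj_le: "norm (adj x) \<le> norm x"
proof (rule norm_bop_le)
  fix v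
  let ?y = "bop_apply (adj x) v"
  have "(norm ?y)\<^sup>2 = Re (cinner (bop_apply x ?y) v)"
    by (simp add: power2_norm_eq_cinner cinner_adj_right)
  also have "\<dots> \<le> norm (bop_apply x ?y) * norm v"
    using Cauchy_Schwarz complex_Re_le_cmod order_trans by blast
  also have "\<dots> \<le> norm x * norm ?y * norm v" by (intro mult_right_mono norm_bop_apply) simp
  finally have "norm ?y * norm ?y \<le> norm ?y * (norm x * norm v)"
    by (simp add: power2_eq_square mult_ac)
  then show "norm ?y \<le> norm x * norm v"
    by (cases "norm ?y = 0") (auto simp: mult_le_cancel_left)
qed simp

lemma norm_adj [simp]: "norm (adj x) = norm x"
  using norm_adj_le[of x] norm_adj_le[of "adj x"] by simp

lemma bounded_linear_adj: "bounded_linear adj"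
  by (rule bounded_linear_intro[where K = 1]) auto

lemma adj_self_mult_eq_0: "adj x * x = 0 \<Longrightarrow> x = 0"
proof (rule bop_eqI)
  fix v assume "adj x * x = 0"
  then have "cinner (bop_apply (adj x * x) v) v = 0" by (simp add: bop_apply_simps)
  then have "cinner (bop_apply x v) (bop_apply x v) = 0" by (simp add: bop_apply_simps cinner_adj_left)
  then show "bop_apply x v = bop_apply 0 v" by (simp add: cinner_self_eq_0_iff bop_apply_simps)
qed

text \<open>The Lax-Milgram argument: coercivity bounds \<open>T\<close> from below, so it is
  injective with closed range, and a vector orthogonal to the range violates coercivity unless it is
  0. The constant 1 in the hypothesis gives the bound 1 on the inverse.\<close>

lemma coercive_invertible:
  fixes T :: "'a::complex_hilbert bop"
  assumes T: "\<And>v. (norm v)\<^sup>2 \<le> Re (cinner (bop_apply T v) v)"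
  obtains S where "T * S = 1" "S * T = 1" "norm S \<le> 1"
proof -
  have bb: "norm v \<le> norm (bop_apply T v)" for v
  proof -
    have "(norm v)\<^sup>2 \<le> norm (bop_apply T v) * norm v"
      using T[of v] Cauchy_Schwarz[of "bop_apply T v" v] complex_Re_le_cmod[of "cinner (bop_apply T v) v"]
      by linarith
    then have "norm v * norm v \<le> norm (bop_apply T v) * norm v" by (simp add: power2_eq_square)
    then show ?thesis by (cases "v = 0") (auto simp: mult_le_cancel_right)
  qed
  have inj: "inj (bop_apply T)"
  proof (rule injI)
    fix v w assume "bop_apply T v = bop_apply T w"
    then show "v = w" using bb[of "v - w"] by (simp add: bop_linear_simps)
  qed
  have "complete (range (bop_apply T))"
    by (rule complete_isometric_image[where e = 1]) (auto simp: bb bop_bounded_linear complete_UNIV)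
  then have "closed (range (bop_apply T))" by (simp add: complete_eq_closed)
  moreover have "0 \<in> range (bop_apply T)" using bop_zero_vec[of T] by (metis rangeI)
  moreover have "bop_apply T v + bop_apply T w \<in> range (bop_apply T)" for v w
    by (metis bop_linear_simps(1) rangeI)
  moreover have "c *\<^sub>C bop_apply T v \<in> range (bop_apply T)" for c v
    by (metis bop_scaleC_vec rangeI)
  ultimately have ran: "closed_csubspace (range (bop_apply T))"
    unfolding closed_csubspace_def by auto
  have surj: "range (bop_apply T) = UNIV"
  proof -
    have "v \<in> range (bop_apply T)" for v
    proof -
      obtain a b where ab: "a \<in> range (bop_apply T)" "b \<in> ortho (range (bop_apply T))" "v = a + b"
        by (rule orthogonal_decomposition[OF ran])
      have "cinner (bop_apply T b) b = 0"
        using ab(2) by (auto simp: ortho_def intro: cinner_eq_zero_commute[THEN iffD1])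
      then have "b = 0" using T[of b] by simp
      then show ?thesis using ab by simp
    qed
    then show ?thesis by blast
  qed
  define g where "g = inv_into UNIV (bop_apply T)"
  have Tg: "bop_apply T (g v) = v" for v using surj by (simp add: g_def f_inv_into_f)
  have gT: "g (bop_apply T v) = v" for v using inj by (simp add: g_def)
  have eq: "g v = w" if "bop_apply T w = v" for v w using gT[of w] that by simp
  have ng: "norm (g v) \<le> norm v" for v using bb[of "g v"] Tg by simp
  have bl: "bounded_linear g"
  proof (rule bounded_linear_intro[where K = 1])
    show "g (v + w) = g v + g w" for v w by (rule eq) (simp add: bop_linear_simps Tg)
    show "g (r *\<^sub>R v) = r *\<^sub>R g v" for r v
      by (rule eq) (simp add: bop_linear_simps Tg scaleR_scaleC)
  qed (simp add: ng)
  have "bop_apply (Bop g) = g"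
    by (rule bop_apply_Bop[OF bl]) (rule eq, simp add: bop_linear_simps Tg)
  then show thesis
    by (intro that[of "Bop g"] bop_eqI norm_bop_le) (auto simp: bop_apply_simps Tg gT ng)
qed

text \<open>The iteration \<open>y \<mapsto> (k + y\<^sup>2) / 2\<close> converges because its increments are dominated by those
  of the scalar iteration \<open>q \<mapsto> (1 + q\<^sup>2) / 2\<close> started at 0, which increases to 1.\<close>

lemma sqrt_one_minus:
  fixes k :: "'a::complex_hilbert bop"
  assumes k: "adj k = k" "norm k \<le> 1"
    and A: "k \<in> A" "0 \<in> A" "closed A" "\<And>x y. x \<in> A \<Longrightarrow> y \<in> A \<Longrightarrow> x + y \<in> A"
      "\<And>x y. x \<in> A \<Longrightarrow> y \<in> A \<Longrightarrow> x * y \<in> A" "\<And>r x. x \<in> A \<Longrightarrow> r *\<^sub>R x \<in> A"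
  obtains y where "y \<in> A" "adj y = y" "(1 - y) * (1 - y) = 1 - k" "norm y \<le> norm k"
proof -
  define Y where "Y = rec_nat (0 :: 'a bop) (\<lambda>_ y. (1/2) *\<^sub>R (k + y * y))"
  define q where "q = rec_nat (0 :: real) (\<lambda>_ y. (1/2) * (1 + y * y))"
  have Y: "Y 0 = 0" "Y (Suc n) = (1/2) *\<^sub>R (k + Y n * Y n)" for n by (simp_all add: Y_def)
  have q: "q 0 = 0" "q (Suc n) = (1/2) * (1 + q n * q n)" for n by (simp_all add: q_def)
  have YA: "Y n \<in> A" for n by (induction n) (auto simp: Y A)
  have Yadj: "adj (Y n) = Y n" for n by (induction n) (auto simp: Y k(1))
  have Yk: "norm (Y n) \<le> norm k" for n
  proof (induction n)
    case (Suc n)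
    have "norm (Y (Suc n)) \<le> (1/2) * (norm k + norm (Y n * Y n))"
      unfolding Y using norm_triangle_ineq[of k "Y n * Y n"] by simp
    also have "norm (Y n * Y n) \<le> norm (Y n) * norm (Y n)" by (rule norm_mult_ineq)
    also have "norm (Y n) * norm (Y n) \<le> norm k * norm k" using Suc by (intro mult_mono) auto
    also have "norm k * norm k \<le> norm k" using k(2) by (simp add: mult_left_le)
    finally show ?case by simp
  qed (simp add: Y)
  have q01: "0 \<le> q n \<and> q n \<le> 1" for n
  proof (induction n)
    case (Suc n)
    then have "q n * q n \<le> 1 * 1" by (intro mult_mono) auto
    then show ?case using Suc by (auto simp: q)
  qed (simp add: q)
  have Yq: "norm (Y n) \<le> q n" for n
  proof (induction n)
    case (Suc n)
    have "norm (Y (Suc n)) \<le> (1/2) * (norm k + norm (Y n * Y n))"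
      unfolding Y using norm_triangle_ineq[of k "Y n * Y n"] by simp
    also have "norm (Y n * Y n) \<le> norm (Y n) * norm (Y n)" by (rule norm_mult_ineq)
    also have "norm (Y n) * norm (Y n) \<le> q n * q n" using Suc q01 by (intro mult_mono) auto
    finally show ?case using k(2) by (simp add: q)
  qed (simp add: Y q)
  have dY: "norm (Y (Suc n) - Y n) \<le> q (Suc n) - q n" for n
  proof (induction n)
    case 0
    then show ?case using k(2) by (simp add: Y q)
  next
    case (Suc n)
    let ?d = "Y (Suc n) - Y n"
    have "Y (Suc (Suc n)) - Y (Suc n) = (1/2) *\<^sub>R (Y (Suc n) * Y (Suc n) - Y n * Y n)"
      by (simp only: Y(2)[of "Suc n"] Y(2)[of n] scaleR_diff_right[symmetric]) simp
    \<comment> \<open>The difference of squares is split with the factors in this order, so that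
      commutation of the iterates never enters.\<close>
    also have "Y (Suc n) * Y (Suc n) - Y n * Y n = Y (Suc n) * ?d + ?d * Y n"
      by (simp add: algebra_simps)
    finally have "norm (Y (Suc (Suc n)) - Y (Suc n)) = (1/2) * norm (Y (Suc n) * ?d + ?d * Y n)"
      by simp
    also have "norm (Y (Suc n) * ?d + ?d * Y n) \<le> norm (Y (Suc n)) * norm ?d + norm ?d * norm (Y n)"
      by (meson add_mono norm_mult_ineq norm_triangle_le)
    also have "\<dots> \<le> q (Suc n) * (q (Suc n) - q n) + (q (Suc n) - q n) * q n"
      using Yq Suc.IH q01 order_trans[OF norm_ge_zero Suc.IH] by (intro add_mono mult_mono) simp_all
    also have "(1/2) * \<dots> = q (Suc (Suc n)) - q (Suc n)"
      by (simp add: q(2)[of "Suc n"] q(2)[of n] field_simps)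
    finally show ?case by simp
  qed
  have "incseq q"
  proof (rule incseq_SucI)
    show "q n \<le> q (Suc n)" for n using order_trans[OF norm_ge_zero dY[of n]] by simp
  qed
  then obtain l where "q \<longlonglongrightarrow> l" using incseq_convergent[of q 1] q01 by blast
  then have "summable (\<lambda>n. q (Suc n) - q n)" by (rule telescope_summable)
  then have "summable (\<lambda>n. Y (Suc n) - Y n)"
    by (rule summable_comparison_test'[where N = 0]) (rule dY)
  then have "convergent (\<lambda>n. \<Sum>i<n. Y (Suc i) - Y i)" by (simp add: summable_iff_convergent)
  then obtain y where y: "Y \<longlonglongrightarrow> y"
    unfolding sum_lessThan_telescope by (auto simp: Y convergent_def)
  have "(\<lambda>n. Y (Suc n)) \<longlonglongrightarrow> (1/2) *\<^sub>R (k + y * y)" unfolding Y by (intro tendsto_intros y)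
  \<comment> \<open>The fixed-point equation \<open>2 y = k + y\<^sup>2\<close> is
    \<open>(1 - y)\<^sup>2 = 1 - k\<close> rearranged.\<close>
  then have "y = (1/2) *\<^sub>R (k + y * y)" using y LIMSEQ_Suc LIMSEQ_unique by blast
  then have "2 *\<^sub>R y = 2 *\<^sub>R ((1/2) *\<^sub>R (k + y * y))" by (rule arg_cong)
  then have "k = y + y - y * y" by (simp add: scaleR_2)
  then have "(1 - y) * (1 - y) = 1 - k" by (simp add: algebra_simps)
  moreover have "y \<in> A" using closed_sequentially[OF A(3) YA y] .
  moreover have "adj y = y"
  proof (rule LIMSEQ_unique)
    show "Y \<longlonglongrightarrow> adj y" using bounded_linear.tendsto[OF bounded_linear_adj y] by (simp add: Yadj)
  qed fact
  moreover have "norm y \<le> norm k"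
    by (rule Lim_norm_ubound[OF _ y]) (auto simp: Yk)
  ultimately show thesis using that by blast
qed

section \<open>Weak operator limits\<close>

lemma bop_eqI_cinner:
  assumes "\<And>v w. cinner (bop_apply x v) w = cinner (bop_apply y v) w"
  shows "x = y"
proof (rule bop_eqI, rule cinner_extensionality)
  show "cinner w (bop_apply x v) = cinner w (bop_apply y v)" for v w
    unfolding cinner_commute[of w] assms ..
qed

text \<open>Convergence in the weak operator topology, along a filter rather than a sequence:
  cluster points are reached along refinements of a given filter, and the faithfulness argument runs
  over the finite subsets of an ideal.\<close>

definition weakly_tendsto :: "('i \<Rightarrow> 'a::complex_hilbert bop) \<Rightarrow> 'a bop \<Rightarrow> 'i filter \<Rightarrow> bool" where
  "weakly_tendsto X z G \<longleftrightarrow>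
     (\<forall>v w. ((\<lambda>i. cinner (bop_apply (X i) v) w) \<longlongrightarrow> cinner (bop_apply z v) w) G)"

text \<open>Riesz representation is applied to \<open>w \<mapsto> cnj (f v w)\<close>, conjugated
  because \<open>f\<close> is antilinear in \<open>w\<close>; the resulting vector depends linearly
  on \<open>v\<close>.\<close>

lemma sesquilinear_bop:
  fixes f :: "'a::complex_hilbert \<Rightarrow> 'a \<Rightarrow> complex"
  assumes add: "\<And>u v w. f (u + v) w = f u w + f v w" "\<And>u v w. f w (u + v) = f w u + f w v"
    and scale: "\<And>c v w. f (c *\<^sub>C v) w = c * f v w" "\<And>c v w. f v (c *\<^sub>C w) = cnj c * f v w"
    and bound: "\<And>v w. cmod (f v w) \<le> C * norm v * norm w"
  obtains z where "\<And>v w. f v w = cinner (bop_apply z v) w"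
proof -
  have "\<exists>y. \<forall>w. cnj (f v w) = cinner w y" for v
  proof -
    have "bounded_linear (\<lambda>w. cnj (f v w))"
      by (rule bounded_linear_intro[where K = "C * norm v"])
        (use bound[of v] in \<open>auto simp: add scale scaleR_scaleC scaleC_complex_def mult.commute\<close>)
    then obtain y where "\<And>w. cnj (f v w) = cinner w y"
      by (rule Riesz_representation) (auto simp: scale)
    then show ?thesis by blast
  qed
  then obtain z where "\<And>v w. cnj (f v w) = cinner w (z v)" by metis
  then have z: "cinner (z v) w = f v w" for v w by (metis cinner_commute complex_cnj_cnj)
  have zeq: "z v = y" if "\<And>w. cinner (z v) w = cinner y w" for v y
    by (rule cinner_extensionality) (metis that cinner_commute)
  have bl: "bounded_linear z"
  proof (rule bounded_linear_intro[where K = C])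
    show "z (v + w) = z v + z w" for v w by (rule zeq) (simp add: z cinner_simps add)
    show "z (r *\<^sub>R v) = r *\<^sub>R z v" for r v
      by (rule zeq) (simp add: z cinner_simps scaleR_scaleC scale)
    fix v
    have "(norm (z v))\<^sup>2 \<le> C * norm v * norm (z v)"
      using bound[of v "z v"] by (simp add: cinner_self norm_power flip: z)
    then have "norm (z v) * norm (z v) \<le> (norm v * C) * norm (z v)"
      by (simp add: power2_eq_square mult_ac)
    \<comment> \<open>The sign of \<open>C\<close> is not given; for \<open>z v = 0\<close> the
      inequality is extracted from the bound on \<open>f\<close> at \<open>(v, v)\<close>.\<close>
    moreover have "0 \<le> norm v * C" if "z v = 0"
    proof -
      have "0 \<le> C * norm v * norm v" using bound[of v v] norm_ge_zero order_trans by blast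
      then show ?thesis by (cases "v = 0") (auto simp: zero_le_mult_iff mult.commute)
    qed
    ultimately show "norm (z v) \<le> norm v * C"
      by (cases "z v = 0") (auto simp: mult_le_cancel_right)
  qed
  have "z (c *\<^sub>C v) = c *\<^sub>C z v" for c v by (rule zeq) (simp add: z cinner_simps scale)
  then have "bop_apply (Bop z) = z" using bl by (intro bop_apply_Bop)
  then show thesis using that[of "Bop z"] z by simp
qed

text \<open>The operator is a cluster point of the associated sesquilinear forms, which lie in a product
  of discs, compact by Tychonoff's theorem.\<close>

lemma bounded_weak_cluster_point:
  fixes X :: "'i \<Rightarrow> 'a::complex_hilbert bop"
  assumes F: "F \<noteq> bot" and bd: "\<And>i. norm (X i) \<le> C"
  obtains z G where "G \<le> F" "G \<noteq> bot" "weakly_tendsto X z G"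
proof -
  define B where "B i p = cinner (bop_apply (X i) (fst p)) (snd p)" for i and p :: "'a \<times> 'a"
  define Q where "Q = (\<Pi>\<^sub>E p\<in>UNIV. cball (0::complex) (C * norm (fst p :: 'a) * norm (snd p :: 'a)))"
  have "compactin (product_topology (\<lambda>p. euclidean) UNIV) Q"
    unfolding Q_def by (simp add: compactin_PiE)
  then have Q: "compact Q" unfolding euclidean_product_topology by simp
  have Bb: "cmod (B i p) \<le> C * norm (fst p) * norm (snd p)" for i p
  proof -
    have "norm (bop_apply (X i) (fst p)) \<le> C * norm (fst p)"
      using norm_bop_apply bd by (meson mult_right_mono norm_ge_zero order_trans)
    then show ?thesis unfolding B_def
      using Cauchy_Schwarz by (meson mult_right_mono norm_ge_zero order_trans)
  qed
  then have "B i \<in> Q" for i unfolding Q_def by (intro PiE_I) (auto simp del: split_paired_All)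
  then have "eventually (\<lambda>f. f \<in> Q) (filtermap B F)" by (simp add: eventually_filtermap)
  moreover have "filtermap B F \<noteq> bot" using F by (simp add: filtermap_bot_iff)
  ultimately obtain f where f: "f \<in> Q" "inf (nhds f) (filtermap B F) \<noteq> bot"
    using Q unfolding compact_filter by blast
  \<comment> \<open>\<open>G\<close> takes the place of a convergent subnet: it refines
    \<open>F\<close> and forces the forms \<open>B i\<close> to converge to the cluster point
    \<open>f\<close>.\<close>
  define G where "G = inf F (filtercomap B (nhds f))"
  have GF: "G \<le> F" by (simp add: G_def)
  have G: "G \<noteq> bot"
  proof
    assume "G = bot"
    then have "eventually (\<lambda>_. False) G" by simp
    then obtain P P' where P: "eventually P F" "eventually P' (filtercomap B (nhds f))"
      "\<And>x. P x \<Longrightarrow> P' x \<Longrightarrow> False" unfolding G_def eventually_inf by blast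
    obtain R where R: "eventually R (nhds f)" "\<And>x. R (B x) \<Longrightarrow> P' x"
      using P(2) unfolding eventually_filtercomap by blast
    have "eventually (\<lambda>g. \<not> R g) (filtermap B F)"
      unfolding eventually_filtermap using P(1) by eventually_elim (use P(3) R(2) in blast)
    then have "eventually (\<lambda>_. False) (inf (nhds f) (filtermap B F))"
      unfolding eventually_inf using R(1) by blast
    then show False using f(2) by (simp add: eventually_False)
  qed
  have Blim: "filterlim B (nhds f) G"
    unfolding G_def filterlim_def filtermap_inf
    by (meson filtermap_filtercomap filtermap_inf inf_le2 order_trans)
  have "((\<lambda>i. B i p) \<longlongrightarrow> f p) G" for p
    by (rule continuous_on_tendsto_compose[OF continuous_on_product_coordinates[of p] Blim]) auto
  from this[of "(_, _)"] have lim: "((\<lambda>i. cinner (bop_apply (X i) v) w) \<longlongrightarrow> f (v, w)) G" for v w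
    by (simp add: B_def)
  have uniq: "f (v, w) = l" if "((\<lambda>i. cinner (bop_apply (X i) v) w) \<longlongrightarrow> l) G" for v w l
    using tendsto_unique[OF G lim that] .
  obtain z where z: "\<And>v w. f (v, w) = cinner (bop_apply z v) w"
  proof (rule sesquilinear_bop[of "\<lambda>v w. f (v, w)" C])
    show "f (u + v, w) = f (u, w) + f (v, w)" for u v w
      by (rule uniq) (simp add: bop_linear_simps cinner_simps tendsto_add lim)
    show "f (w, u + v) = f (w, u) + f (w, v)" for u v w
      by (rule uniq) (simp add: bop_linear_simps cinner_simps tendsto_add lim)
    show "f (c *\<^sub>C v, w) = c * f (v, w)" for c v w
      by (rule uniq) (simp add: bop_linear_simps cinner_simps tendsto_mult_left lim)
    show "f (v, c *\<^sub>C w) = cnj c * f (v, w)" for c v w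
      by (rule uniq) (simp add: bop_linear_simps cinner_simps tendsto_mult_left lim)
    show "cmod (f (v, w)) \<le> C * norm v * norm w" for v w
      using f(1) by (auto simp: Q_def PiE_iff dest!: spec[of _ "(v, w)"])
  qed blast
  have "weakly_tendsto X z G"
    unfolding weakly_tendsto_def by (simp add: lim flip: z)
  then show thesis using that GF G by blast
qed

text \<open>On norm-bounded families weak operator convergence implies ultraweak convergence: the
  series behind a subbasic ultraweak set is dominated by a multiple of the sum of the squared norms
  of \<open>\<xi> n\<close> and \<open>\<eta> n\<close>, so Tannery's theorem permits the termwise
  limit.\<close>

lemma predual_weakly_continuous:
  fixes X :: "'i \<Rightarrow> 'a::complex_hilbert bop"
  assumes \<phi>: "\<phi> \<in> predual M" and G: "G \<noteq> bot" and bd: "\<And>i. norm (X i) \<le> C"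
    and lim: "weakly_tendsto X z G" and XM: "eventually (\<lambda>i. X i \<in> M) G" and zM: "z \<in> M"
  shows "((\<lambda>i. \<phi> (X i)) \<longlongrightarrow> \<phi> z) G"
proof (rule topological_tendstoI)
  fix U assume U: "open U" "\<phi> z \<in> U"
  have cont: "continuous_map (subtopology ultraweak M) euclidean \<phi>" using \<phi> by (simp add: predual_def)
  have sub: "eventually (\<lambda>i. X i \<in> W) G"
    if "generate_topology_on {{x. (\<Sum>n. cinner (bop_apply x (\<xi> n)) (\<eta> n)) \<in> U} | \<xi> \<eta> U.
        square_summable \<xi> \<and> square_summable \<eta> \<and> open U} W" "z \<in> W" for W
    using that
  proof (induction rule: generate_topology_on.induct)
    case (Int a b)
    then show ?case by (auto intro: eventually_conj)
  next
    case (UN K)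
    then obtain k where "k \<in> K" "z \<in> k" by blast
    then have "eventually (\<lambda>i. X i \<in> k) G" using UN.IH by blast
    then show ?case by eventually_elim (use \<open>k \<in> K\<close> in blast)
  next
    case (Basis s)
    then obtain \<xi> \<eta> U where s: "s = {x. (\<Sum>n. cinner (bop_apply x (\<xi> n)) (\<eta> n)) \<in> U}"
      "square_summable \<xi>" "square_summable \<eta>" "open U" by blast
    have "((\<lambda>i. \<Sum>n. cinner (bop_apply (X i) (\<xi> n)) (\<eta> n)) \<longlongrightarrow> (\<Sum>n. cinner (bop_apply z (\<xi> n)) (\<eta> n))) G"
    proof (rule tannerys_theorem[THEN conjunct2, THEN conjunct2, OF _ _ _ G])
      show "((\<lambda>i. cinner (bop_apply (X i) (\<xi> n)) (\<eta> n)) \<longlongrightarrow> cinner (bop_apply z (\<xi> n)) (\<eta> n)) G" for n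
        using lim by (simp add: weakly_tendsto_def)
      have "norm (cinner (bop_apply (X i) (\<xi> n)) (\<eta> n)) \<le> C * ((norm (\<xi> n))\<^sup>2 + (norm (\<eta> n))\<^sup>2)" for n i
      proof -
        have C: "0 \<le> C" using bd[of i] norm_ge_zero order_trans by blast
        have "norm (cinner (bop_apply (X i) (\<xi> n)) (\<eta> n)) \<le> norm (bop_apply (X i) (\<xi> n)) * norm (\<eta> n)"
          by (rule Cauchy_Schwarz)
        also have "\<dots> \<le> C * norm (\<xi> n) * norm (\<eta> n)"
          using norm_bop_apply bd by (meson mult_right_mono norm_ge_zero order_trans)
        also have "\<dots> \<le> C * ((norm (\<xi> n))\<^sup>2 + (norm (\<eta> n))\<^sup>2)"
        proof -
          have "2 * norm (\<xi> n) * norm (\<eta> n) \<le> (norm (\<xi> n))\<^sup>2 + (norm (\<eta> n))\<^sup>2"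
            by (rule sum_squares_bound)
          moreover have "0 \<le> norm (\<xi> n) * norm (\<eta> n)" by simp
          ultimately have "norm (\<xi> n) * norm (\<eta> n) \<le> (norm (\<xi> n))\<^sup>2 + (norm (\<eta> n))\<^sup>2" by linarith
          then show ?thesis unfolding mult.assoc using C by (rule mult_left_mono)
        qed
        finally show ?thesis .
      qed
      then show "eventually (\<lambda>(n, i). norm (cinner (bop_apply (X i) (\<xi> n)) (\<eta> n))
          \<le> C * ((norm (\<xi> n))\<^sup>2 + (norm (\<eta> n))\<^sup>2)) (sequentially \<times>\<^sub>F G)"
        by (simp add: case_prod_unfold)
      show "summable (\<lambda>n. C * ((norm (\<xi> n))\<^sup>2 + (norm (\<eta> n))\<^sup>2))"
        using s(2,3) unfolding square_summable_def by (intro summable_mult summable_add)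
    qed
    then have "eventually (\<lambda>i. (\<Sum>n. cinner (bop_apply (X i) (\<xi> n)) (\<eta> n)) \<in> U) G"
      by (rule topological_tendstoD) (use s Basis.prems in auto)
    then show ?case using s by simp
  qed auto
  have "openin (subtopology ultraweak M) {x \<in> topspace (subtopology ultraweak M). \<phi> x \<in> U}"
    using cont U(1) by (simp add: continuous_map)
  then obtain W where W: "openin ultraweak W"
    "{x \<in> topspace (subtopology ultraweak M). \<phi> x \<in> U} = W \<inter> M" by (auto simp: openin_subtopology)
  have "topspace (ultraweak :: 'a bop topology) = UNIV"
  proof -
    \<comment> \<open>Zero sequences and \<open>U = UNIV\<close> exhibit the whole space as a
      subbasic set.\<close>
    have "UNIV = {x :: 'a bop. (\<Sum>n. cinner (bop_apply x ((\<lambda>_. 0) n)) ((\<lambda>_::nat. 0) n)) \<in> UNIV}" by simp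
    then have "openin (ultraweak :: 'a bop topology) UNIV"
      unfolding ultraweak_def
      by (intro topology_generated_by_Basis) (auto simp: square_summable_def intro!: exI[of _ "\<lambda>_. 0"] exI[of _ UNIV])
    then show ?thesis by (meson openin_subset top.extremum_uniqueI)
  qed
  then have WM: "\<phi> x \<in> U" if "x \<in> W" "x \<in> M" for x using W(2) that by auto
  have "z \<in> W" using W(2) zM U(2) \<open>topspace ultraweak = UNIV\<close> by auto
  then have "eventually (\<lambda>i. X i \<in> W) G"
    using sub W(1) unfolding ultraweak_def openin_topology_generated_by_iff by blast
  then show "eventually (\<lambda>i. \<phi> (X i) \<in> U) G"
    using XM by eventually_elim (rule WM)
qed

section \<open>Von Neumann algebras\<close>

locale vN_algebra =
  fixes M :: "'h::complex_hilbert bop set"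
  assumes von_neumann: "von_neumann_algebra M"
begin

text \<open>The double commutant condition turns membership into commutation with fixed operators,
  so that closure of \<open>M\<close> under algebraic operations, inverses and limits becomes a
  matter of commutation identities.\<close>

lemma mem_iff: "x \<in> M \<longleftrightarrow> (\<forall>y\<in>commutant M. y * x = x * y)"
  using von_neumann unfolding von_neumann_algebra_def commutant_def by blast

lemma commutantD: "y \<in> commutant M \<Longrightarrow> x \<in> M \<Longrightarrow> y * x = x * y"
  using mem_iff by blast

lemma adj_mem: "x \<in> M \<Longrightarrow> adj x \<in> M"
  using von_neumann by (simp add: von_neumann_algebra_def)

lemma adj_mem_commutant:
  assumes "y \<in> commutant M" shows "adj y \<in> commutant M"
proof -
  have "x * adj y = adj y * x" if "x \<in> M" for x
  proof -
    have "y * adj x = adj x * y" using assms adj_mem[OF that] by (rule commutantD)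
    then have "adj (y * adj x) = adj (adj x * y)" by simp
    then show ?thesis by simp
  qed
  then show ?thesis by (simp add: commutant_def)
qed

lemma one_mem: "1 \<in> M" and zero_mem: "0 \<in> M" by (simp_all add: mem_iff)

lemma add_mem: "x \<in> M \<Longrightarrow> y \<in> M \<Longrightarrow> x + y \<in> M"
  and diff_mem: "x \<in> M \<Longrightarrow> y \<in> M \<Longrightarrow> x - y \<in> M"
  and uminus_mem: "x \<in> M \<Longrightarrow> - x \<in> M"
  and scaleC_mem: "x \<in> M \<Longrightarrow> c *\<^sub>C x \<in> M"
  and scaleR_mem: "x \<in> M \<Longrightarrow> r *\<^sub>R x \<in> M"
  by (simp_all add: mem_iff algebra_simps bop_mult_scaleC)

lemma mult_mem: "x \<in> M \<Longrightarrow> y \<in> M \<Longrightarrow> x * y \<in> M"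
  unfolding mem_iff by (metis mult.assoc)

lemmas M_intros = adj_mem one_mem zero_mem add_mem diff_mem uminus_mem scaleC_mem scaleR_mem mult_mem

section \<open>Limits, inverses, square roots and unitaries inside the algebra\<close>

lemma closed_algebra: "closed M"
proof -
  have "M = (\<Inter>y\<in>commutant M. {x. y * x = x * y})" using mem_iff by auto
  moreover have "closed {x. y * x = x * y}" for y :: "'h bop"
    by (intro closed_Collect_eq continuous_intros)
  ultimately show ?thesis by (metis (no_types, lifting) closed_INT)
qed

lemma inverse_mem:
  assumes "x \<in> M" "x * s = 1" "s * x = 1" shows "s \<in> M"
  unfolding mem_iff
proof
  fix y assume "y \<in> commutant M"
  then have yx: "y * x = x * y" using assms(1) by (rule commutantD)
  have "(s * x) * y * s = s * (x * y) * s" by (simp only: mult.assoc)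
  also have "\<dots> = s * y * (x * s)" by (simp only: yx[symmetric] mult.assoc)
  finally show "y * s = s * y" by (simp add: assms)
qed

text \<open>For fixed \<open>y\<close> the maps \<open>x \<mapsto> y x\<close> and
  \<open>x \<mapsto> x y\<close> preserve weak limits, so commutation with the commutant passes to
  the limit.\<close>

lemma weak_limit_mem:
  assumes G: "G \<noteq> bot" and lim: "weakly_tendsto X z G" and XM: "eventually (\<lambda>i. X i \<in> M) G"
  shows "z \<in> M"
  unfolding mem_iff
proof
  fix y assume y: "y \<in> commutant M"
  have "cinner (bop_apply (y * z) v) w = cinner (bop_apply (z * y) v) w" for v w
  proof (rule tendsto_unique[OF G])
    have "((\<lambda>i. cinner (bop_apply (X i) v) (bop_apply (adj y) w)) \<longlongrightarrow> cinner (bop_apply z v) (bop_apply (adj y) w)) G"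
      using lim by (simp add: weakly_tendsto_def)
    then show "((\<lambda>i. cinner (bop_apply (y * X i) v) w) \<longlongrightarrow> cinner (bop_apply (y * z) v) w) G"
      by (simp add: cinner_adj_right bop_apply_simps)
    have "((\<lambda>i. cinner (bop_apply (X i * y) v) w) \<longlongrightarrow> cinner (bop_apply (z * y) v) w) G"
      using lim by (simp add: weakly_tendsto_def bop_apply_simps)
    then show "((\<lambda>i. cinner (bop_apply (y * X i) v) w) \<longlongrightarrow> cinner (bop_apply (z * y) v) w) G"
      by (rule Lim_transform_eventually) (use XM in eventually_elim, simp add: commutantD[OF y])
  qed
  then show "y * z = z * y" by (rule bop_eqI_cinner)
qed

text \<open>The iteration is run inside the closed algebra of those elements of \<open>M\<close>
  that commute with everything commuting with \<open>k\<close>; this is how the root inherits the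
  commutation relations of \<open>k\<close>.\<close>

lemma sqrt_one_minus_mem:
  assumes k: "k \<in> M" "adj k = k" "norm k \<le> 1"
  obtains y where "y \<in> M" "adj y = y" "(1 - y) * (1 - y) = 1 - k" "norm y \<le> norm k"
    "\<forall>z. z * k = k * z \<longrightarrow> z * y = y * z"
proof -
  define A where "A = M \<inter> (\<Inter>z\<in>{z. z * k = k * z}. {y. z * y = y * z})"
  have "closed {y. z * y = y * z}" for z :: "'h bop"
    by (intro closed_Collect_eq continuous_intros)
  then have "closed A" unfolding A_def by (intro closed_Int closed_algebra closed_INT) blast
  have A: "x \<in> A \<longleftrightarrow> x \<in> M \<and> (\<forall>z. z * k = k * z \<longrightarrow> z * x = x * z)" for x
    by (simp add: A_def)
  have Ak: "k \<in> A" and A0: "0 \<in> A" unfolding A by (simp_all add: M_intros k)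
  have Amult: "x * y \<in> A" if "x \<in> A" "y \<in> A" for x y
    using that unfolding A by (metis mult.assoc mult_mem)
  have Aadd: "x + y \<in> A" if "x \<in> A" "y \<in> A" for x y
    using that unfolding A by (simp add: M_intros distrib_left distrib_right)
  have Ascale: "r *\<^sub>R x \<in> A" if "x \<in> A" for r x
    using that unfolding A by (simp add: M_intros)
  obtain y where y: "y \<in> A" "adj y = y" "(1 - y) * (1 - y) = 1 - k" "norm y \<le> norm k"
    by (rule sqrt_one_minus[OF k(2,3) Ak A0 \<open>closed A\<close> Aadd Amult Ascale])
  show thesis
  proof (rule that)
    show "y \<in> M" using y(1) unfolding A by (rule conjunct1)
    show "\<forall>z. z * k = k * z \<longrightarrow> z * y = y * z" using y(1) unfolding A by (rule conjunct2)
  qed fact+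
qed

text \<open>Here \<open>(1 - y)\<^sup>2 = 1 - x\<^sup>2\<close> and \<open>y\<close> commutes with
  \<open>x\<close>, so \<open>1 - y\<close> and \<open>x\<close> are the real and imaginary parts of
  a unitary. The quadratic bound on \<open>y\<close> makes the error second order when
  \<open>x\<close> is scaled down.\<close>

lemma unitary_near_one:
  assumes x: "x \<in> M" "adj x = x" "norm x \<le> 1"
  obtains y where "y \<in> M" "adj y = y" "norm y \<le> (norm x)\<^sup>2" "unitary_op (1 - y + \<i> *\<^sub>C x)"
proof -
  have nx: "norm (x * x) \<le> (norm x)\<^sup>2" using norm_mult_ineq[of x x] by (simp add: power2_eq_square)
  also have "\<dots> \<le> 1" using x(3) by (simp add: power_le_one)
  finally have nxx: "norm (x * x) \<le> 1" .
  have xx: "x * x \<in> M" "adj (x * x) = x * x" using x by (simp_all add: M_intros)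
  obtain y where y: "y \<in> M" "adj y = y" "(1 - y) * (1 - y) = 1 - x * x" "norm y \<le> norm (x * x)"
      and comm: "\<forall>z. z * (x * x) = x * x * z \<longrightarrow> z * y = y * z"
    by (rule sqrt_one_minus_mem[OF xx nxx])
  have xy: "x * y = y * x" by (rule comm[rule_format]) (simp add: mult.assoc)
  define r where "r = 1 - y"
  have r: "x * r = r * x" "adj r = r" "r * r = 1 - x * x"
    unfolding r_def using y(2,3) by (simp_all add: right_diff_distrib left_diff_distrib xy)
  have "(r + \<i> *\<^sub>C x) * (r - \<i> *\<^sub>C x) = 1" "(r - \<i> *\<^sub>C x) * (r + \<i> *\<^sub>C x) = 1"
    using r by (simp_all add: algebra_simps bop_mult_scaleC scaleC_scaleC scaleC_minus_one
        scaleC_add_right scaleC_diff_right)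
  moreover have "adj (r + \<i> *\<^sub>C x) = r - \<i> *\<^sub>C x" by (simp add: r x scaleC_minus_left)
  ultimately have "unitary_op (r + \<i> *\<^sub>C x)" unfolding unitary_op_def by simp
  then show thesis unfolding r_def by (rule that[OF y(1,2) order_trans[OF y(4) nx]])
qed

text \<open>Cartesian decomposition into self-adjoint elements, followed by scaling into the unit
  ball.\<close>

lemma selfadjoint_span_induct:
  assumes x: "x \<in> M"
    and sa: "\<And>x. x \<in> M \<Longrightarrow> adj x = x \<Longrightarrow> norm x \<le> 1 \<Longrightarrow> P x"
    and add: "\<And>x y. x \<in> M \<Longrightarrow> y \<in> M \<Longrightarrow> P x \<Longrightarrow> P y \<Longrightarrow> P (x + y)"
    and scale: "\<And>c x. x \<in> M \<Longrightarrow> P x \<Longrightarrow> P (c *\<^sub>C x)"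
  shows "P x"
proof -
  have sa': "P x" if x: "x \<in> M" "adj x = x" for x
  proof -
    \<comment> \<open>The summand 1 keeps \<open>r\<close> positive when
      \<open>x = 0\<close>.\<close>
    define r where "r = norm x + 1"
    have r: "r > 0" by (simp add: r_def add_nonneg_pos)
    have "P ((1 / r) *\<^sub>R x)"
      by (rule sa) (use r x in \<open>auto simp: M_intros r_def divide_le_eq\<close>)
    then have "P (of_real r *\<^sub>C ((1 / r) *\<^sub>R x))" using x by (intro scale scaleR_mem)
    then show ?thesis using r by (simp add: scaleR_scaleC scaleC_scaleC scaleC_one)
  qed
  have "P (x + adj x)" "P (\<i> *\<^sub>C (x - adj x))"
    by (rule sa'; use x in \<open>simp add: M_intros add.commute scaleC_minus_left scaleC_diff_right\<close>)+
  from scale[OF _ this(1), of "1/2"] scale[OF _ this(2), of "- \<i> / 2"]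
  have "P ((1/2) *\<^sub>C (x + adj x) + (- \<i> / 2) *\<^sub>C (\<i> *\<^sub>C (x - adj x)))"
    using x by (intro add) (simp_all add: M_intros)
  moreover have "(1/2) *\<^sub>C (x + adj x) + (- \<i> / 2) *\<^sub>C (\<i> *\<^sub>C (x - adj x)) = (1/2 + 1/2) *\<^sub>C x"
    unfolding scaleC_add_left by (simp add: scaleC_scaleC scaleC_add_right scaleC_diff_right)
  ultimately show ?thesis by (simp add: scaleC_one)
qed

text \<open>Each self-adjoint contraction \<open>x\<close> is the imaginary part of the unitary \<open>(1 - x\<^sup>2)\<^sup>1\<^sup>/\<^sup>2 + \<i> x\<close>.\<close>

lemma unitary_span_induct:
  assumes x: "x \<in> M"
    and unitary: "\<And>u. u \<in> M \<Longrightarrow> unitary_op u \<Longrightarrow> P u"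
    and add: "\<And>x y. x \<in> M \<Longrightarrow> y \<in> M \<Longrightarrow> P x \<Longrightarrow> P y \<Longrightarrow> P (x + y)"
    and scale: "\<And>c x. x \<in> M \<Longrightarrow> P x \<Longrightarrow> P (c *\<^sub>C x)"
  shows "P x"
  using x
proof (rule selfadjoint_span_induct)
  fix x assume x: "x \<in> M" "adj x = x" "norm x \<le> 1"
  obtain y where y: "y \<in> M" "adj y = y" "unitary_op (1 - y + \<i> *\<^sub>C x)"
    using unitary_near_one[OF x] by blast
  let ?u = "1 - y + \<i> *\<^sub>C x"
  have u: "?u \<in> M" "adj ?u \<in> M" using x y by (auto intro!: M_intros)
  have "unitary_op (adj ?u)" using y(3) by (simp add: unitary_op_def)
  then have "P (?u + (- 1) *\<^sub>C adj ?u)"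
    using u y(3) by (intro add scale unitary scaleC_mem)
  then have "P ((- \<i> / 2) *\<^sub>C (?u + (- 1) *\<^sub>C adj ?u))"
    using u by (intro scale add_mem[of ?u] scaleC_mem[of "adj ?u"])
  moreover have "?u + (- 1) *\<^sub>C adj ?u = (2 * \<i>) *\<^sub>C x"
  proof -
    have "?u + (- 1) *\<^sub>C adj ?u = \<i> *\<^sub>C x + \<i> *\<^sub>C x"
      by (simp add: x y scaleC_minus_left scaleC_one)
    also have "\<dots> = (2 * \<i>) *\<^sub>C x" by (simp flip: scaleC_add_left)
    finally show ?thesis .
  qed
  ultimately show "P x" by (simp add: scaleC_scaleC scaleC_one)
qed (rule add scale; assumption)+

end

section \<open>The standard bimodule\<close>

locale tracial_factor =
  fixes M :: "'h::complex_hilbert bop set"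
    and tr :: "'h bop \<Rightarrow> complex"
    and \<iota> :: "'h bop \<Rightarrow> 'k::complex_hilbert"
  assumes II1: "II1_factor M" and trace: "normal_trace M tr" and tr_one: "tr 1 = 1"
    and L2: "L2_completion M tr \<iota>"
begin

sublocale vN_algebra M
  using II1 by unfold_locales (simp add: II1_factor_def factor_def)

lemma centre_scalar: "x \<in> M \<Longrightarrow> x \<in> commutant M \<Longrightarrow> \<exists>c. x = c *\<^sub>C 1"
  using II1 unfolding II1_factor_def factor_def by blast

lemma tr_predual: "tr \<in> predual M" using trace by (simp add: normal_trace_def)

lemma tr_add: "x \<in> M \<Longrightarrow> y \<in> M \<Longrightarrow> tr (x + y) = tr x + tr y"
  and tr_scaleC: "x \<in> M \<Longrightarrow> tr (c *\<^sub>C x) = c * tr x"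
  using tr_predual by (auto simp: predual_def clinear_on_def scaleC_complex_def)

lemma tr_diff: "x \<in> M \<Longrightarrow> y \<in> M \<Longrightarrow> tr (x - y) = tr x - tr y"
  using tr_add[of x "(- 1) *\<^sub>C y"] tr_scaleC[of y "- 1"] by (simp add: scaleC_minus_one scaleC_mem uminus_mem)

lemma tr_zero: "tr 0 = 0"
  using tr_scaleC[of 0 0] by (simp add: zero_mem)

lemma tr_commute: "x \<in> M \<Longrightarrow> y \<in> M \<Longrightarrow> tr (x * y) = tr (y * x)"
  using trace by (simp add: normal_trace_def)

lemma \<iota>_add: "x \<in> M \<Longrightarrow> y \<in> M \<Longrightarrow> \<iota> (x + y) = \<iota> x + \<iota> y"
  and \<iota>_scaleC: "x \<in> M \<Longrightarrow> \<iota> (c *\<^sub>C x) = c *\<^sub>C \<iota> x"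
  using L2 by (auto simp: L2_completion_def clinear_on_def)

lemma \<iota>_scaleR: "x \<in> M \<Longrightarrow> \<iota> (r *\<^sub>R x) = r *\<^sub>R \<iota> x"
  by (simp add: scaleR_scaleC \<iota>_scaleC)

lemma \<iota>_diff: "x \<in> M \<Longrightarrow> y \<in> M \<Longrightarrow> \<iota> (x - y) = \<iota> x - \<iota> y"
  using \<iota>_add[of x "(- 1) *\<^sub>C y"] \<iota>_scaleC[of y "- 1"] by (simp add: scaleC_minus_one scaleC_mem uminus_mem)

lemma \<iota>_zero: "\<iota> 0 = 0"
  using \<iota>_scaleC[of 0 0] by (simp add: zero_mem)

lemma cinner_\<iota>: "a \<in> M \<Longrightarrow> b \<in> M \<Longrightarrow> cinner (\<iota> a) (\<iota> b) = tr (adj b * a)"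
  using L2 by (simp add: L2_completion_def)

lemma cinner_\<iota>_one: "a \<in> M \<Longrightarrow> cinner (\<iota> a) (\<iota> 1) = tr a"
  by (simp add: cinner_\<iota> one_mem)

lemma norm_\<iota>_one: "norm (\<iota> 1) = 1"
proof -
  have "complex_of_real ((norm (\<iota> 1))\<^sup>2) = 1" unfolding cinner_self[symmetric] cinner_\<iota>_one[OF one_mem] by (rule tr_one)
  then have "(norm (\<iota> 1))\<^sup>2 = 1" using of_real_eq_1_iff by blast
  then show ?thesis using norm_ge_zero[of "\<iota> 1"] by (simp add: power2_eq_1_iff)
qed

lemma \<iota>_dense: "closure (\<iota> ` M) = UNIV"
  using L2 by (simp add: L2_completion_def)

lemma \<iota>_sequence:
  obtains b where "\<And>n. b n \<in> M" "(\<lambda>n. \<iota> (b n)) \<longlonglongrightarrow> v"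
proof -
  have "v \<in> closure (\<iota> ` M)" by (simp add: \<iota>_dense)
  then obtain X where X: "\<And>n. X n \<in> \<iota> ` M" "X \<longlonglongrightarrow> v" by (auto simp: closure_sequential)
  then have "\<exists>b. b \<in> M \<and> X n = \<iota> b" for n by blast
  then obtain b where "\<And>n. b n \<in> M \<and> X n = \<iota> (b n)" by metis
  moreover from this have "X = (\<lambda>n. \<iota> (b n))" by auto
  ultimately show thesis using that X(2) by blast
qed

lemma closed_dense_UNIV:
  assumes "closed S" "\<And>b. b \<in> M \<Longrightarrow> \<iota> b \<in> S" shows "v \<in> S"
  using closure_minimal[of "\<iota> ` M" S] assms \<iota>_dense by blast

lemma cinner_\<iota>_eq_0: "(\<And>b. b \<in> M \<Longrightarrow> cinner v (\<iota> b) = 0) \<Longrightarrow> v = 0"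
proof -
  assume "\<And>b. b \<in> M \<Longrightarrow> cinner v (\<iota> b) = 0"
  moreover have "closed {w. cinner v w = 0}"
    by (intro closed_Collect_eq linear_continuous_on bounded_linear_cinner_right continuous_on_const)
  ultimately have "v \<in> {w. cinner v w = 0}" by (intro closed_dense_UNIV[where v = v]) auto
  then show ?thesis by (simp add: cinner_self_eq_0_iff)
qed

lemma bop_dense_eqI:
  assumes "\<And>b. b \<in> M \<Longrightarrow> bop_apply T (\<iota> b) = bop_apply S (\<iota> b)" shows "T = S"
proof (rule bop_eqI)
  fix v
  have "closed {v. bop_apply T v = bop_apply S v}"
    by (intro closed_Collect_eq linear_continuous_on bop_bounded_linear)
  then have "v \<in> {v. bop_apply T v = bop_apply S v}" by (rule closed_dense_UNIV) (simp add: assms)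
  then show "bop_apply T v = bop_apply S v" by simp
qed

lemma bop_dense_cinner_eqI:
  assumes "\<And>b c. b \<in> M \<Longrightarrow> c \<in> M \<Longrightarrow> cinner (bop_apply T (\<iota> b)) (\<iota> c) = cinner (bop_apply S (\<iota> b)) (\<iota> c)"
  shows "T = S"
proof (rule bop_dense_eqI)
  fix b assume b: "b \<in> M"
  have "bop_apply T (\<iota> b) - bop_apply S (\<iota> b) = 0"
    by (rule cinner_\<iota>_eq_0) (simp add: cinner_simps assms b)
  then show "bop_apply T (\<iota> b) = bop_apply S (\<iota> b)" by simp
qed

section \<open>Left and right multiplication as bounded operators on the completion\<close>

lemma norm_\<iota>_square: "b \<in> M \<Longrightarrow> complex_of_real ((norm (\<iota> b))\<^sup>2) = tr (adj b * b)"
  by (simp only: cinner_self[symmetric] cinner_\<iota>)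

lemma norm_\<iota>_adj: "b \<in> M \<Longrightarrow> norm (\<iota> (adj b)) = norm (\<iota> b)"
proof -
  assume b: "b \<in> M"
  have "complex_of_real ((norm (\<iota> (adj b)))\<^sup>2) = complex_of_real ((norm (\<iota> b))\<^sup>2)"
    unfolding norm_\<iota>_square[OF b] norm_\<iota>_square[OF adj_mem[OF b]] using b by (simp add: tr_commute M_intros)
  then show ?thesis by (simp only: of_real_eq_iff power2_eq_iff_nonneg norm_ge_zero)
qed

text \<open>Write \<open>x\<^sup>* x = \<parallel>x\<parallel>\<^sup>2 (1 - r\<^sup>2)\<close> with \<open>r\<close> self-adjoint in \<open>M\<close>; then \<open>tr (b\<^sup>* r\<^sup>2 b) \<ge> 0\<close> is the claim.\<close>

lemma norm_\<iota>_mult_left: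
  assumes x: "x \<in> M" and b: "b \<in> M"
  shows "norm (\<iota> (x * b)) \<le> norm x * norm (\<iota> b)"
proof (cases "x = 0")
  case False
  define C where "C = norm x"
  have C: "C > 0" using False by (simp add: C_def)
  define j where "j = (1 / C\<^sup>2) *\<^sub>R (adj x * x)"
  have "norm (adj x * x) \<le> C\<^sup>2" using norm_mult_ineq[of "adj x" x] by (simp add: C_def power2_eq_square)
  then have "j \<in> M" "adj j = j" "norm j \<le> 1"
    using C x by (auto simp: j_def M_intros divide_le_eq)
  then obtain y where y: "y \<in> M" "adj y = y" "(1 - y) * (1 - y) = 1 - j"
    using sqrt_one_minus_mem by blast
  define r where "r = 1 - y"
  have r: "r \<in> M" "adj r = r" "r * r = 1 - j" using y by (auto simp: r_def M_intros)
  have "complex_of_real ((norm (\<iota> (r * b)))\<^sup>2) = tr (adj b * (r * r) * b)"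
    using r(1,2) b by (subst norm_\<iota>_square) (auto simp: M_intros mult.assoc)
  also have "adj b * (r * r) * b = adj b * b - of_real (1 / C\<^sup>2) *\<^sub>C (adj (x * b) * (x * b))"
    unfolding r(3) j_def by (simp add: algebra_simps scaleR_scaleC bop_mult_scaleC)
  also have "tr \<dots> = complex_of_real ((norm (\<iota> b))\<^sup>2 - (1 / C\<^sup>2) * (norm (\<iota> (x * b)))\<^sup>2)"
  proof -
    have "tr (adj b * b - of_real (1 / C\<^sup>2) *\<^sub>C (adj (x * b) * (x * b)))
        = tr (adj b * b) - of_real (1 / C\<^sup>2) * tr (adj (x * b) * (x * b))"
      using x b by (subst tr_diff, simp_all only: tr_scaleC M_intros)
    also have "\<dots> = complex_of_real ((norm (\<iota> b))\<^sup>2 - (1 / C\<^sup>2) * (norm (\<iota> (x * b)))\<^sup>2)"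
      unfolding norm_\<iota>_square[OF b, symmetric] norm_\<iota>_square[OF mult_mem[OF x b], symmetric] by simp
    finally show ?thesis .
  qed
  finally have "(norm (\<iota> (r * b)))\<^sup>2 = (norm (\<iota> b))\<^sup>2 - (1 / C\<^sup>2) * (norm (\<iota> (x * b)))\<^sup>2"
    by (simp only: of_real_eq_iff)
  then have "(1 / C\<^sup>2) * (norm (\<iota> (x * b)))\<^sup>2 \<le> (norm (\<iota> b))\<^sup>2"
    using zero_le_power2[of "norm (\<iota> (r * b))"] by linarith
  then have "(norm (\<iota> (x * b)))\<^sup>2 \<le> (C * norm (\<iota> b))\<^sup>2"
    using C by (simp add: divide_le_eq power_mult_distrib mult.commute)
  then show ?thesis unfolding C_def by (rule power2_le_imp_le) simp
qed (simp add: \<iota>_zero)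

text \<open>By the trace property the adjoint is isometric for the L2 norm, which carries the left
  estimate over to the right.\<close>

lemma norm_\<iota>_mult_right:
  assumes x: "x \<in> M" and b: "b \<in> M"
  shows "norm (\<iota> (b * x)) \<le> norm x * norm (\<iota> b)"
  using norm_\<iota>_mult_left[of "adj x" "adj b"] norm_\<iota>_adj[of "b * x"] norm_\<iota>_adj[OF b] assms
  by (simp add: M_intros)

text \<open>Injectivity of \<open>\<iota>\<close> is not yet available; the bound itself shows that
  \<open>f a\<close> depends only on \<open>\<iota> a\<close>, and Lipschitz continuity then carries
  \<open>f\<close> from the dense image to the completion.\<close>

lemma extend_bop:
  assumes add: "\<And>a b. a \<in> M \<Longrightarrow> b \<in> M \<Longrightarrow> f (a + b) = f a + f b"
    and scale: "\<And>c a. a \<in> M \<Longrightarrow> f (c *\<^sub>C a) = c *\<^sub>C f a"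
    and bound: "\<And>a. a \<in> M \<Longrightarrow> norm (f a) \<le> C * norm (\<iota> a)" and C: "0 \<le> C"
  shows "\<exists>T :: 'k bop. norm T \<le> C \<and> (\<forall>a\<in>M. bop_apply T (\<iota> a) = f a)"
proof -
  have diff: "norm (f a - f b) \<le> C * norm (\<iota> a - \<iota> b)" if "a \<in> M" "b \<in> M" for a b
  proof -
    have "f (a - b) = f a - f b"
      using add[of a "(- 1) *\<^sub>C b"] scale[of b "- 1"] that by (simp add: scaleC_minus_one scaleC_mem uminus_mem)
    then show ?thesis using bound[of "a - b"] that by (simp add: \<iota>_diff diff_mem)
  qed
  \<comment> \<open>The arbitrary choice of a preimage is harmless by \<open>diff\<close>.\<close>
  define g where "g v = f (SOME b. b \<in> M \<and> \<iota> b = v)" for v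
  have g: "g (\<iota> a) = f a" if "a \<in> M" for a
  proof -
    have "(SOME b. b \<in> M \<and> \<iota> b = \<iota> a) \<in> M \<and> \<iota> (SOME b. b \<in> M \<and> \<iota> b = \<iota> a) = \<iota> a"
      by (rule someI[of _ a]) (simp add: that)
    then show ?thesis using diff[of "SOME b. b \<in> M \<and> \<iota> b = \<iota> a" a] that by (simp add: g_def)
  qed
  have "C-lipschitz_on (\<iota> ` M) g"
    by (rule lipschitz_onI) (auto simp: C g dist_norm diff)
  then obtain h where h: "C-lipschitz_on UNIV h" "\<And>a. a \<in> M \<Longrightarrow> h (\<iota> a) = f a"
    using lipschitz_extend_closure[of C "\<iota> ` M" g] by (auto simp: \<iota>_dense g)
  have cont: "continuous_on UNIV h" by (rule lipschitz_on_continuous_on[OF h(1)])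
  have lim: "(\<lambda>n. h (X n)) \<longlonglongrightarrow> h v" if "X \<longlonglongrightarrow> v" for X v
    using continuous_on_tendsto_compose[OF cont that] by simp
  have hadd: "h (v + w) = h v + h w" for v w
  proof -
    obtain a where a: "\<And>n. a n \<in> M" "(\<lambda>n. \<iota> (a n)) \<longlonglongrightarrow> v" by (rule \<iota>_sequence) blast
    obtain b where b: "\<And>n. b n \<in> M" "(\<lambda>n. \<iota> (b n)) \<longlonglongrightarrow> w" by (rule \<iota>_sequence) blast
    have "(\<lambda>n. h (\<iota> (a n) + \<iota> (b n))) \<longlonglongrightarrow> h (v + w)" by (intro lim tendsto_add a b)
    moreover have "h (\<iota> (a n) + \<iota> (b n)) = h (\<iota> (a n)) + h (\<iota> (b n))" for n
      using h(2)[of "a n + b n"] a(1) b(1) by (simp add: \<iota>_add add_mem h(2) add)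
    ultimately show ?thesis using tendsto_add[OF lim[OF a(2)] lim[OF b(2)]] LIMSEQ_unique by auto
  qed
  have hscale: "h (c *\<^sub>C v) = c *\<^sub>C h v" for c v
  proof -
    obtain a where a: "\<And>n. a n \<in> M" "(\<lambda>n. \<iota> (a n)) \<longlonglongrightarrow> v" by (rule \<iota>_sequence) blast
    have "(\<lambda>n. h (c *\<^sub>C \<iota> (a n))) \<longlonglongrightarrow> h (c *\<^sub>C v)"
      by (intro lim bounded_linear.tendsto[OF bounded_linear_scaleC] a)
    moreover have "h (c *\<^sub>C \<iota> (a n)) = c *\<^sub>C h (\<iota> (a n))" for n
      using h(2)[of "c *\<^sub>C a n"] a(1) by (simp add: \<iota>_scaleC scaleC_mem h(2) scale)
    ultimately have "(\<lambda>n. c *\<^sub>C h (\<iota> (a n))) \<longlonglongrightarrow> h (c *\<^sub>C v)" by simp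
    then show ?thesis
      by (rule LIMSEQ_unique[OF _ bounded_linear.tendsto[OF bounded_linear_scaleC lim[OF a(2)]]])
  qed
  have h0: "h 0 = 0" using hscale[of 0 0] by simp
  have hb: "norm (h v) \<le> C * norm v" for v
    using lipschitz_onD[OF h(1), of v 0] by (simp add: h0 dist_norm)
  have "bounded_linear h"
    by (rule bounded_linear_intro[where K = C]) (auto simp: hadd hscale scaleR_scaleC hb mult.commute)
  then have T: "bop_apply (Bop h) = h" by (rule bop_apply_Bop) (rule hscale)
  show ?thesis
    by (intro exI[of _ "Bop h"] conjI ballI norm_bop_le C) (simp_all add: T hb h(2))
qed

text \<open>Products of an element of \<open>M\<close> with a vector of the completion make sense
  only through \<open>lm\<close> and \<open>rm\<close>. Density makes the operator unique;
  \<open>SOME\<close> merely packages the norm bound with the formula.\<close>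

definition lm :: "'h bop \<Rightarrow> 'k bop" where
  "lm x = (SOME T. norm T \<le> norm x \<and> (\<forall>b\<in>M. bop_apply T (\<iota> b) = \<iota> (x * b)))"

definition rm :: "'h bop \<Rightarrow> 'k bop" where
  "rm x = (SOME T. norm T \<le> norm x \<and> (\<forall>b\<in>M. bop_apply T (\<iota> b) = \<iota> (b * x)))"

lemma
  assumes x: "x \<in> M"
  shows norm_lm: "norm (lm x) \<le> norm x"
    and lm_\<iota>: "b \<in> M \<Longrightarrow> bop_apply (lm x) (\<iota> b) = \<iota> (x * b)"
proof -
  have "\<exists>T. norm T \<le> norm x \<and> (\<forall>b\<in>M. bop_apply T (\<iota> b) = \<iota> (x * b))"
    by (rule extend_bop) (use x in \<open>simp_all add: distrib_left \<iota>_add M_intros bop_mult_scaleC \<iota>_scaleC norm_\<iota>_mult_left\<close>)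
  from someI_ex[OF this] show "norm (lm x) \<le> norm x" "b \<in> M \<Longrightarrow> bop_apply (lm x) (\<iota> b) = \<iota> (x * b)"
    unfolding lm_def by auto
qed

lemma
  assumes x: "x \<in> M"
  shows norm_rm: "norm (rm x) \<le> norm x"
    and rm_\<iota>: "b \<in> M \<Longrightarrow> bop_apply (rm x) (\<iota> b) = \<iota> (b * x)"
proof -
  have "\<exists>T. norm T \<le> norm x \<and> (\<forall>b\<in>M. bop_apply T (\<iota> b) = \<iota> (b * x))"
    by (rule extend_bop) (use x in \<open>simp_all add: distrib_right \<iota>_add M_intros bop_mult_scaleC \<iota>_scaleC norm_\<iota>_mult_right\<close>)
  from someI_ex[OF this] show "norm (rm x) \<le> norm x" "b \<in> M \<Longrightarrow> bop_apply (rm x) (\<iota> b) = \<iota> (b * x)"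
    unfolding rm_def by auto
qed

lemma lm_simps:
  assumes "x \<in> M" "y \<in> M"
  shows "lm (x + y) = lm x + lm y" "lm (x - y) = lm x - lm y" "lm (c *\<^sub>C x) = c *\<^sub>C lm x"
    "lm (x * y) = lm x * lm y"
  using assms by (auto intro!: bop_dense_eqI
      simp: bop_apply_simps lm_\<iota> M_intros \<iota>_add \<iota>_diff \<iota>_scaleC distrib_right left_diff_distrib bop_mult_scaleC mult.assoc)

lemma rm_simps:
  assumes "x \<in> M" "y \<in> M"
  shows "rm (x + y) = rm x + rm y" "rm (x - y) = rm x - rm y" "rm (c *\<^sub>C x) = c *\<^sub>C rm x"
    "rm (x * y) = rm y * rm x"
  using assms by (auto intro!: bop_dense_eqI
      simp: bop_apply_simps rm_\<iota> M_intros \<iota>_add \<iota>_diff \<iota>_scaleC distrib_left right_diff_distrib bop_mult_scaleC mult.assoc)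

lemma lm_one [simp]: "lm 1 = 1" and rm_one [simp]: "rm 1 = 1"
  by (auto intro!: bop_dense_eqI simp: bop_apply_simps lm_\<iota> rm_\<iota> one_mem)

lemma lm_zero [simp]: "lm 0 = 0" and rm_zero [simp]: "rm 0 = 0"
  by (auto intro!: bop_dense_eqI simp: bop_apply_simps lm_\<iota> rm_\<iota> zero_mem \<iota>_zero)

lemma lm_rm_commute:
  assumes "x \<in> M" "y \<in> M" shows "lm x * rm y = rm y * lm x"
  using assms by (auto intro!: bop_dense_eqI simp: bop_apply_simps lm_\<iota> rm_\<iota> M_intros mult.assoc)

lemma lm_rm_commute_vec:
  assumes "x \<in> M" "y \<in> M"
  shows "bop_apply (lm x) (bop_apply (rm y) v) = bop_apply (rm y) (bop_apply (lm x) v)"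
  using lm_rm_commute[OF assms] by (metis bop_apply_simps(6))

lemma adj_lm: "x \<in> M \<Longrightarrow> adj (lm x) = lm (adj x)"
  by (rule bop_dense_cinner_eqI) (simp add: cinner_adj_left lm_\<iota> cinner_\<iota> M_intros mult.assoc)

lemma adj_rm: "x \<in> M \<Longrightarrow> adj (rm x) = rm (adj x)"
proof (rule bop_dense_cinner_eqI)
  fix b c assume m: "x \<in> M" "b \<in> M" "c \<in> M"
  have "cinner (bop_apply (adj (rm x)) (\<iota> b)) (\<iota> c) = tr (adj x * (adj c * b))"
    using m by (simp add: cinner_adj_left rm_\<iota> cinner_\<iota> M_intros mult.assoc)
  also have "\<dots> = tr (adj c * b * adj x)" using m by (intro tr_commute M_intros)
  finally show "cinner (bop_apply (adj (rm x)) (\<iota> b)) (\<iota> c) = cinner (bop_apply (rm (adj x)) (\<iota> b)) (\<iota> c)"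
    using m by (simp add: rm_\<iota> cinner_\<iota> M_intros mult.assoc)
qed

end

section \<open>Faithfulness of the trace\<close>

text \<open>The third conclusion is the reducing-subspace criterion. It later places a projection
  both in \<open>M\<close> and in its commutant.\<close>

lemma projection_onto:
  fixes S :: "'a::complex_hilbert set"
  assumes S: "closed_csubspace S"
  obtains P where "\<forall>v. bop_apply P v \<in> S" "\<forall>v\<in>S. bop_apply P v = v"
    "\<forall>x. (\<forall>v\<in>S. bop_apply x v \<in> S) \<and> (\<forall>v\<in>S. bop_apply (adj x) v \<in> S) \<longrightarrow> x * P = P * x"
proof -
  note S' = closed_csubspaceD[OF S] and O' = closed_csubspaceD[OF closed_csubspace_ortho[of S]]
  have "\<exists>a. a \<in> S \<and> v - a \<in> ortho S" for v
    by (rule orthogonal_decomposition[OF S, of v]) force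
  then obtain p where p: "\<And>v. p v \<in> S" "\<And>v. v - p v \<in> ortho S" by metis
  have eq: "p v = a" if "a \<in> S" "v - a \<in> ortho S" for v a
  proof -
    have "a - p v \<in> S" using that(1) p(1) by (rule S'(6))
    moreover have "(v - p v) - (v - a) \<in> ortho S" using p(2) that(2) by (rule O'(6))
    ultimately have "a - p v = 0" by (intro ortho_inter) (auto simp: algebra_simps)
    then show ?thesis by simp
  qed
  have nrm: "norm (p v) \<le> norm v" for v
  proof -
    have "cinner (p v) (v - p v) = 0"
      using p by (auto simp: ortho_def intro: cinner_eq_zero_commute[THEN iffD1])
    then have "(norm (p v + (v - p v)))\<^sup>2 = (norm (p v))\<^sup>2 + (norm (v - p v))\<^sup>2"
      unfolding norm_add_square by simp
    then have "(norm (p v))\<^sup>2 \<le> (norm v)\<^sup>2" by simp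
    then show ?thesis by (rule power2_le_imp_le) simp
  qed
  have padd: "p (v + w) = p v + p w" for v w
    using S'(3)[OF p(1)[of v] p(1)[of w]] O'(3)[OF p(2)[of v] p(2)[of w]] by (intro eq) (simp_all add: algebra_simps)
  have pscale: "p (c *\<^sub>C v) = c *\<^sub>C p v" for c v
    using S'(4)[OF p(1)[of v]] O'(4)[OF p(2)[of v]] by (intro eq) (simp_all add: scaleC_diff_right)
  have "bounded_linear p"
    by (rule bounded_linear_intro[where K = 1]) (auto simp: padd pscale nrm scaleR_scaleC)
  then have P: "bop_apply (Bop p) = p" by (rule bop_apply_Bop) (rule pscale)
  show thesis
  proof (rule that[of "Bop p"])
    show "\<forall>v. bop_apply (Bop p) v \<in> S" by (simp add: P p)
    have "p v = v" if "v \<in> S" for v by (rule eq) (use that O'(2) in auto)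
    then show "\<forall>v\<in>S. bop_apply (Bop p) v = v" by (simp add: P)
    have "x * Bop p = Bop p * x"
      if x: "\<forall>v\<in>S. bop_apply x v \<in> S" "\<forall>v\<in>S. bop_apply (adj x) v \<in> S" for x
    proof (rule bop_eqI)
      fix v
      have "bop_apply x (v - p v) \<in> ortho S"
        using p(2)[of v] x(2) by (simp add: ortho_def flip: cinner_adj_right)
      then have "p (bop_apply x v) = bop_apply x (p v)"
        using x(1) p(1) by (intro eq) (simp_all add: bop_linear_simps)
      then show "bop_apply (x * Bop p) v = bop_apply (Bop p * x) v" by (simp add: bop_apply_simps P)
    qed
    then show "\<forall>x. (\<forall>v\<in>S. bop_apply x v \<in> S) \<and> (\<forall>v\<in>S. bop_apply (adj x) v \<in> S) \<longrightarrow> x * Bop p = Bop p * x"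
      by blast
  qed
qed

text \<open>Pairing \<open>(1 + c) y = n w\<close> with \<open>y\<close> gives an inequality
  quadratic in the norm of \<open>n\<^sup>* y\<close>, from which that norm is eliminated. Applied
  to large multiples of one element, the bound forces decay.\<close>

lemma resolvent_bound:
  fixes n c X :: "'a::complex_hilbert bop"
  assumes X: "(1 + c) * X = 1"
    and c: "\<And>v. (norm (bop_apply (adj n) v))\<^sup>2 \<le> Re (cinner (bop_apply c v) v)"
  shows "norm (bop_apply X (bop_apply n w)) \<le> norm w"
proof -
  define y where "y = bop_apply X (bop_apply n w)"
  let ?t = "norm (bop_apply (adj n) y)"
  have "bop_apply (1 + c) y = bop_apply ((1 + c) * X) (bop_apply n w)"
    by (simp only: y_def bop_apply_simps)
  then have "y + bop_apply c y = bop_apply n w" by (simp add: X bop_apply_simps)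
  then have "cinner (y + bop_apply c y) y = cinner (bop_apply n w) y" by simp
  also have "\<dots> = cinner w (bop_apply (adj n) y)" by (simp add: cinner_adj_right)
  finally have "(norm y)\<^sup>2 + Re (cinner (bop_apply c y) y) = Re (cinner w (bop_apply (adj n) y))"
    by (simp add: cinner_simps cinner_self complex_eq_iff)
  also have "\<dots> \<le> norm w * ?t" using Cauchy_Schwarz complex_Re_le_cmod order_trans by blast
  finally have le: "(norm y)\<^sup>2 + ?t\<^sup>2 \<le> norm w * ?t" using c[of y] by linarith
  have "2 * norm w * ?t \<le> (norm w)\<^sup>2 + ?t\<^sup>2" by (rule sum_squares_bound)
  then have "(norm y)\<^sup>2 \<le> (norm w)\<^sup>2"
    using le zero_le_power2[of "norm y"] zero_le_power2[of ?t] by linarith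
  then show ?thesis unfolding y_def by (rule power2_le_imp_le) simp
qed

text \<open>A uniform operator bound lets convergence to 0 pass from approximating vectors to their
  limit, so it need only be tested on a dense set.\<close>

lemma closed_strongly_null:
  fixes X :: "'i \<Rightarrow> 'a::complex_hilbert bop"
  assumes X: "\<And>i. norm (X i) \<le> C"
  shows "closed {v. ((\<lambda>i. bop_apply (X i) v) \<longlongrightarrow> 0) F}"
proof (subst closed_sequential_limits, intro allI impI, unfold mem_Collect_eq)
  fix V v assume V: "(\<forall>n. ((\<lambda>i. bop_apply (X i) (V n)) \<longlongrightarrow> 0) F) \<and> V \<longlonglongrightarrow> v"
  show "((\<lambda>i. bop_apply (X i) v) \<longlongrightarrow> 0) F"
  proof (rule tendstoI)
    fix e :: real assume e: "0 < e"
    define d where "d = e / (2 * (\<bar>C\<bar> + 1))"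
    have d: "0 < d" "(\<bar>C\<bar> + 1) * d = e / 2" using e by (auto simp: d_def add_nonneg_pos field_simps)
    have "\<forall>\<^sub>F n in sequentially. dist (V n) v < d" using V d by (intro tendstoD) auto
    then obtain n where n: "dist (V n) v < d" by (auto simp: eventually_sequentially)
    have "\<forall>\<^sub>F i in F. dist (bop_apply (X i) (V n)) 0 < e / 2" using V e by (intro tendstoD) auto
    then show "\<forall>\<^sub>F i in F. dist (bop_apply (X i) v) 0 < e"
    proof eventually_elim
      case (elim i)
      have "norm (bop_apply (X i) (v - V n)) \<le> norm (X i) * norm (v - V n)" by (rule norm_bop_apply)
      also have "\<dots> \<le> (\<bar>C\<bar> + 1) * d"
        using n X[of i] by (intro mult_mono) (auto simp: dist_norm norm_minus_commute)
      finally have "norm (bop_apply (X i) (v - V n)) \<le> e / 2" by (simp add: d)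
      moreover have "bop_apply (X i) v = bop_apply (X i) (v - V n) + bop_apply (X i) (V n)"
        by (simp add: bop_linear_simps)
      then have "norm (bop_apply (X i) v) \<le> norm (bop_apply (X i) (v - V n)) + norm (bop_apply (X i) (V n))"
        by (metis norm_triangle_ineq)
      ultimately show ?case using elim by (simp add: dist_norm)
    qed
  qed
qed

context tracial_factor
begin

text \<open>The kernel \<open>N\<close> of \<open>\<iota>\<close> is a two-sided ideal, so unless it vanishes the vectors \<open>n v\<close> with
  \<open>n \<in> N\<close> span a dense subspace because \<open>M\<close> is a factor. The resolvents \<open>(1 + \<Sum>n\<in>F. n n\<^sup>*)\<^sup>-\<^sup>1\<close>,
  \<open>F \<subseteq> N\<close> finite, then tend weakly to 0, although each of them has trace 1.\<close>

lemma \<iota>_eq_0D: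
  assumes n0: "n0 \<in> M" "\<iota> n0 = 0"
  shows "n0 = 0"
proof (rule ccontr)
  assume "n0 \<noteq> 0"
  define N where "N = {b \<in> M. \<iota> b = 0}"
  have Nl: "x * b \<in> N" if "x \<in> M" "b \<in> N" for x b
    using that lm_\<iota>[of x b] by (simp add: N_def mult_mem)
  have Nr: "b * x \<in> N" if "x \<in> M" "b \<in> N" for x b
    using that rm_\<iota>[of x b] by (simp add: N_def mult_mem)
  have Nadj: "adj b \<in> N" if "b \<in> N" for b
    using that norm_\<iota>_adj[of b] by (simp add: N_def adj_mem)
  have Nadd: "a + b \<in> N" if "a \<in> N" "b \<in> N" for a b
    using that by (simp add: N_def add_mem \<iota>_add)
  have NM: "b \<in> M" if "b \<in> N" for b using that by (simp add: N_def)
  have Nsum: "sum f I \<in> N" if "\<And>i. i \<in> I \<Longrightarrow> f i \<in> N" for f and I :: "'h bop set"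
    using that by (induction I rule: infinite_finite_induct) (auto simp: Nadd, auto simp: N_def zero_mem \<iota>_zero)

  \<comment> \<open>The common kernel of the ideal is invariant under \<open>M\<close> and under its
    commutant. Its projection is therefore central, hence scalar, so \<open>K\<close> is 0 or
    everything, and \<open>n0\<close> excludes the latter.\<close>
  define K where "K = {v. \<forall>n\<in>N. bop_apply n v = 0}"
  have "K = (\<Inter>n\<in>N. {v. bop_apply n v = 0})" by (auto simp: K_def)
  moreover have "closed {v. bop_apply n v = 0}" for n :: "'h bop"
    by (intro closed_Collect_eq linear_continuous_on bop_bounded_linear continuous_on_const)
  ultimately have "closed K" by (simp add: closed_INT)
  then have Ksub: "closed_csubspace K" by (auto simp: closed_csubspace_def K_def bop_linear_simps)
  have KM: "bop_apply x v \<in> K" if "x \<in> M" "v \<in> K" for x v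
    using that Nr by (auto simp: K_def simp flip: bop_apply_simps(6))
  have KM': "bop_apply y v \<in> K" if "y \<in> commutant M" "v \<in> K" for y v
  proof -
    have "bop_apply n (bop_apply y v) = bop_apply y (bop_apply n v)" if "n \<in> N" for n
      using commutantD[OF \<open>y \<in> commutant M\<close> NM[OF that]] by (metis bop_apply_simps(6))
    then show ?thesis using that(2) by (simp add: K_def)
  qed
  obtain P where P: "\<forall>v. bop_apply P v \<in> K" "\<forall>v\<in>K. bop_apply P v = v"
    and Pcomm: "\<forall>x. (\<forall>v\<in>K. bop_apply x v \<in> K) \<and> (\<forall>v\<in>K. bop_apply (adj x) v \<in> K) \<longrightarrow> x * P = P * x"
    by (rule projection_onto[OF Ksub])
  have "x * P = P * x" if "x \<in> M" for x
    by (rule Pcomm[rule_format]) (use that KM adj_mem in blast)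
  then have "P \<in> commutant M" by (simp add: commutant_def)
  moreover have "y * P = P * y" if "y \<in> commutant M" for y
    by (rule Pcomm[rule_format]) (use that KM' adj_mem_commutant in blast)
  then have "P \<in> M" by (simp add: mem_iff)
  ultimately obtain c where c: "P = c *\<^sub>C 1" using centre_scalar by blast
  have K0: "v = 0" if v: "v \<in> K" for v
  proof (rule ccontr)
    assume "v \<noteq> 0"
    have "c *\<^sub>C v = v" using P(2) v by (simp add: c bop_apply_simps)
    then have "(c - 1) *\<^sub>C v = 0" by (simp add: scaleC_diff_left scaleC_one)
    then have "cmod (c - 1) * norm v = 0" using norm_scaleC[of "c - 1" v] by simp
    then have "c = 1" using \<open>v \<noteq> 0\<close> by simp
    then have "w \<in> K" for w using P(1) by (simp add: c scaleC_one bop_apply_simps)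
    then have "n0 = 0" using n0 by (intro bop_eqI) (simp add: K_def N_def bop_apply_simps)
    then show False using \<open>n0 \<noteq> 0\<close> by simp
  qed

  define C where "C F = (\<Sum>n\<in>F. n * adj n)" for F :: "'h bop set"
  have Cpos: "Re (cinner (bop_apply (C F) v) v) = (\<Sum>n\<in>F. (norm (bop_apply (adj n) v))\<^sup>2)" for F v
    unfolding C_def by (induction F rule: infinite_finite_induct)
      (auto simp: bop_apply_simps cinner_simps power2_norm_eq_cinner cinner_adj_right)
  have "\<exists>S. (1 + C F) * S = 1 \<and> S * (1 + C F) = 1 \<and> norm S \<le> 1" for F
  proof -
    have "(norm v)\<^sup>2 \<le> Re (cinner (bop_apply (1 + C F) v) v)" for v
      using sum_nonneg[of F "\<lambda>n. (norm (bop_apply (adj n) v))\<^sup>2"]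
      by (simp add: bop_apply_simps cinner_add_left Cpos power2_norm_eq_cinner[of v, symmetric])
    then show ?thesis by (rule coercive_invertible) blast
  qed
  then obtain X where X: "\<And>F. (1 + C F) * X F = 1" "\<And>F. X F * (1 + C F) = 1" "\<And>F. norm (X F) \<le> 1"
    by metis
  have CN: "C F \<in> N" if "F \<subseteq> N" for F
    unfolding C_def using that by (intro Nsum Nr adj_mem NM) auto
  have XM: "X F \<in> M" if "F \<subseteq> N" for F
    by (rule inverse_mem[OF _ X(1,2)]) (use NM[OF CN[OF that]] in \<open>simp add: add_mem one_mem\<close>)
  have trX: "tr (X F) = 1" if "F \<subseteq> N" for F
  proof -
    \<comment> \<open>The defect \<open>1 - X F\<close> lies in the ideal, where the trace
      vanishes.\<close>
    have "1 - X F = X F * C F" using X(2)[of F] by (simp add: algebra_simps)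
    then have "\<iota> (1 - X F) = 0" using Nl[OF XM CN, OF that that] by (simp add: N_def)
    then have "tr (1 - X F) = 0" using cinner_\<iota>_one[of "1 - X F"] XM[OF that] by (simp add: M_intros)
    then show ?thesis using XM[OF that] by (simp add: tr_diff one_mem tr_one)
  qed

  let ?G = "finite_subsets_at_top N"
  define S where "S = {v. ((\<lambda>F. bop_apply (X F) v) \<longlongrightarrow> 0) ?G}"
  have XS: "bop_apply n w \<in> S" if n: "n \<in> N" for n w
    unfolding S_def mem_Collect_eq
  proof (rule tendstoI)
    fix e :: real assume e: "0 < e"
    obtain k :: nat where k: "norm w / e < real k" using reals_Archimedean2 by blast
    have k0: "0 < real k" using k e by (meson divide_nonneg_pos norm_ge_zero order.strict_trans1)
    \<comment> \<open>Multiples of \<open>n\<close> stay in \<open>N\<close>, and as soon as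
      \<open>m\<close> belongs to \<open>F\<close> the resolvent bound controls \<open>k\<close>
      times the norm in question.\<close>
    define m where "m = real k *\<^sub>R n"
    have m: "m \<in> N" using n by (simp add: N_def m_def scaleR_mem \<iota>_scaleR)
    have "\<forall>\<^sub>F F in ?G. finite F \<and> m \<in> F \<and> F \<subseteq> N"
      unfolding eventually_finite_subsets_at_top by (rule exI[of _ "{m}"]) (use m in auto)
    then show "\<forall>\<^sub>F F in ?G. dist (bop_apply (X F) (bop_apply n w)) 0 < e"
    proof eventually_elim
      case (elim F)
      have "norm (bop_apply (X F) (bop_apply m w)) \<le> norm w"
      proof (rule resolvent_bound[OF X(1)])
        show "(norm (bop_apply (adj m) v))\<^sup>2 \<le> Re (cinner (bop_apply (C F) v) v)" for v
          unfolding Cpos using elim by (intro member_le_sum) auto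
      qed
      then have "real k * norm (bop_apply (X F) (bop_apply n w)) \<le> norm w"
        by (simp add: m_def bop_apply_simps bop_linear_simps scaleR_scaleC norm_scaleC)
      also have "norm w < real k * e" using k e by (simp add: divide_less_eq)
      finally show ?case using k0 by simp
    qed
  qed
  have "closed S" unfolding S_def by (rule closed_strongly_null) (rule X(3))
  then have Ssub: "closed_csubspace S"
    unfolding closed_csubspace_def S_def
    using bounded_linear.tendsto[OF bounded_linear_scaleC, of _ "0::'h" ?G]
    by (auto simp: bop_linear_simps intro: tendsto_add_zero)
  have SU: "v \<in> S" for v
  proof -
    obtain a b where ab: "a \<in> S" "b \<in> ortho S" "v = a + b" by (rule orthogonal_decomposition[OF Ssub])
    \<comment> \<open>A vector orthogonal to all \<open>n\<^sup>* n b\<close> is killed by the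
      ideal, and the common kernel \<open>K\<close> is 0.\<close>
    have "bop_apply n b = 0" if n: "n \<in> N" for n
    proof -
      have "cinner b (bop_apply (adj n) (bop_apply n b)) = 0"
        using ab(2) XS[OF Nadj[OF n]] by (auto simp: ortho_def)
      then show ?thesis by (simp add: cinner_adj_right cinner_self_eq_0_iff)
    qed
    then have "b = 0" by (intro K0) (simp add: K_def)
    then show ?thesis using ab by simp
  qed
  have "weakly_tendsto X 0 ?G"
    unfolding weakly_tendsto_def
  proof (intro allI)
    fix v w
    have "((\<lambda>F. bop_apply (X F) v) \<longlongrightarrow> 0) ?G" using SU by (simp add: S_def)
    from bounded_linear.tendsto[OF bounded_linear_cinner_left this]
    show "((\<lambda>F. cinner (bop_apply (X F) v) w) \<longlongrightarrow> cinner (bop_apply 0 v) w) ?G"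
      by (simp add: bop_apply_simps)
  qed
  moreover have evN: "\<forall>\<^sub>F F in ?G. F \<subseteq> N"
    unfolding eventually_finite_subsets_at_top by (rule exI[of _ "{}"]) auto
  then have "\<forall>\<^sub>F F in ?G. X F \<in> M" by eventually_elim (rule XM)
  ultimately have "((\<lambda>F. tr (X F)) \<longlongrightarrow> tr 0) ?G"
    by (intro predual_weakly_continuous[OF tr_predual _ X(3)]) (auto simp: zero_mem)
  moreover have "((\<lambda>F. tr (X F)) \<longlongrightarrow> 1) ?G"
    by (rule tendsto_eventually) (use evN in eventually_elim, rule trX)
  ultimately have "tr 0 = 1" using tendsto_unique finite_subsets_at_top_neq_bot by blast
  then show False by (simp add: tr_zero)
qed

lemma \<iota>_inject: "x \<in> M \<Longrightarrow> y \<in> M \<Longrightarrow> \<iota> x = \<iota> y \<Longrightarrow> x = y"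
  using \<iota>_eq_0D[of "x - y"] by (simp add: diff_mem \<iota>_diff)

end

section \<open>Averaging over the unitary group\<close>

lemma unitary_norm:
  assumes "unitary_op u" shows "norm (bop_apply u v) = norm v"
proof -
  have "cinner (bop_apply u v) (bop_apply u v) = cinner (bop_apply (adj u * u) v) v"
    by (simp add: bop_apply_simps cinner_adj_left)
  also have "\<dots> = cinner v v" using assms by (simp add: unitary_op_def bop_apply_simps)
  finally have "(norm (bop_apply u v))\<^sup>2 = (norm v)\<^sup>2" by (simp add: power2_norm_eq_cinner)
  then show ?thesis by simp
qed

lemma unitary_norm_le: "unitary_op u \<Longrightarrow> norm u \<le> 1"
  by (rule norm_bop_le) (simp_all add: unitary_norm)

lemma unitary_conj_norm_le: "unitary_op u \<Longrightarrow> norm (u * x * adj u) \<le> norm x"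
proof -
  assume u: "unitary_op u"
  have "norm (u * x * adj u) \<le> norm (u * x) * norm (adj u)" by (rule norm_mult_ineq)
  also have "\<dots> \<le> norm (u * x) * 1" using unitary_norm_le[OF u] by (intro mult_left_mono) auto
  also have "\<dots> \<le> norm u * norm x" using norm_mult_ineq[of u x] by simp
  also have "\<dots> \<le> 1 * norm x" using unitary_norm_le[OF u] by (intro mult_right_mono) auto
  finally show ?thesis by simp
qed

lemma convex_combination_norm_le:
  fixes a b :: "'a::real_normed_vector"
  assumes "norm a \<le> C" "norm b \<le> C" "0 \<le> s" "0 \<le> t" "s + t = 1"
  shows "norm (s *\<^sub>R a + t *\<^sub>R b) \<le> C"
proof -
  have "norm (s *\<^sub>R a + t *\<^sub>R b) \<le> s * norm a + t * norm b"
    using norm_triangle_ineq[of "s *\<^sub>R a" "t *\<^sub>R b"] assms by simp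
  also have "\<dots> \<le> s * C + t * C" using assms by (intro add_mono mult_left_mono) auto
  also have "\<dots> = C" using assms(5) by (simp flip: distrib_right)
  finally show ?thesis .
qed

lemma closed_bop_kernel: "closed {v. bop_apply T v = (0 :: 'c::complex_hilbert)}"
  by (intro closed_Collect_eq linear_continuous_on bop_bounded_linear continuous_on_const)

context tracial_factor
begin

definition Adv :: "'h bop \<Rightarrow> 'k bop" where "Adv u = lm u * rm (adj u)"

lemma Adv_\<iota>: "u \<in> M \<Longrightarrow> x \<in> M \<Longrightarrow> bop_apply (Adv u) (\<iota> x) = \<iota> (u * x * adj u)"
  by (simp add: Adv_def bop_apply_simps lm_\<iota> rm_\<iota> M_intros mult.assoc)

lemma Adv_mult: "u \<in> M \<Longrightarrow> w \<in> M \<Longrightarrow> Adv (u * w) = Adv u * Adv w"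
  by (rule bop_dense_eqI) (simp add: Adv_\<iota> bop_apply_simps M_intros mult.assoc)

lemma Adv_one: "Adv 1 = 1" by (simp add: Adv_def)

lemma adj_Adv: "u \<in> M \<Longrightarrow> adj (Adv u) = Adv (adj u)"
  by (simp add: Adv_def adj_lm adj_rm M_intros lm_rm_commute)

lemma unitary_Adv: "u \<in> M \<Longrightarrow> unitary_op u \<Longrightarrow> unitary_op (Adv u)"
  by (simp add: unitary_op_def adj_Adv Adv_one M_intros flip: Adv_mult)

lemma Adv_\<iota>_one: "u \<in> M \<Longrightarrow> unitary_op u \<Longrightarrow> bop_apply (Adv u) (\<iota> 1) = \<iota> 1"
  by (simp add: Adv_\<iota> one_mem unitary_op_def)

definition central :: "'k \<Rightarrow> bool" where
  "central v \<longleftrightarrow> (\<forall>x\<in>M. bop_apply (lm x) v = bop_apply (rm x) v)"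

text \<open>\<open>u v u\<^sup>* = v\<close> says that \<open>u\<close> commutes with
  \<open>v\<close>, and the unitaries span \<open>M\<close>.\<close>

lemma Adv_fixed_central:
  assumes fixed: "\<And>u. u \<in> M \<Longrightarrow> unitary_op u \<Longrightarrow> bop_apply (Adv u) v = v"
  shows "central v"
  unfolding central_def
proof
  fix x assume "x \<in> M"
  then show "bop_apply (lm x) v = bop_apply (rm x) v"
  proof (rule unitary_span_induct)
    fix u assume u: "u \<in> M" "unitary_op u"
    have "bop_apply (rm u) v = bop_apply (rm u) (bop_apply (Adv u) v)" using fixed[OF u] by simp
    also have "\<dots> = bop_apply (lm u) (bop_apply (rm (adj u * u)) v)"
      using u by (simp add: Adv_def bop_apply_simps rm_simps M_intros lm_rm_commute_vec)
    also have "\<dots> = bop_apply (lm u) v" using u by (simp add: unitary_op_def bop_apply_simps)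
    finally show "bop_apply (lm u) v = bop_apply (rm u) v" by simp
  qed (simp_all add: lm_simps rm_simps bop_apply_simps)
qed

lemma central_Adv_fixed:
  assumes "central v" "u \<in> M" "unitary_op u" shows "bop_apply (Adv u) v = v"
proof -
  have "bop_apply (Adv u) v = bop_apply (rm (adj u)) (bop_apply (lm u) v)"
    using assms by (simp add: Adv_def bop_apply_simps lm_rm_commute_vec M_intros)
  also have "\<dots> = bop_apply (rm (u * adj u)) v"
    using assms by (simp add: central_def rm_simps M_intros bop_apply_simps)
  finally show ?thesis using assms by (simp add: unitary_op_def bop_apply_simps)
qed

text \<open>The element of minimal norm in the closure is unique, hence fixed.\<close>

lemma convex_invariant_central:
  assumes Q: "convex Q" "Q \<noteq> {}"
    and inv: "\<And>u v. u \<in> M \<Longrightarrow> unitary_op u \<Longrightarrow> v \<in> Q \<Longrightarrow> bop_apply (Adv u) v \<in> Q"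
  obtains w where "w \<in> closure Q" "central w"
proof -
  obtain w where w: "w \<in> closure Q" "\<And>z. z \<in> closure Q \<Longrightarrow> norm w \<le> norm z"
    "\<And>z. z \<in> closure Q \<Longrightarrow> norm z \<le> norm w \<Longrightarrow> z = w"
    by (rule convex_minimal_norm[of "closure Q"]) (use Q in \<open>auto simp: convex_closure\<close>)
  have "bop_apply (Adv u) w = w" if u: "u \<in> M" "unitary_op u" for u
  proof (rule w(3))
    obtain X where X: "\<And>n. X n \<in> Q" "X \<longlonglongrightarrow> w" using w(1) by (auto simp: closure_sequential)
    have "(\<lambda>n. bop_apply (Adv u) (X n)) \<longlonglongrightarrow> bop_apply (Adv u) w"
      by (rule bounded_linear.tendsto[OF bop_bounded_linear X(2)])
    then show "bop_apply (Adv u) w \<in> closure Q"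
      using inv[OF u X(1)] unfolding closure_sequential by (intro exI conjI allI)
    show "norm (bop_apply (Adv u) w) \<le> norm w" by (simp add: unitary_norm unitary_Adv u)
  qed
  then show thesis using that[OF w(1)] Adv_fixed_central by blast
qed

text \<open>The same convex combination of unitary conjugations acts on an element of
  \<open>M\<close> and on a vector at once. Keeping the pair together lets an identity that involves
  both be averaged in \<open>corner_scalar\<close>.\<close>

inductive avg :: "'h bop \<Rightarrow> 'k \<Rightarrow> 'h bop \<Rightarrow> 'k \<Rightarrow> bool" for x v where
  base: "avg x v x v"
| conj: "avg x v y w \<Longrightarrow> u \<in> M \<Longrightarrow> unitary_op u \<Longrightarrow> avg x v (u * y * adj u) (bop_apply (Adv u) w)"
| mix: "avg x v y w \<Longrightarrow> avg x v y' w' \<Longrightarrow> 0 \<le> s \<Longrightarrow> 0 \<le> t \<Longrightarrow> s + t = 1 \<Longrightarrow>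
    avg x v (s *\<^sub>R y + t *\<^sub>R y') (s *\<^sub>R w + t *\<^sub>R w')"

lemma avg_trans: "avg y w y' w' \<Longrightarrow> avg x v y w \<Longrightarrow> avg x v y' w'"
  by (induction rule: avg.induct) (auto intro: avg.intros)

lemma avg_mem: "avg x v y w \<Longrightarrow> x \<in> M \<Longrightarrow> y \<in> M"
  by (induction rule: avg.induct) (auto simp: M_intros)

text \<open>A derivation of \<open>avg\<close> is a recipe that can be replayed on any other
  starting vector.\<close>

lemma avg_change: "avg x v y w \<Longrightarrow> \<exists>w'. avg x v' y w'"
  by (induction rule: avg.induct) (blast intro: avg.intros)+

lemma avg_\<iota>: "avg x (\<iota> x) y w \<Longrightarrow> x \<in> M \<Longrightarrow> w = \<iota> y"
  by (induction rule: avg.induct) (auto simp: avg_mem Adv_\<iota> \<iota>_add \<iota>_scaleR M_intros)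

lemma avg_norm: "avg x v y w \<Longrightarrow> norm y \<le> norm x"
  by (induction rule: avg.induct)
    (auto intro: convex_combination_norm_le order_trans[OF unitary_conj_norm_le])

lemma avg_cinner_central:
  assumes c: "central c" shows "avg x v y w \<Longrightarrow> cinner w c = cinner v c"
proof (induction rule: avg.induct)
  case (conj y w u)
  have "cinner (bop_apply (Adv u) w) c = cinner (bop_apply (Adv u) w) (bop_apply (Adv u) c)"
    using central_Adv_fixed[OF c] conj by simp
  also have "\<dots> = cinner (bop_apply (adj (Adv u) * Adv u) w) c"
    by (simp add: bop_apply_simps cinner_adj_left)
  also have "\<dots> = cinner w c" using unitary_Adv conj by (simp add: unitary_op_def bop_apply_simps)
  finally show ?case using conj by simp
next
  case (mix y w y' w' s t)
  then have "cinner (s *\<^sub>R w + t *\<^sub>R w') c = complex_of_real (s + t) * cinner v c"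
    unfolding of_real_add distrib_right by (simp add: cinner_simps)
  then show ?case using mix by simp
qed simp

lemma central_\<iota>_one: "central (c *\<^sub>C \<iota> 1)"
  by (simp add: central_def bop_linear_simps lm_\<iota> rm_\<iota> one_mem)

text \<open>Conjugations are isometric and fix scalars, so an approximation to a scalar survives
  further averaging.\<close>

lemma avg_dist_scalar: "avg x v y w \<Longrightarrow> norm (w - c *\<^sub>C \<iota> 1) \<le> norm (v - c *\<^sub>C \<iota> 1)"
proof (induction rule: avg.induct)
  case (conj y w u)
  have "bop_apply (Adv u) w - c *\<^sub>C \<iota> 1 = bop_apply (Adv u) (w - c *\<^sub>C \<iota> 1)"
    using conj by (simp add: bop_linear_simps Adv_\<iota>_one)
  then show ?case using conj by (simp add: unitary_norm unitary_Adv)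
next
  case (mix y w y' w' s t)
  have "s *\<^sub>R w + t *\<^sub>R w' - (s + t) *\<^sub>R (c *\<^sub>C \<iota> 1) = s *\<^sub>R (w - c *\<^sub>C \<iota> 1) + t *\<^sub>R (w' - c *\<^sub>C \<iota> 1)"
    by (simp add: algebra_simps)
  then show ?case using mix by (simp add: convex_combination_norm_le)
qed simp

text \<open>A weak cluster point of the bounded sequence lies in \<open>M\<close>, and normality of
  the trace identifies its image with the L2 limit.\<close>

lemma bounded_L2_limit:
  assumes X: "\<And>n. X n \<in> M" "\<And>n. norm (X n) \<le> C" and lim: "(\<lambda>n. \<iota> (X n)) \<longlonglongrightarrow> w"
  obtains z where "z \<in> M" "w = \<iota> z"
proof -
  obtain z G where G: "G \<le> sequentially" "G \<noteq> bot" and z: "weakly_tendsto X z G"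
    by (rule bounded_weak_cluster_point[OF sequentially_bot X(2)])
  have zM: "z \<in> M" by (rule weak_limit_mem[OF G(2) z]) (simp add: X)
  have "cinner (w - \<iota> z) (\<iota> b) = 0" if b: "b \<in> M" for b
  proof -
    have "weakly_tendsto (\<lambda>n. adj b * X n) (adj b * z) G"
      using z unfolding weakly_tendsto_def by (simp add: bop_apply_simps cinner_adj_left)
    moreover have "norm (adj b * X n) \<le> norm b * C" for n
      using norm_mult_ineq[of "adj b" "X n"] mult_left_mono[OF X(2)[of n], of "norm b"] by simp
    ultimately have "((\<lambda>n. tr (adj b * X n)) \<longlongrightarrow> tr (adj b * z)) G"
      by (intro predual_weakly_continuous[OF tr_predual G(2)]) (use X(1) b zM in \<open>auto simp: M_intros\<close>)
    then have "((\<lambda>n. cinner (\<iota> (X n)) (\<iota> b)) \<longlongrightarrow> cinner (\<iota> z) (\<iota> b)) G"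
      using X(1) b zM by (simp add: cinner_\<iota>)
    moreover have "((\<lambda>n. cinner (\<iota> (X n)) (\<iota> b)) \<longlongrightarrow> cinner w (\<iota> b)) G"
      by (rule tendsto_mono[OF G(1)]) (rule bounded_linear.tendsto[OF bounded_linear_cinner_left lim])
    ultimately have "cinner (\<iota> z) (\<iota> b) = cinner w (\<iota> b)" using tendsto_unique[OF G(2)] by blast
    then show ?thesis by (simp add: cinner_simps)
  qed
  then have "w - \<iota> z = 0" by (rule cinner_\<iota>_eq_0)
  then show thesis using that zM by simp
qed

lemma central_\<iota>_scalar:
  assumes "z \<in> M" "central (\<iota> z)" obtains c where "\<iota> z = c *\<^sub>C \<iota> 1"
proof -
  have "x * z = z * x" if "x \<in> M" for x
    using assms that by (intro \<iota>_inject) (auto simp: central_def lm_\<iota> rm_\<iota> M_intros)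
  then have "z \<in> commutant M" by (simp add: commutant_def)
  then obtain c where "z = c *\<^sub>C 1" using centre_scalar assms(1) by blast
  then show thesis using that[of c] by (simp add: \<iota>_scaleC one_mem)
qed

lemma convex_avg: "convex {w. \<exists>y. avg x v y w}"
  by (rule convexI) (auto intro: avg.mix)

lemma avg_central:
  obtains w where "w \<in> closure {w. \<exists>y. avg x v y w}" "central w"
proof (rule convex_invariant_central[OF convex_avg])
  show "{w. \<exists>y. avg x v y w} \<noteq> {}" using avg.base by blast
  show "bop_apply (Adv u) w \<in> {w. \<exists>y. avg x v y w}"
    if "u \<in> M" "unitary_op u" "w \<in> {w. \<exists>y. avg x v y w}" for u w
    using that avg.conj by blast
qed (rule that)

lemma closure_avg_cinner:
  assumes "central c" "w \<in> closure {w. \<exists>y. avg x v y w}" shows "cinner w c = cinner v c"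
proof -
  have "closed {w. cinner w c = cinner v c}"
    by (intro closed_Collect_eq linear_continuous_on bounded_linear_cinner_left continuous_on_const)
  then have "closure {w. \<exists>y. avg x v y w} \<subseteq> {w. cinner w c = cinner v c}"
    by (intro closure_minimal) (auto simp: avg_cinner_central[OF assms(1)])
  then show ?thesis using assms(2) by blast
qed

text \<open>Averages of an element \<open>x\<close> of \<open>M\<close> stay bounded, so their L2
  limit is a central element of \<open>M\<close>, hence a scalar. Pairing with the central
  \<open>v\<close> is unchanged by averaging, so \<open>v\<close> and its scalar component have the
  same inner product with every \<open>\<iota> x\<close>.\<close>

lemma central_scalar:
  assumes v: "central v" shows "v = cinner v (\<iota> 1) *\<^sub>C \<iota> 1"
proof -
  have one: "central (\<iota> 1)" using central_\<iota>_one[of 1] by (simp add: scaleC_one)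
  have "cinner (v - cinner v (\<iota> 1) *\<^sub>C \<iota> 1) (\<iota> x) = 0" if x: "x \<in> M" for x
  proof -
    obtain w where w: "w \<in> closure {w. \<exists>y. avg x (\<iota> x) y w}" "central w" by (rule avg_central)
    obtain W where W: "\<And>n. W n \<in> {w. \<exists>y. avg x (\<iota> x) y w}" "W \<longlonglongrightarrow> w"
      using w(1) by (auto simp: closure_sequential)
    then obtain Y where Y: "\<And>n. avg x (\<iota> x) (Y n) (W n)" by simp metis
    have "\<iota> (Y n) = W n" for n using avg_\<iota>[OF Y x] by simp
    then have "(\<lambda>n. \<iota> (Y n)) \<longlonglongrightarrow> w" using W(2) by simp
    then obtain z where z: "z \<in> M" "w = \<iota> z"
      using bounded_L2_limit[of Y "norm x" w] avg_mem[OF Y x] avg_norm[OF Y] by blast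
    obtain c where c: "w = c *\<^sub>C \<iota> 1" using central_\<iota>_scalar[of z] z w(2) by metis
    have "cinner w (\<iota> 1) = cinner (\<iota> x) (\<iota> 1)" by (rule closure_avg_cinner[OF one w(1)])
    then have cx: "c = cinner (\<iota> x) (\<iota> 1)" by (simp add: c cinner_simps cinner_self norm_\<iota>_one)
    have "cinner (\<iota> x) v = cinner w v" by (rule closure_avg_cinner[OF v w(1), symmetric])
    also have "\<dots> = cinner (\<iota> x) (\<iota> 1) * cinner (\<iota> 1) v" by (simp add: c cinner_simps cx)
    finally have "cinner (\<iota> x) (v - cinner v (\<iota> 1) *\<^sub>C \<iota> 1) = 0"
      using cinner_commute[of "\<iota> 1" v] by (simp add: cinner_simps)
    then show ?thesis using cinner_eq_zero_commute by blast
  qed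
  then have "v - cinner v (\<iota> 1) *\<^sub>C \<iota> 1 = 0" by (rule cinner_\<iota>_eq_0)
  then show ?thesis by simp
qed

lemma avg_approx:
  assumes "0 < e" obtains y w where "avg x v y w" "norm (w - cinner v (\<iota> 1) *\<^sub>C \<iota> 1) < e"
proof -
  obtain w where w: "w \<in> closure {w. \<exists>y. avg x v y w}" "central w" by (rule avg_central)
  have "cinner w (\<iota> 1) = cinner v (\<iota> 1)"
    using closure_avg_cinner[OF _ w(1)] central_\<iota>_one[of 1] by (simp add: scaleC_one)
  then have "w = cinner v (\<iota> 1) *\<^sub>C \<iota> 1" using central_scalar[OF w(2)] by simp
  then show thesis using w(1) assms that unfolding closure_approachable by (auto simp: dist_norm)
qed

text \<open>Two rounds: the first brings the vector near its scalar, the second brings the operator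
  near its trace. By \<open>avg_dist_scalar\<close> the second round does not spoil the
  first.\<close>

lemma avg_approx_both:
  assumes e: "0 < e" and x: "x \<in> M"
  obtains y w where "avg x v y w" "norm (w - cinner v (\<iota> 1) *\<^sub>C \<iota> 1) < e"
    "norm (\<iota> y - tr x *\<^sub>C \<iota> 1) < e"
proof -
  obtain y w where yw: "avg x v y w" "norm (w - cinner v (\<iota> 1) *\<^sub>C \<iota> 1) < e"
    using avg_approx[OF e] by blast
  have y: "y \<in> M" using avg_mem[OF yw(1) x] .
  have "avg x (\<iota> x) y (\<iota> y)" using avg_change[OF yw(1), of "\<iota> x"] avg_\<iota>[OF _ x] by metis
  then have "cinner (\<iota> y) (\<iota> 1) = cinner (\<iota> x) (\<iota> 1)"
    using avg_cinner_central[of "\<iota> 1" x "\<iota> x" y "\<iota> y"] central_\<iota>_one[of 1] by (simp add: scaleC_one)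
  then have tr: "cinner (\<iota> y) (\<iota> 1) = tr x" by (simp add: cinner_\<iota>_one x)
  obtain y' w' where y': "avg y (\<iota> y) y' w'" "norm (w' - tr x *\<^sub>C \<iota> 1) < e"
    using avg_approx[OF e, of y "\<iota> y"] unfolding tr by blast
  have w': "w' = \<iota> y'" using avg_\<iota>[OF y'(1) y] .
  obtain w'' where w'': "avg y w y' w''" using avg_change[OF y'(1)] by blast
  show thesis
  proof (rule that)
    show "avg x v y' w''" using avg_trans[OF w'' yw(1)] .
    show "norm (w'' - cinner v (\<iota> 1) *\<^sub>C \<iota> 1) < e" using avg_dist_scalar[OF w''] yw(2) by (rule order.strict_trans1)
    show "norm (\<iota> y' - tr x *\<^sub>C \<iota> 1) < e" using y'(2) w' by simp
  qed
qed

section \<open>Invariant subspaces\<close>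

lemma bimodule_trivial:
  assumes K: "closed_csubspace K" and v0: "v0 \<in> K" "v0 \<noteq> 0"
    and lmK: "\<And>x v. x \<in> M \<Longrightarrow> v \<in> K \<Longrightarrow> bop_apply (lm x) v \<in> K"
    and rmK: "\<And>x v. x \<in> M \<Longrightarrow> v \<in> K \<Longrightarrow> bop_apply (rm x) v \<in> K"
  shows "v \<in> K"
proof -
  note K' = closed_csubspaceD[OF K] and O' = closed_csubspaceD[OF closed_csubspace_ortho[of K]]
  have lmO: "bop_apply (lm x) v \<in> ortho K" if "x \<in> M" "v \<in> ortho K" for x v
    using that lmK[OF adj_mem[OF that(1)]] unfolding ortho_def by (simp add: adj_lm flip: cinner_adj_right)
  have rmO: "bop_apply (rm x) v \<in> ortho K" if "x \<in> M" "v \<in> ortho K" for x v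
    using that rmK[OF adj_mem[OF that(1)]] unfolding ortho_def by (simp add: adj_rm flip: cinner_adj_right)
  obtain a b where ab: "a \<in> K" "b \<in> ortho K" "\<iota> 1 = a + b" by (rule orthogonal_decomposition[OF K])
  have "central a" unfolding central_def
  proof
    fix x assume x: "x \<in> M"
    have "bop_apply (lm x) (\<iota> 1) = bop_apply (rm x) (\<iota> 1)" using x by (simp add: lm_\<iota> rm_\<iota> one_mem)
    \<comment> \<open>The identity \<open>x 1 = 1 x\<close> is separated into its components in
      \<open>K\<close> and in the orthogonal complement.\<close>
    then have eq: "bop_apply (lm x) a - bop_apply (rm x) a = bop_apply (rm x) b - bop_apply (lm x) b"
      unfolding ab(3) by (simp add: bop_linear_simps algebra_simps)
    have "bop_apply (lm x) a - bop_apply (rm x) a \<in> K" using x ab(1) by (intro K'(6) lmK rmK)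
    moreover have "bop_apply (lm x) a - bop_apply (rm x) a \<in> ortho K"
      unfolding eq using x ab(2) by (intro O'(6) lmO rmO)
    ultimately show "bop_apply (lm x) a = bop_apply (rm x) a" using ortho_inter by fastforce
  qed
  then obtain c where c: "a = c *\<^sub>C \<iota> 1" using central_scalar by blast
  have dense: "w \<in> S" if "closed_csubspace S" "\<iota> 1 \<in> S"
    "\<And>x v. x \<in> M \<Longrightarrow> v \<in> S \<Longrightarrow> bop_apply (lm x) v \<in> S" for S w
  proof (rule closed_dense_UNIV)
    show "closed S" using that(1) by (simp add: closed_csubspace_def)
    show "\<iota> x \<in> S" if "x \<in> M" for x using lm_\<iota>[OF that one_mem] \<open>\<iota> 1 \<in> S\<close> that by (metis \<open>\<And>x v. x \<in> M \<Longrightarrow> v \<in> S \<Longrightarrow> bop_apply (lm x) v \<in> S\<close> mult_1_right)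
  qed
  \<comment> \<open>As \<open>a\<close> is a multiple of 1, either \<open>K\<close> or its
    complement contains 1, and the left multiples of 1 are dense.\<close>
  show ?thesis
  proof (cases "c = 0")
    case True
    then have "a = 0" by (simp add: c)
    then have "\<iota> 1 \<in> ortho K" using ab(2) by (simp add: ab(3))
    then have "v0 \<in> ortho K" using dense[OF closed_csubspace_ortho] lmO by blast
    then show ?thesis using v0 ortho_inter by blast
  next
    case False
    have "\<iota> 1 = inverse c *\<^sub>C a" using False by (simp add: c scaleC_scaleC scaleC_one)
    then have "\<iota> 1 \<in> K" using K'(4)[OF ab(1)] by simp
    then show ?thesis using dense[OF K] lmK by blast
  qed
qed

text \<open>The vectors \<open>w\<close> with \<open>w z q = 0\<close> for all \<open>z\<close> form
  a closed sub-bimodule; a nonzero one would contain 1 and give \<open>q = 0\<close>.\<close>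

lemma rm_annihilator:
  assumes q: "q \<in> M" "q \<noteq> 0" and w: "\<And>z. z \<in> M \<Longrightarrow> bop_apply (rm q) (bop_apply (rm z) w) = 0"
  shows "w = 0"
proof (rule ccontr)
  assume w0: "w \<noteq> 0"
  define K where "K = (\<Inter>z\<in>M. {v. bop_apply (rm q * rm z) v = 0})"
  have K: "v \<in> K \<longleftrightarrow> (\<forall>z\<in>M. bop_apply (rm q) (bop_apply (rm z) v) = 0)" for v
    by (simp add: K_def bop_apply_simps)
  have "closed K" unfolding K_def by (intro closed_INT ballI closed_bop_kernel)
  then have "closed_csubspace K" by (simp add: closed_csubspace_def K bop_linear_simps)
  moreover have "w \<in> K" using w by (simp add: K)
  moreover have "bop_apply (lm x) v \<in> K" if "x \<in> M" "v \<in> K" for x v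
    using that q by (simp add: K flip: lm_rm_commute_vec)
  moreover have "bop_apply (rm x) v \<in> K" if "x \<in> M" "v \<in> K" for x v
    unfolding K
  proof
    fix z assume "z \<in> M"
    then show "bop_apply (rm q) (bop_apply (rm z) (bop_apply (rm x) v)) = 0"
      using that(2)[unfolded K, rule_format, of "x * z"] that(1) by (simp add: rm_simps mult_mem bop_apply_simps)
  qed
  ultimately have "\<iota> 1 \<in> K" using w0 bimodule_trivial[of K w "\<iota> 1"] by blast
  then have "\<iota> q = 0" using one_mem q by (auto simp: K rm_\<iota> bop_apply_simps dest: bspec[OF _ one_mem])
  then show False using \<iota>_eq_0D q by blast
qed

lemma lm_annihilator:
  assumes p: "p \<in> M" "p \<noteq> 0" and w: "\<And>z. z \<in> M \<Longrightarrow> bop_apply (lm p) (bop_apply (lm z) w) = 0"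
  shows "w = 0"
proof (rule ccontr)
  assume w0: "w \<noteq> 0"
  define K where "K = (\<Inter>z\<in>M. {v. bop_apply (lm p * lm z) v = 0})"
  have K: "v \<in> K \<longleftrightarrow> (\<forall>z\<in>M. bop_apply (lm p) (bop_apply (lm z) v) = 0)" for v
    by (simp add: K_def bop_apply_simps)
  have "closed K" unfolding K_def by (intro closed_INT ballI closed_bop_kernel)
  then have "closed_csubspace K" by (simp add: closed_csubspace_def K bop_linear_simps)
  moreover have "w \<in> K" using w by (simp add: K)
  moreover have "bop_apply (rm x) v \<in> K" if "x \<in> M" "v \<in> K" for x v
    using that p by (simp add: K lm_rm_commute_vec)
  moreover have "bop_apply (lm x) v \<in> K" if "x \<in> M" "v \<in> K" for x v
    unfolding K
  proof
    fix z assume "z \<in> M"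
    then show "bop_apply (lm p) (bop_apply (lm z) (bop_apply (lm x) v)) = 0"
      using that(2)[unfolded K, rule_format, of "z * x"] that(1) by (simp add: lm_simps mult_mem bop_apply_simps)
  qed
  ultimately have "\<iota> 1 \<in> K" using w0 bimodule_trivial[of K w "\<iota> 1"] by blast
  then have "\<iota> p = 0" using one_mem p by (auto simp: K lm_\<iota> bop_apply_simps dest: bspec[OF _ one_mem])
  then show False using \<iota>_eq_0D p by blast
qed

section \<open>Commutators and conjugation by unitaries near 1\<close>

definition commutator :: "'h bop \<Rightarrow> 'k \<Rightarrow> 'k" where
  "commutator x v = bop_apply (lm x) v - bop_apply (rm x) v"

text \<open>For a self-adjoint contraction \<open>x\<close> and small \<open>t > 0\<close>, the unitary
  \<open>u = (1 - t\<^sup>2 x\<^sup>2)\<^sup>1\<^sup>/\<^sup>2 + \<i> t x\<close> satisfies \<open>u s u\<^sup>* = s + \<i> t (x s - s x) + O(t\<^sup>2)\<close>.\<close>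

lemma Adv_invariant_commutator:
  assumes S: "closed_csubspace S"
    and inv: "\<And>u v. u \<in> M \<Longrightarrow> unitary_op u \<Longrightarrow> v \<in> S \<Longrightarrow> bop_apply (Adv u) v \<in> S"
    and s: "s \<in> S" and x: "x \<in> M"
  shows "commutator x s \<in> S"
  using x
proof (rule selfadjoint_span_induct)
  note S' = closed_csubspaceD[OF S]
  show "commutator (x + y) s \<in> S" if "x \<in> M" "y \<in> M" "commutator x s \<in> S" "commutator y s \<in> S" for x y
  proof -
    have "commutator (x + y) s = commutator x s + commutator y s"
      using that(1,2) by (simp add: commutator_def lm_simps rm_simps bop_apply_simps)
    then show ?thesis using S'(3)[OF that(3,4)] by simp
  qed
  show "commutator (c *\<^sub>C x) s \<in> S" if "x \<in> M" "commutator x s \<in> S" for c x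
  proof -
    have "commutator (c *\<^sub>C x) s = c *\<^sub>C commutator x s"
      using that(1) by (simp add: commutator_def lm_simps rm_simps bop_apply_simps scaleC_diff_right)
    then show ?thesis using S'(4)[OF that(2)] by simp
  qed
  fix x assume x: "x \<in> M" "adj x = x" "norm x \<le> 1"
  have "\<exists>s'\<in>S. dist s' (commutator x s) < e" if e: "0 < e" for e
  proof -
    \<comment> \<open>The 6 counts the second-order terms: 4 from \<open>A * B\<close> and 1 each
      from \<open>lm y\<close> and \<open>rm y\<close>. The added 1 keeps the denominator
      positive.\<close>
    define t where "t = min 1 (e / (6 * norm s + 1))"
    have t: "0 < t" "t \<le> 1" "t * (6 * norm s + 1) \<le> e"
      using e by (auto simp: t_def min_def field_simps add_pos_nonneg add_nonneg_pos)
    define h where "h = t *\<^sub>R x"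
    have h: "h \<in> M" "adj h = h" "norm h \<le> t" using x t by (auto simp: h_def M_intros mult_left_le)
    then have "norm h \<le> 1" using t by linarith
    then obtain y where y: "y \<in> M" "adj y = y" "norm y \<le> (norm h)\<^sup>2" and u: "unitary_op (1 - y + \<i> *\<^sub>C h)"
      using unitary_near_one h by metis
    have ny: "norm y \<le> t * t"
      using y(3) h(3) mult_mono[OF h(3) h(3)] t by (simp add: power2_eq_square)
    have tt: "t * t \<le> t" using t by (simp add: mult_left_le)
    define A where "A = \<i> *\<^sub>C lm h - lm y"
    define B where "B = - (\<i> *\<^sub>C rm h) - rm y"
    have nA: "norm A \<le> 2 * t"
    proof -
      have "norm A \<le> norm (\<i> *\<^sub>C lm h) + norm (lm y)" unfolding A_def by (rule norm_triangle_ineq4)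
      also have "\<dots> \<le> norm h + norm y"
        using norm_bop_scaleC[of \<i> "lm h"] norm_lm[OF h(1)] norm_lm[OF y(1)] by simp
      finally show ?thesis using h(3) ny tt by linarith
    qed
    have nB: "norm B \<le> 2 * t"
    proof -
      have "norm B \<le> norm (- (\<i> *\<^sub>C rm h)) + norm (rm y)" unfolding B_def by (rule norm_triangle_ineq4)
      also have "\<dots> \<le> norm h + norm y"
        using norm_bop_scaleC[of \<i> "rm h"] norm_rm[OF h(1)] norm_rm[OF y(1)] by simp
      finally show ?thesis using h(3) ny tt by linarith
    qed
    define u where "u = 1 - y + \<i> *\<^sub>C h"
    have uM: "u \<in> M" using y h by (simp add: u_def M_intros)
    have uu: "unitary_op u" using u by (simp add: u_def)
    have lu: "lm u = 1 + A" using y h by (simp add: u_def A_def lm_simps M_intros)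
    have ru: "rm (adj u) = 1 + B"
      using y h by (simp add: u_def B_def rm_simps M_intros scaleC_minus_left)
    have AdvAB: "Adv u = 1 + (A + B + A * B)" unfolding Adv_def lu ru by (simp add: algebra_simps)
    define E where "E = A * B - lm y - rm y"
    have "A + B + A * B = \<i> *\<^sub>C (lm h - rm h) + E"
      by (simp add: A_def B_def E_def scaleC_diff_right algebra_simps)
    then have "bop_apply (Adv u) s - s = \<i> *\<^sub>C commutator h s + bop_apply E s"
      unfolding AdvAB by (simp add: bop_apply_simps commutator_def)
    also have "commutator h s = of_real t *\<^sub>C commutator x s"
      using x by (simp add: h_def commutator_def scaleR_scaleC lm_simps rm_simps bop_apply_simps scaleC_diff_right)
    finally have eq: "bop_apply (Adv u) s - s = (\<i> * of_real t) *\<^sub>C commutator x s + bop_apply E s"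
      by (simp add: scaleC_scaleC)
    define k where "k = - \<i> / of_real t"
    have k: "k * (\<i> * of_real t) = 1" "cmod k = 1 / t" using t by (simp_all add: k_def norm_divide)
    define s' where "s' = k *\<^sub>C (bop_apply (Adv u) s - s)"
    have "s' \<in> S" unfolding s'_def using inv[OF uM uu s] s by (intro S'(4) S'(6))
    moreover have "dist s' (commutator x s) < e"
    proof -
      have "s' - commutator x s = k *\<^sub>C bop_apply E s"
        unfolding s'_def eq by (simp add: scaleC_add_right scaleC_scaleC k scaleC_one)
      then have "dist s' (commutator x s) = (1 / t) * norm (bop_apply E s)"
        by (simp add: dist_norm norm_scaleC k)
      also have "norm (bop_apply E s) \<le> norm E * norm s" by (rule norm_bop_apply)
      also have "norm E \<le> 6 * (t * t)"
      proof -
        have "norm E \<le> norm (A * B) + norm (lm y) + norm (rm y)"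
          unfolding E_def by (intro order_trans[OF norm_triangle_ineq4] add_right_mono norm_triangle_ineq4)
        also have "norm (A * B) \<le> norm A * norm B" by (rule norm_mult_ineq)
        also have "norm A * norm B \<le> (2 * t) * (2 * t)" using nA nB t by (intro mult_mono) auto
        also have "norm (lm y) \<le> t * t" using norm_lm[OF y(1)] ny by linarith
        also have "norm (rm y) \<le> t * t" using norm_rm[OF y(1)] ny by linarith
        finally show ?thesis by simp
      qed
      also have "(1 / t) * (6 * (t * t) * norm s) = t * (6 * norm s)" using t by simp
      also have "\<dots> < t * (6 * norm s + 1)" using t by simp
      also have "\<dots> \<le> e" by (rule t)
      finally show ?thesis using t by (simp add: divide_right_mono mult_right_mono)
    qed
    ultimately show ?thesis by blast
  qed
  then show "commutator x s \<in> S" using S'(1) closed_approachable[of S "commutator x s"] by blast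
qed

end

lemma scaleC_eq_0D: "c *\<^sub>C x = 0 \<Longrightarrow> c \<noteq> 0 \<Longrightarrow> x = (0 :: 'a::complex_vector)"
  by (metis scaleC_scaleC scaleC_one scaleC_zero_right left_inverse)

section \<open>Corners of the factor\<close>

context tracial_factor
begin

lemma lm_lm: "x \<in> M \<Longrightarrow> y \<in> M \<Longrightarrow> bop_apply (lm x) (bop_apply (lm y) v) = bop_apply (lm (x * y)) v"
  and rm_rm: "x \<in> M \<Longrightarrow> y \<in> M \<Longrightarrow> bop_apply (rm x) (bop_apply (rm y) v) = bop_apply (rm (y * x)) v"
  by (simp_all add: lm_simps rm_simps bop_apply_simps)

lemmas bimodule_simps = lm_lm rm_rm lm_rm_commute_vec

lemma commutator_\<iota>_one: "x \<in> M \<Longrightarrow> commutator x (\<iota> 1) = 0"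
  by (simp add: commutator_def lm_\<iota> rm_\<iota> one_mem)

lemma commutator_diff: "commutator x (v - w) = commutator x v - commutator x w"
  and commutator_scaleC: "commutator x (c *\<^sub>C v) = c *\<^sub>C commutator x v"
  by (simp_all add: commutator_def bop_linear_simps scaleC_diff_right)

lemma cinner_commutator: "x \<in> M \<Longrightarrow> cinner (commutator x v) w = cinner v (commutator (adj x) w)"
  by (simp add: commutator_def cinner_simps adj_lm[symmetric] adj_rm[symmetric] cinner_adj_right)

text \<open>If \<open>p M p\<close> consisted of multiples of \<open>p\<close>, a multiple of
  \<open>p\<close> would be a nonzero abelian projection. As \<open>p\<close> is only self-adjoint,
  it is first rescaled by the constant in \<open>p\<^sup>2 = c p\<close>, which is real and
  nonzero.\<close>

lemma not_minimal:
  assumes p: "p \<in> M" "adj p = p" "p \<noteq> 0"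
  shows "\<exists>y\<in>M. \<forall>c. p * y * p \<noteq> c *\<^sub>C p"
proof (rule ccontr)
  assume "\<not> ?thesis"
  then have min: "\<exists>c. p * y * p = c *\<^sub>C p" if "y \<in> M" for y using that by blast
  obtain c where c: "p * p = c *\<^sub>C p" using min[OF one_mem] by auto
  have c0: "c \<noteq> 0" using c adj_self_mult_eq_0[of p] p by auto
  have "adj (p * p) = adj (c *\<^sub>C p)" by (rule arg_cong[OF c])
  then have "p * p = cnj c *\<^sub>C p" by (simp add: p(2))
  then have "c *\<^sub>C p = cnj c *\<^sub>C p" unfolding c .
  then have "(c - cnj c) *\<^sub>C p = 0" by (simp add: scaleC_diff_left)
  then have cr: "cnj c = c" using scaleC_eq_0D p(3) by fastforce
  define e where "e = inverse c *\<^sub>C p"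
  have "e \<in> M" using p by (simp add: e_def scaleC_mem)
  moreover have "projection_op e"
    using c0 cr p(2) unfolding projection_op_def e_def by (simp add: bop_mult_scaleC c scaleC_scaleC)
  moreover have "(e * x * e) * (e * y * e) = (e * y * e) * (e * x * e)" if xy: "x \<in> M" "y \<in> M" for x y
  proof -
    obtain a b where "p * x * p = a *\<^sub>C p" "p * y * p = b *\<^sub>C p" using min xy by metis
    then show ?thesis by (simp add: e_def bop_mult_scaleC scaleC_scaleC mult_ac)
  qed
  ultimately have "abelian_projection M e" by (simp add: abelian_projection_def)
  then have "e = 0" using II1 by (auto simp: II1_factor_def)
  then show False using scaleC_eq_0D[of "inverse c" p] c0 p(3) by (simp add: e_def)
qed

lemma one_neq_zero: "(1 :: 'h bop) \<noteq> 0"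
  using tr_one tr_zero by auto

lemma exists_nonscalar_selfadjoint:
  obtains h where "h \<in> M" "adj h = h" "\<And>c. h \<noteq> c *\<^sub>C 1"
proof -
  obtain y where y: "y \<in> M" "\<And>c. y \<noteq> c *\<^sub>C 1"
    using not_minimal[OF one_mem _ one_neq_zero] by auto
  have "\<exists>c. y = c *\<^sub>C 1" if all: "\<And>h. h \<in> M \<Longrightarrow> adj h = h \<Longrightarrow> \<exists>c. h = c *\<^sub>C 1"
    using y(1)
  proof (rule selfadjoint_span_induct)
    show "\<exists>c. x = c *\<^sub>C 1" if "x \<in> M" "adj x = x" for x using all that by blast
    show "\<exists>c. a + b = c *\<^sub>C 1" if "\<exists>c. a = c *\<^sub>C 1" "\<exists>c. b = c *\<^sub>C 1" for a b :: "'h bop"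
      using that by (metis scaleC_add_left)
    show "\<exists>d. c *\<^sub>C x = d *\<^sub>C 1" if "\<exists>c. x = c *\<^sub>C 1" for c and x :: "'h bop"
      using that by (metis scaleC_scaleC)
  qed
  then show thesis using y(2) that by blast
qed

text \<open>A non-scalar self-adjoint \<open>k\<close> of trace 0 has positive and negative part \<open>(\<bar>k\<bar> \<plusminus> k) / 2\<close> both nonzero,
  since \<open>\<bar>k\<bar>\<close> has nonzero trace.\<close>

lemma exists_orthogonal_selfadjoint:
  obtains a b where "a \<in> M" "b \<in> M" "adj a = a" "adj b = b" "a \<noteq> 0" "b \<noteq> 0" "a * b = 0" "b * a = 0"
proof -
  obtain h where h: "h \<in> M" "adj h = h" "\<And>c. h \<noteq> c *\<^sub>C 1" by (rule exists_nonscalar_selfadjoint) blast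
  \<comment> \<open>The trace of a self-adjoint element is real, so subtracting it keeps
    \<open>g\<close> self-adjoint.\<close>
  have "tr h = cnj (tr h)"
    using cinner_commute[of "\<iota> h" "\<iota> 1"] h by (simp add: cinner_\<iota> one_mem)
  then have hr: "cnj (tr h) = tr h" by simp
  define g where "g = h - tr h *\<^sub>C 1"
  have g: "g \<in> M" "adj g = g" "g \<noteq> 0" "tr g = 0"
    using h hr by (auto simp: g_def M_intros tr_diff tr_scaleC tr_one)
  define r where "r = norm g + 1"
  have r: "r > 0" by (simp add: r_def add_nonneg_pos)
  define k where "k = (1 / r) *\<^sub>R g"
  have k: "k \<in> M" "adj k = k" "k \<noteq> 0" "norm k \<le> 1"
    using g r by (auto simp: k_def M_intros r_def divide_le_eq)
  have trk: "tr k = 0" using g by (simp add: k_def scaleR_scaleC tr_scaleC)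
  \<comment> \<open>With this \<open>j\<close> the root \<open>1 - y\<close> of \<open>1 - j\<close>
    is the absolute value of \<open>k\<close>.\<close>
  define j where "j = 1 - k * k"
  have j: "j \<in> M" "adj j = j" using k by (simp_all add: j_def M_intros)
  have "norm j \<le> 1"
  proof (rule norm_bop_le)
    fix v
    let ?w = "bop_apply k v"
    have "norm (bop_apply k ?w) \<le> 1 * norm ?w"
      using norm_bop_apply k(4) by (meson mult_right_mono norm_ge_zero order_trans)
    then have "(norm (bop_apply k ?w))\<^sup>2 \<le> (norm ?w)\<^sup>2" by (intro power_mono) auto
    moreover have "Re (cinner v (bop_apply k ?w)) = (norm ?w)\<^sup>2"
      using cinner_adj_right[of v k ?w] k(2) by (simp add: power2_norm_eq_cinner)
    ultimately have "(norm (v - bop_apply k ?w))\<^sup>2 \<le> (norm v)\<^sup>2"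
      using zero_le_power2[of "norm ?w"] norm_diff_square[of v "bop_apply k ?w"] by linarith
    then have "norm (v - bop_apply k ?w) \<le> norm v" by (rule power2_le_imp_le) simp
    then show "norm (bop_apply j v) \<le> 1 * norm v" by (simp add: j_def bop_apply_simps)
  qed simp
  then obtain y where y: "y \<in> M" "adj y = y" "(1 - y) * (1 - y) = 1 - j" "norm y \<le> norm j"
      and comm: "\<forall>z. z * j = j * z \<longrightarrow> z * y = y * z"
    by (rule sqrt_one_minus_mem[OF j])
  have "norm y \<le> 1" using y(4) \<open>norm j \<le> 1\<close> by linarith
  \<comment> \<open>A second root writes the absolute value as a square, so its trace is a squared
    L2 norm and vanishes only if the absolute value does.\<close>
  then obtain y' where y': "y' \<in> M" "adj y' = y'" "(1 - y') * (1 - y') = 1 - y"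
    using sqrt_one_minus_mem[OF y(1,2)] by blast
  have "k * j = j * k" by (simp add: j_def algebra_simps)
  then have ky: "k * y = y * k" using comm by blast
  define m where "m = 1 - y"
  have m: "m \<in> M" "adj m = m" "m * m = k * k" using y by (simp_all add: m_def M_intros j_def)
  have km: "k * m = m * k" by (simp add: m_def algebra_simps ky)
  have trm: "tr m \<noteq> 0"
  proof
    assume "tr m = 0"
    then have "complex_of_real ((norm (\<iota> (1 - y')))\<^sup>2) = 0"
      using norm_\<iota>_square[of "1 - y'"] y' by (simp add: M_intros m_def)
    then have "1 - y' = 0" by (intro \<iota>_eq_0D) (use y' in \<open>auto simp: M_intros\<close>)
    then have "m = 0" using y'(3) by (simp add: m_def)
    then have "adj k * k = 0" using m(3) k(2) by simp
    then show False using adj_self_mult_eq_0 k(3) by blast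
  qed
  show thesis
  proof (rule that[of "m + k" "m - k"])
    show "m + k \<noteq> 0" "m - k \<noteq> 0"
      using trm trk tr_add[OF m(1) k(1)] tr_diff[OF m(1) k(1)] tr_zero by auto
    show "(m + k) * (m - k) = 0" "(m - k) * (m + k) = 0"
      by (simp_all add: algebra_simps m km)
  qed (use m k in \<open>simp_all add: M_intros\<close>)
qed

text \<open>The hypothesis reads \<open>p y p s = t y p\<close> and yields
  \<open>a p\<^sup>2 b t = a (p t) b p\<close> for all \<open>a\<close> and \<open>b\<close>. Since
  \<open>a\<close> and \<open>b\<close> absorb unitaries, \<open>p\<^sup>2\<close> and
  \<open>p t\<close> can be averaged simultaneously; in the limit they become scalars, and a nonzero
  multiple of \<open>t\<close> equals a multiple of \<open>p\<close>.\<close>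

lemma corner_scalar:
  assumes p: "p \<in> M" "adj p = p" "p \<noteq> 0" and t: "t = bop_apply (lm p) s"
    and comm: "\<And>y. y \<in> M \<Longrightarrow> bop_apply (lm (p * y * p)) s = bop_apply (rm (y * p)) t"
  shows "\<exists>c. t = c *\<^sub>C \<iota> p"
proof -
  define v0 where "v0 = bop_apply (lm p) t"
  \<comment> \<open>The factors \<open>a\<close> and \<open>b\<close> are kept general for the
    conjugation case, where they turn into \<open>a u\<close> and
    \<open>u\<^sup>* b\<close>.\<close>
  have inv: "y \<in> M \<and> (\<forall>a\<in>M. \<forall>b\<in>M. bop_apply (lm (a * y * b)) t = bop_apply (rm p) (bop_apply (lm a) (bop_apply (rm b) w)))"
    if "avg (p * p) v0 y w" for y w
    using that
  proof (induction rule: avg.induct)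
    case base
    have "bop_apply (lm (a * (p * p) * b)) t = bop_apply (rm p) (bop_apply (lm a) (bop_apply (rm b) v0))"
      if ab: "a \<in> M" "b \<in> M" for a b
    proof -
      have "bop_apply (lm (a * (p * p) * b)) t = bop_apply (lm (a * p)) (bop_apply (lm (p * b * p)) s)"
        using ab p by (simp add: t bimodule_simps M_intros mult.assoc)
      also have "\<dots> = bop_apply (lm (a * p)) (bop_apply (rm (b * p)) t)" using comm[OF ab(2)] by simp
      also have "\<dots> = bop_apply (rm p) (bop_apply (lm a) (bop_apply (rm b) v0))"
        using ab p by (simp add: v0_def bimodule_simps M_intros)
      finally show ?thesis .
    qed
    then show ?case using p by (simp add: M_intros)
  next
    case (conj y w u)
    have "bop_apply (lm (a * (u * y * adj u) * b)) t
        = bop_apply (rm p) (bop_apply (lm a) (bop_apply (rm b) (bop_apply (Adv u) w)))"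
      if ab: "a \<in> M" "b \<in> M" for a b
    proof -
      have "bop_apply (lm ((a * u) * y * (adj u * b))) t
          = bop_apply (rm p) (bop_apply (lm (a * u)) (bop_apply (rm (adj u * b)) w))"
        using conj ab by (simp add: M_intros)
      then show ?thesis using conj ab p
        by (simp add: Adv_def bop_apply_simps bimodule_simps M_intros mult.assoc)
    qed
    then show ?case using conj by (simp add: M_intros)
  next
    case (mix y w y' w' c d)
    then show ?case
      by (simp add: M_intros scaleR_scaleC distrib_left distrib_right bop_mult_scaleC lm_simps(1,3)
          bop_apply_simps bop_linear_simps)
  qed
  let ?c = "cinner v0 (\<iota> 1)" and ?\<tau> = "tr (p * p)"
  have "\<exists>y w. avg (p * p) v0 y w \<and> norm (w - ?c *\<^sub>C \<iota> 1) < inverse (real (Suc n))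
      \<and> norm (\<iota> y - ?\<tau> *\<^sub>C \<iota> 1) < inverse (real (Suc n))" for n
    by (rule avg_approx_both[of "inverse (real (Suc n))" "p * p" v0]) (use p in \<open>auto simp: M_intros\<close>)
  then obtain Y W where YW: "\<And>n. avg (p * p) v0 (Y n) (W n)"
    "\<And>n. norm (W n - ?c *\<^sub>C \<iota> 1) < inverse (real (Suc n))"
    "\<And>n. norm (\<iota> (Y n) - ?\<tau> *\<^sub>C \<iota> 1) < inverse (real (Suc n))" by metis
  have null: "f \<longlonglongrightarrow> l" if "\<And>n. norm (f n - l) < inverse (real (Suc n))" for f :: "nat \<Rightarrow> 'k" and l
  proof -
    have "(\<lambda>n. f n - l) \<longlonglongrightarrow> 0"
    proof (rule Lim_null_comparison)
      show "\<forall>\<^sub>F n in sequentially. norm (f n - l) \<le> inverse (real (Suc n))"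
        using that by (intro always_eventually allI less_imp_le)
    qed (rule LIMSEQ_inverse_real_of_nat)
    then show ?thesis by (simp add: LIM_zero_iff)
  qed
  have Wlim: "W \<longlonglongrightarrow> ?c *\<^sub>C \<iota> 1" by (rule null) (rule YW)
  have Ylim: "(\<lambda>n. \<iota> (Y n)) \<longlonglongrightarrow> ?\<tau> *\<^sub>C \<iota> 1" by (rule null) (rule YW)
  have YM: "Y n \<in> M" for n using avg_mem[OF YW(1)] p by (simp add: M_intros)
  have eq: "bop_apply (lm (Y n)) t = bop_apply (rm p) (W n)" for n
    using inv[OF YW(1), THEN conjunct2, rule_format, OF one_mem one_mem, of n] by (simp add: bop_apply_simps)
  \<comment> \<open>The averages \<open>Y n\<close> converge only in the L2 norm. Being bounded in
    operator norm, they converge strongly on the dense image of \<open>M\<close> and hence at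
    \<open>t\<close>, which may lie outside it.\<close>
  define X where "X n = lm (Y n) - ?\<tau> *\<^sub>C 1" for n
  have bd: "norm (X n) \<le> norm (p * p) + cmod ?\<tau>" for n
  proof -
    have "norm (X n) \<le> norm (lm (Y n)) + norm (?\<tau> *\<^sub>C (1 :: 'k bop))" unfolding X_def by (rule norm_triangle_ineq4)
    also have "norm (lm (Y n)) \<le> norm (p * p)" using norm_lm[OF YM] avg_norm[OF YW(1)] order_trans by blast
    also have "norm (?\<tau> *\<^sub>C (1 :: 'k bop)) \<le> cmod ?\<tau>"
      using norm_bop_scaleC[of ?\<tau> "1 :: 'k bop"] mult_left_mono[OF norm_bop_one_le[where 'a = 'k], of "cmod ?\<tau>"] by simp
    finally show ?thesis by simp
  qed
  have "t \<in> {v. (\<lambda>n. bop_apply (X n) v) \<longlonglongrightarrow> 0}"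
  proof (rule closed_dense_UNIV[OF closed_strongly_null[OF bd]])
    fix b assume b: "b \<in> M"
    have "bop_apply (X n) (\<iota> b) = bop_apply (rm b) (\<iota> (Y n) - ?\<tau> *\<^sub>C \<iota> 1)" for n
      using b YM by (simp add: X_def bop_apply_simps lm_\<iota> rm_\<iota> bop_linear_simps one_mem)
    moreover have "(\<lambda>n. bop_apply (rm b) (\<iota> (Y n) - ?\<tau> *\<^sub>C \<iota> 1)) \<longlonglongrightarrow> bop_apply (rm b) (?\<tau> *\<^sub>C \<iota> 1 - ?\<tau> *\<^sub>C \<iota> 1)"
      by (intro bounded_linear.tendsto[OF bop_bounded_linear] tendsto_diff Ylim tendsto_const)
    ultimately show "\<iota> b \<in> {v. (\<lambda>n. bop_apply (X n) v) \<longlonglongrightarrow> 0}" by simp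
  qed
  then have "(\<lambda>n. bop_apply (X n) t) \<longlonglongrightarrow> 0" by simp
  then have "(\<lambda>n. bop_apply (rm p) (W n) - ?\<tau> *\<^sub>C t) \<longlonglongrightarrow> 0" by (simp add: X_def bop_apply_simps eq)
  then have "(\<lambda>n. bop_apply (rm p) (W n)) \<longlonglongrightarrow> ?\<tau> *\<^sub>C t" by (simp add: LIM_zero_iff)
  moreover have "(\<lambda>n. bop_apply (rm p) (W n)) \<longlonglongrightarrow> bop_apply (rm p) (?c *\<^sub>C \<iota> 1)"
    by (rule bounded_linear.tendsto[OF bop_bounded_linear Wlim])
  ultimately have "?\<tau> *\<^sub>C t = bop_apply (rm p) (?c *\<^sub>C \<iota> 1)" by (rule LIMSEQ_unique)
  then have \<tau>t: "?\<tau> *\<^sub>C t = ?c *\<^sub>C \<iota> p" using p by (simp add: bop_linear_simps rm_\<iota> one_mem)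
  have "?\<tau> \<noteq> 0"
  proof
    assume "?\<tau> = 0"
    then have "complex_of_real ((norm (\<iota> p))\<^sup>2) = 0" using norm_\<iota>_square[OF p(1)] p(2) by simp
    then show False using \<iota>_eq_0D p by simp
  qed
  then have "t = (inverse ?\<tau> * ?c) *\<^sub>C \<iota> p"
    by (simp add: \<tau>t[symmetric] scaleC_scaleC[symmetric]) (simp add: scaleC_scaleC scaleC_one)
  then show ?thesis by blast
qed

text \<open>Applying the hypothesis to \<open>x s - s x\<close> gives \<open>p x s q = p s x q\<close>, hence
  \<open>(p y p s - p s y p) z q = 0\<close> for all \<open>z\<close>, so \<open>p y p s = p s y p\<close>. Averaging this over unitaries
  yields \<open>p s \<in> \<complex> p\<close>; for a non-scalar \<open>s\<close> this would force \<open>p M p = \<complex> p\<close>.\<close>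

lemma corner_null_scalar:
  assumes p: "p \<in> M" "adj p = p" "p \<noteq> 0" and q: "q \<in> M" "q \<noteq> 0"
    and inv: "\<And>x s. x \<in> M \<Longrightarrow> s \<in> S \<Longrightarrow> commutator x s \<in> S"
    and null: "\<And>s. s \<in> S \<Longrightarrow> bop_apply (rm q) (bop_apply (lm p) s) = 0"
    and s: "s \<in> S"
  shows "\<exists>c. s = c *\<^sub>C \<iota> 1"
proof -
  have swap: "bop_apply (rm q) (bop_apply (lm (p * x)) s) = bop_apply (rm (x * q)) (bop_apply (lm p) s)"
    if "s \<in> S" "x \<in> M" for s x
    using null[OF inv[OF that(2,1)]] p q that(2)
    by (simp add: commutator_def bop_linear_simps bimodule_simps M_intros)
  have comm: "bop_apply (lm (p * y * p)) s = bop_apply (rm (y * p)) (bop_apply (lm p) s)"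
    if s: "s \<in> S" and y: "y \<in> M" for s y
  proof -
    have "bop_apply (lm (p * y * p)) s - bop_apply (rm (y * p)) (bop_apply (lm p) s) = 0"
    proof (rule rm_annihilator[OF q])
      fix z assume z: "z \<in> M"
      \<comment> \<open>\<open>swap\<close> is used twice: it carries \<open>z\<close> to the left
        of \<open>s\<close>, and then \<open>y p z\<close> back to its right.\<close>
      have "bop_apply (rm q) (bop_apply (rm z) (bop_apply (lm (p * y * p)) s))
          = bop_apply (lm (p * y)) (bop_apply (rm (z * q)) (bop_apply (lm p) s))"
        using p q y z by (simp add: bimodule_simps M_intros)
      also have "\<dots> = bop_apply (lm (p * y)) (bop_apply (rm q) (bop_apply (lm (p * z)) s))"
        using swap[OF s z] by simp
      also have "\<dots> = bop_apply (rm q) (bop_apply (lm (p * (y * p * z))) s)"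
        using p q y z by (simp add: bimodule_simps M_intros mult.assoc)
      also have "\<dots> = bop_apply (rm (y * p * z * q)) (bop_apply (lm p) s)"
        using swap[OF s, of "y * p * z"] p y z by (simp add: M_intros)
      also have "\<dots> = bop_apply (rm q) (bop_apply (rm z) (bop_apply (rm (y * p)) (bop_apply (lm p) s)))"
        using p q y z by (simp add: bimodule_simps M_intros mult.assoc)
      finally show "bop_apply (rm q) (bop_apply (rm z) (bop_apply (lm (p * y * p)) s
          - bop_apply (rm (y * p)) (bop_apply (lm p) s))) = 0"
        by (simp add: bop_linear_simps)
    qed
    then show ?thesis by simp
  qed
  have scalar: "\<exists>c. bop_apply (lm p) s = c *\<^sub>C \<iota> p" if "s \<in> S" for s
    using corner_scalar[OF p refl] comm[OF that] by blast
  obtain c where c: "bop_apply (lm p) s = c *\<^sub>C \<iota> p" using scalar[OF s] by blast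
  define s' where "s' = s - c *\<^sub>C \<iota> 1"
  have ps': "bop_apply (lm p) s' = 0" using p by (simp add: s'_def bop_linear_simps c lm_\<iota> one_mem)
  have ex: "\<exists>d. bop_apply (lm p) (bop_apply (lm y) s') = d *\<^sub>C \<iota> p" if y: "y \<in> M" for y
  proof -
    \<comment> \<open>Subtracting a scalar leaves commutators unchanged, and \<open>p s' = 0\<close>
      removes one term, so \<open>p y s'\<close> is \<open>p\<close> applied to an element of
      \<open>S\<close>.\<close>
    have "commutator y s = commutator y s'" using y by (simp add: s'_def commutator_diff commutator_scaleC commutator_\<iota>_one)
    then have "bop_apply (lm p) (commutator y s) = bop_apply (lm p) (bop_apply (lm y) s')"
      using p y by (simp add: commutator_def bop_linear_simps lm_rm_commute_vec ps')
    then show ?thesis using scalar[OF inv[OF y s]] by simp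
  qed
  have "s' = 0"
  proof (rule ccontr)
    assume "s' \<noteq> 0"
    then obtain z where z: "z \<in> M" "bop_apply (lm p) (bop_apply (lm z) s') \<noteq> 0"
      using lm_annihilator[OF p(1,3)] by blast
    obtain d where d: "bop_apply (lm p) (bop_apply (lm z) s') = d *\<^sub>C \<iota> p" using ex[OF z(1)] by blast
    have d0: "d \<noteq> 0" using z(2) d by auto
    have "\<exists>c. p * y * p = c *\<^sub>C p" if y: "y \<in> M" for y
    proof -
      \<comment> \<open>Replacing \<open>z\<close> by \<open>y p z\<close> multiplies
        \<open>d p\<close> on the left by \<open>p y\<close>. The outcome is again a multiple of
        \<open>p\<close>, hence so is \<open>p y p\<close>.\<close>
      obtain e where e: "bop_apply (lm p) (bop_apply (lm (y * p * z)) s') = e *\<^sub>C \<iota> p"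
        using ex[of "y * p * z"] y p z by (auto simp: M_intros)
      have "bop_apply (lm p) (bop_apply (lm (y * p * z)) s')
          = bop_apply (lm (p * y)) (bop_apply (lm p) (bop_apply (lm z) s'))"
        using p y z by (simp add: bimodule_simps M_intros mult.assoc)
      also have "\<dots> = d *\<^sub>C \<iota> (p * y * p)" using p y by (simp add: d bop_linear_simps lm_\<iota> M_intros)
      finally have "\<iota> (p * y * p) = (inverse d * e) *\<^sub>C \<iota> p"
        using d0 e by (simp add: scaleC_scaleC[symmetric]) (metis scaleC_scaleC scaleC_one left_inverse)
      then have "\<iota> (p * y * p) = \<iota> ((inverse d * e) *\<^sub>C p)" using p by (simp add: \<iota>_scaleC)
      then show ?thesis using \<iota>_inject p y by (metis M_intros(7,9))
    qed
    then show False using not_minimal[OF p] by blast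
  qed
  then show ?thesis by (auto simp: s'_def)
qed

text \<open>The commutators of \<open>[b, s]\<close> with \<open>a\<close> taken twice and with
  \<open>a\<^sup>2\<close> contain \<open>a\<^sup>2 s b\<close> with equal signs and
  \<open>b s a\<^sup>2\<close> with opposite signs, so their sum isolates the former. Commutators
  with \<open>a x a\<close> and \<open>b y b\<close> then act from one side only.\<close>

lemma orthogonal_corner_mem:
  assumes S: "closed_csubspace S" and inv: "\<And>x s. x \<in> M \<Longrightarrow> s \<in> S \<Longrightarrow> commutator x s \<in> S"
    and ab: "a \<in> M" "b \<in> M" "a * b = 0" "b * a = 0" and xy: "x \<in> M" "y \<in> M" and s: "s \<in> S"
  shows "bop_apply (rm (b * b * y * b)) (bop_apply (lm (a * x * a * a * a)) s) \<in> S"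
proof -
  note S' = closed_csubspaceD[OF S]
  have ab0: "a * (b * z) = 0" "b * (a * z) = 0" for z
    using ab(3,4) by (simp_all flip: mult.assoc)
  let ?asb = "bop_apply (rm b) (bop_apply (lm a) s)" and ?bsa = "bop_apply (rm a) (bop_apply (lm b) s)"
  let ?aasb = "bop_apply (rm b) (bop_apply (lm (a * a)) s)" and ?bsaa = "bop_apply (rm (a * a)) (bop_apply (lm b) s)"
  have 1: "commutator a (commutator b s) = - (?asb + ?bsa)"
    using ab by (simp add: commutator_def bop_linear_simps bimodule_simps M_intros bop_apply_simps)
  have 2: "commutator a (commutator a (commutator b s)) = ?bsaa - ?aasb"
    unfolding 1 using ab by (simp add: commutator_def bop_linear_simps bimodule_simps M_intros bop_apply_simps)
  have 3: "commutator (a * a) (commutator b s) = - (?aasb + ?bsaa)"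
    using ab ab0 by (simp add: commutator_def bop_linear_simps bimodule_simps M_intros bop_apply_simps mult.assoc)
  have "commutator a (commutator a (commutator b s)) + commutator (a * a) (commutator b s) \<in> S"
    using ab s by (intro S'(3) inv M_intros)
  then have "(- 1 / 2) *\<^sub>R (commutator a (commutator a (commutator b s)) + commutator (a * a) (commutator b s)) \<in> S" by (rule S'(7))
  moreover have "commutator a (commutator a (commutator b s)) + commutator (a * a) (commutator b s) = (- 2) *\<^sub>R ?aasb"
    unfolding 2 3 by (simp add: scaleR_2)
  ultimately have t: "?aasb \<in> S" by simp
  have "commutator (a * x * a) ?aasb = bop_apply (rm b) (bop_apply (lm (a * x * a * a * a)) s)" (is "_ = ?t")
    using ab ab0 xy by (simp add: commutator_def bimodule_simps M_intros bop_apply_simps mult.assoc)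
  then have t2: "?t \<in> S" using inv[OF _ t, of "a * x * a"] ab xy by (simp add: M_intros)
  have "commutator (b * y * b) ?t = - bop_apply (rm (b * b * y * b)) (bop_apply (lm (a * x * a * a * a)) s)"
    using ab ab0 xy by (simp add: commutator_def bimodule_simps M_intros bop_apply_simps mult.assoc)
  then show ?thesis
    using S'(5)[OF inv[OF _ t2, of "b * y * b"]] ab xy by (simp add: M_intros)
qed

lemma commutator_invariant_trivial:
  assumes S: "closed_csubspace S" and inv: "\<And>x s. x \<in> M \<Longrightarrow> s \<in> S \<Longrightarrow> commutator x s \<in> S"
    and S0: "\<And>s. s \<in> S \<Longrightarrow> cinner s (\<iota> 1) = 0"
  shows "S = {0} \<or> S = {v. cinner v (\<iota> 1) = 0}"
proof -
  note S' = closed_csubspaceD[OF S]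
  obtain a b where ab: "a \<in> M" "b \<in> M" "adj a = a" "adj b = b" "a \<noteq> 0" "b \<noteq> 0" "a * b = 0" "b * a = 0"
    by (rule exists_orthogonal_selfadjoint)
  show ?thesis
  proof (cases "\<forall>s\<in>S. bop_apply (rm (b * b)) (bop_apply (lm (a * a * a)) s) = 0")
    case True
    \<comment> \<open>\<open>x\<^sup>* x = 0\<close> only for \<open>x = 0\<close>, so
      \<open>a\<^sup>2\<close> and \<open>a\<^sup>4\<close> do not vanish, and neither does
      \<open>a\<^sup>3\<close>.\<close>
    have aa: "a * a \<noteq> 0" "b * b \<noteq> 0"
      using adj_self_mult_eq_0[of a] adj_self_mult_eq_0[of b] ab by auto
    then have "a * a * a * a \<noteq> 0" using adj_self_mult_eq_0[of "a * a"] ab by (auto simp: mult.assoc)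
    then have aaa: "a * a * a \<noteq> 0" by auto
    have "s = 0" if s: "s \<in> S" for s
    proof -
      have "\<exists>c. s = c *\<^sub>C \<iota> 1"
        by (rule corner_null_scalar[of "a * a * a" "b * b" S])
          (use ab aa aaa True s inv in \<open>simp_all add: M_intros mult.assoc\<close>)
      then obtain c where c: "s = c *\<^sub>C \<iota> 1" by blast
      then have "c = 0" using S0[OF s] by (simp add: cinner_simps cinner_self norm_\<iota>_one)
      then show ?thesis using c by simp
    qed
    then show ?thesis using S'(2) by blast
  next
    case False
    then obtain s where s: "s \<in> S" "bop_apply (rm (b * b)) (bop_apply (lm (a * a * a)) s) \<noteq> 0" by blast
    let ?w = "bop_apply (rm (b * b)) (bop_apply (lm (a * a * a)) s)"
    \<comment> \<open>\<open>T\<close> consists of the \<open>t\<close> with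
      \<open>a x t y b \<in> S\<close> for all \<open>x\<close> and \<open>y\<close>; the free
      factors make it a sub-bimodule although \<open>S\<close> is not known to be one.\<close>
    define T where "T = (\<Inter>x\<in>M. \<Inter>y\<in>M. {t. bop_apply (rm b * rm y * lm a * lm x) t \<in> S})"
    have T: "t \<in> T \<longleftrightarrow> (\<forall>x\<in>M. \<forall>y\<in>M. bop_apply (rm b) (bop_apply (rm y) (bop_apply (lm a) (bop_apply (lm x) t))) \<in> S)" for t
      by (simp add: T_def bop_apply_simps)
    have cl: "closed {t. bop_apply U t \<in> S}" for U :: "'k bop"
    proof -
      have "closed (bop_apply U -` S)"
        by (rule closed_vimage[OF S'(1)]) (rule linear_continuous_on[OF bop_bounded_linear])
      then show ?thesis by (simp add: vimage_def)
    qed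
    have "closed T" unfolding T_def by (intro closed_INT ballI cl)
    then have Tsub: "closed_csubspace T"
      by (simp add: closed_csubspace_def T bop_linear_simps S')
    have w: "?w \<in> T" unfolding T
    proof (intro ballI)
      fix x y assume "x \<in> M" "y \<in> M"
      then show "bop_apply (rm b) (bop_apply (rm y) (bop_apply (lm a) (bop_apply (lm x) ?w))) \<in> S"
        using orthogonal_corner_mem[OF S inv, of a b x y s] ab s
        by (simp add: bimodule_simps M_intros mult.assoc)
    qed
    have TU: "v \<in> T" for v
    proof (rule bimodule_trivial[OF Tsub w s(2)])
      fix z v assume zv: "z \<in> M" "v \<in> T"
      show "bop_apply (lm z) v \<in> T" unfolding T
      proof (intro ballI)
        fix x y assume "x \<in> M" "y \<in> M"
        then show "bop_apply (rm b) (bop_apply (rm y) (bop_apply (lm a) (bop_apply (lm x) (bop_apply (lm z) v)))) \<in> S"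
          using zv(2)[unfolded T, rule_format, of "x * z" y] zv(1) by (simp add: lm_lm[of x z] mult_mem)
      qed
      show "bop_apply (rm z) v \<in> T" unfolding T
      proof (intro ballI)
        fix x y assume "x \<in> M" "y \<in> M"
        then show "bop_apply (rm b) (bop_apply (rm y) (bop_apply (lm a) (bop_apply (lm x) (bop_apply (rm z) v)))) \<in> S"
          using zv(2)[unfolded T, rule_format, of x "z * y"] zv(1) ab
          by (simp add: bimodule_simps M_intros mult.assoc)
      qed
    qed
    have corner: "bop_apply (rm b) (bop_apply (lm a) v) \<in> S" for v
      using TU[of v, unfolded T, rule_format, OF one_mem one_mem] by (simp add: bop_apply_simps)
    \<comment> \<open>The complement inherits commutator invariance by passing to adjoints. The map
      \<open>t \<mapsto> a t b\<close> annihilates it, being self-adjoint with range in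
      \<open>S\<close>.\<close>
    have "\<exists>c. t = c *\<^sub>C \<iota> 1" if t: "t \<in> ortho S" for t
    proof (rule corner_null_scalar[OF ab(1,3,5,2,6) _ _ t])
      show "commutator x s \<in> ortho S" if "x \<in> M" "s \<in> ortho S" for x s
        using that inv[OF adj_mem] by (simp add: ortho_def cinner_commutator)
      show "bop_apply (rm b) (bop_apply (lm a) s) = 0" if "s \<in> ortho S" for s
      proof -
        let ?v = "bop_apply (rm b) (bop_apply (lm a) s)"
        have "cinner ?v ?v = cinner s (bop_apply (adj (lm a)) (bop_apply (adj (rm b)) ?v))"
          by (simp only: cinner_adj_right)
        also have "\<dots> = cinner s (bop_apply (rm b) (bop_apply (lm a) ?v))"
          using ab by (simp add: adj_lm adj_rm lm_rm_commute_vec)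
        also have "\<dots> = 0" using that corner by (simp add: ortho_def)
        finally show ?thesis by (simp add: cinner_self_eq_0_iff)
      qed
    qed
    \<comment> \<open>Since the complement contains only scalars, every vector orthogonal to 1 is
      orthogonal to the complement and so lies in \<open>S\<close>.\<close>
    then have "v \<in> ortho (ortho S)" if "cinner v (\<iota> 1) = 0" for v
      unfolding ortho_def[of "ortho S"] using that by (force simp: cinner_scaleC_right)
    then have "{v. cinner v (\<iota> 1) = 0} \<subseteq> S" using ortho_ortho_subset[OF S] by blast
    then show ?thesis using S0 by blast
  qed
qed

section \<open>The representation of the inner automorphisms\<close>

lemma inner_rep_Ad:
  assumes u: "u \<in> M" shows "inner_rep M \<iota> (Ad M u) = Adv u"
  unfolding inner_rep_def
proof (rule the_equality)
  show *: "\<forall>x\<in>M. bop_apply (Adv u) (\<iota> x) = \<iota> (Ad M u x)" using u by (simp add: Adv_\<iota> Ad_def)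
  show "T = Adv u" if "\<forall>x\<in>M. bop_apply T (\<iota> x) = \<iota> (Ad M u x)" for T
    by (rule bop_dense_eqI) (simp add: that *)
qed

lemma compose_Ad:
  assumes "u \<in> M" "w \<in> M" shows "compose M (Ad M u) (Ad M w) = Ad M (u * w)"
  using assms by (auto simp: compose_def Ad_def M_intros mult.assoc fun_eq_iff restrict_def)

lemma unitary_rep_inner: "unitary_rep (Inn M) (inner_rep M \<iota>)"
  unfolding unitary_rep_def
proof (rule homI)
  fix g assume "g \<in> carrier (Inn M)"
  then obtain u where u: "g = Ad M u" "u \<in> M" "unitary_op u" by (auto simp: Inn_def)
  show "inner_rep M \<iota> g \<in> carrier unitary_group"
    using u by (simp add: unitary_group_def inner_rep_Ad unitary_Adv)
  fix h assume "h \<in> carrier (Inn M)"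
  then obtain w where w: "h = Ad M w" "w \<in> M" "unitary_op w" by (auto simp: Inn_def)
  show "inner_rep M \<iota> (g \<otimes>\<^bsub>Inn M\<^esub> h) = inner_rep M \<iota> g \<otimes>\<^bsub>unitary_group\<^esub> inner_rep M \<iota> h"
    using u w by (simp add: Inn_def unitary_group_def compose_Ad inner_rep_Ad M_intros Adv_mult)
qed

lemma irreducible_on_trace_zero:
  "irreducible_on (Inn M) (inner_rep M \<iota>) {v. cinner v (\<iota> 1) = 0}"
proof -
  let ?L = "{v. cinner v (\<iota> 1) = 0}"
  have inv_iff: "invariant_subspace (Inn M) (inner_rep M \<iota>) S \<longleftrightarrow>
      closed_csubspace S \<and> (\<forall>u v. u \<in> M \<longrightarrow> unitary_op u \<longrightarrow> v \<in> S \<longrightarrow> bop_apply (Adv u) v \<in> S)" for S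
    unfolding invariant_subspace_def Inn_def by (auto simp: inner_rep_Ad image_subset_iff)
  have one: "central (\<iota> 1)" using central_\<iota>_one[of 1] by (simp add: scaleC_one)
  have "closed_csubspace ?L"
    using closed_csubspace_ortho[of "{\<iota> 1}"] by (simp add: ortho_def)
  \<comment> \<open>A single conjugation is a special average, and averages preserve the pairing
    with the central vector \<open>\<iota> 1\<close>.\<close>
  moreover have "cinner (bop_apply (Adv u) v) (\<iota> 1) = cinner v (\<iota> 1)" if "u \<in> M" "unitary_op u" for u v
    by (rule avg_cinner_central[OF one avg.conj[OF avg.base that]])
  ultimately have "invariant_subspace (Inn M) (inner_rep M \<iota>) ?L" by (simp add: inv_iff)
  moreover have "S = {0} \<or> S = ?L" if S: "invariant_subspace (Inn M) (inner_rep M \<iota>) S" "S \<subseteq> ?L" for S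
  proof (rule commutator_invariant_trivial)
    show sub: "closed_csubspace S" using S(1) by (simp add: inv_iff)
    show "commutator x s \<in> S" if "x \<in> M" "s \<in> S" for x s
      using that S(1) by (intro Adv_invariant_commutator[OF sub]) (simp_all add: inv_iff)
    show "cinner s (\<iota> 1) = 0" if "s \<in> S" for s using that S(2) by blast
  qed
  ultimately show ?thesis by (simp add: irreducible_on_def)
qed

end

theorem theorem1:
  fixes M :: "'h::complex_hilbert bop set"
    and tr :: "'h bop \<Rightarrow> complex"
    and \<iota> :: "'h bop \<Rightarrow> 'k::complex_hilbert"
  assumes "II1_factor M"
    and "separable_predual M"
    and "normal_trace M tr"
    and "tr 1 = 1"
    and "L2_completion M tr \<iota>"
  shows "unitary_rep (Inn M) (inner_rep M \<iota>) \<and>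
    irreducible_on (Inn M) (inner_rep M \<iota>) {v. cinner v (\<iota> 1) = 0}"
proof -
  interpret tracial_factor M tr \<iota> using assms by unfold_locales
  show ?thesis using unitary_rep_inner irreducible_on_trace_zero by blast
qed

end
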